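(* Let $G$ be a finite simple graph on the vertices $x_1,\dots,x_n$, let $\Bbbk$ be a field, and let $I(G)\subset S=\Bbbk[x_1,\dots,x_n]$ be the edge ideal of $G$. If $G$ is $(C_4,2K_2)$-free, then $I(G)^s$ has a linear resolution for all $s\geq 2$.
   Context: All graphs are finite and simple. $C_4$ denotes the cycle on 4 vertices, and $2K_2$ denotes its complement graph (two disjoint edges). A graph $G$ is $(C_4,2K_2)$-free if it has no induced subgraph isomorphic to $C_4$ and no induced subgraph isomorphic to $2K_2$. The edge ideal of a graph $G$ with vertices $x_1,\dots,x_n$ is the ideal $I(G)=(x_ix_j : \{x_i,x_j\}\text{ is an edge of }G)$ of $S=\Bbbk[x_1,\dots,x_n]$, where $S$ has the standard grading. For a graded ideal $I\subset S$, let $b_{i,j}(I)$ denote its graded Betti numbers. An ideal $I$ generated in degree $d$ has a linear resolution if for all $i\geq 0$, $b_{i,j}(I)=0$ for all $j\neq i+d$. *)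

theory Defs
  imports "HOL-Library.Poly_Mapping" "Jordan_Normal_Form.Matrix_Kernel"
begin

section \<open>Finite simple graphs\<close>

type_synonym 'a graph = "'a set \<times> 'a set set"

abbreviation verts :: "'a graph \<Rightarrow> 'a set" where "verts \<equiv> fst"
abbreviation edges :: "'a graph \<Rightarrow> 'a set set" where "edges \<equiv> snd"

definition simple_graph :: "'a graph \<Rightarrow> bool" where
  "simple_graph G \<longleftrightarrow> finite (verts G) \<and> edges G \<subseteq> {e. e \<subseteq> verts G \<and> card e = 2}"

definition induced :: "'a graph \<Rightarrow> 'a set \<Rightarrow> 'a graph" where
  "induced G W = (W, {e \<in> edges G. e \<subseteq> W})"

definition graph_iso :: "'a graph \<Rightarrow> 'b graph \<Rightarrow> bool" where
  "graph_iso G H \<longleftrightarrow>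
     (\<exists>f. bij_betw f (verts G) (verts H) \<and> edges H = (\<lambda>e. f ` e) ` edges G)"

definition induced_free :: "'b graph \<Rightarrow> 'a graph \<Rightarrow> bool" where
  "induced_free H G \<longleftrightarrow> \<not> (\<exists>W \<subseteq> verts G. graph_iso (induced G W) H)"

definition complement_graph :: "'a graph \<Rightarrow> 'a graph" where
  "complement_graph G = (verts G, {e. e \<subseteq> verts G \<and> card e = 2} - edges G)"

definition cycle_graph :: "nat \<Rightarrow> nat graph" where
  "cycle_graph n = ({..<n}, {{i, (i + 1) mod n} | i. i < n})"

definition C4 :: "nat graph" where
  "C4 = cycle_graph 4"

definition two_K2 :: "nat graph" where
  "two_K2 = complement_graph C4"


section \<open>Polynomials and ideals\<close>

text \<open>The polynomial ring over \<open>'k\<close> in variables indexed by \<open>'v\<close> is the monoid algebra of the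
  monoid of exponent vectors \<open>'v \<Rightarrow>\<^sub>0 nat\<close>.\<close>

type_synonym ('v, 'k) mpoly = "('v \<Rightarrow>\<^sub>0 nat) \<Rightarrow>\<^sub>0 'k"

definition Var :: "'v \<Rightarrow> ('v, 'k::comm_ring_1) mpoly" where
  "Var v = Poly_Mapping.single (Poly_Mapping.single v 1) 1"

definition mdeg :: "('v \<Rightarrow>\<^sub>0 nat) \<Rightarrow> nat" where
  "mdeg m = (\<Sum>v \<in> Poly_Mapping.keys m. Poly_Mapping.lookup m v)"

definition homogeneous :: "nat \<Rightarrow> ('v, 'k::comm_ring_1) mpoly \<Rightarrow> bool" where
  "homogeneous d p \<longleftrightarrow> (\<forall>m \<in> Poly_Mapping.keys p. mdeg m = d)"

definition ideal_of :: "'r::comm_ring_1 set \<Rightarrow> 'r set" where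
  "ideal_of B = module.span (*) B"

fun ideal_power :: "'r::comm_ring_1 set \<Rightarrow> nat \<Rightarrow> 'r set" where
  "ideal_power I 0 = UNIV"
| "ideal_power I (Suc s) = ideal_of {a * b | a b. a \<in> I \<and> b \<in> ideal_power I s}"

definition graded_max_ideal :: "('v, 'k::comm_ring_1) mpoly set" where
  "graded_max_ideal = ideal_of (range Var)"

definition generated_in_degree :: "nat \<Rightarrow> ('v, 'k::comm_ring_1) mpoly set \<Rightarrow> bool" where
  "generated_in_degree d I \<longleftrightarrow> (\<exists>B. (\<forall>p \<in> B. homogeneous d p) \<and> I = ideal_of B)"

definition edge_ideal :: "'v graph \<Rightarrow> ('v, 'k::comm_ring_1) mpoly set" where
  "edge_ideal G = ideal_of {Var u * Var v | u v. {u, v} \<in> edges G}"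


section \<open>Minimal graded free resolutions and graded Betti numbers\<close>

text \<open>A list \<open>\<tau>\<close> of degrees stands for the graded free module \<open>\<Oplus>\<^sub>b S(-\<tau>\<^sub>b)\<close>, whose \<open>b\<close>-th basis
  element has degree \<open>\<tau>\<^sub>b\<close>; its elements are the vectors of length \<open>length \<tau>\<close>.  A matrix \<open>A\<close> gives
  a degree-preserving homomorphism \<open>\<Oplus>\<^sub>b S(-\<tau>\<^sub>b) \<rightarrow> \<Oplus>\<^sub>a S(-\<sigma>\<^sub>a)\<close> iff each entry \<open>A\<^sub>a\<^sub>b\<close> is zero or
  homogeneous of degree \<open>\<tau>\<^sub>b - \<sigma>\<^sub>a\<close>; stating this as an addition forces the entry to be zero if
  \<open>\<tau>\<^sub>b < \<sigma>\<^sub>a\<close>.\<close>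

definition graded_hom ::
  "nat list \<Rightarrow> nat list \<Rightarrow> ('v, 'k::comm_ring_1) mpoly mat \<Rightarrow> bool" where
  "graded_hom \<tau> \<sigma> A \<longleftrightarrow>
     A \<in> carrier_mat (length \<sigma>) (length \<tau>) \<and>
     (\<forall>a < length \<sigma>. \<forall>b < length \<tau>. \<forall>m \<in> Poly_Mapping.keys (A $$ (a, b)).
        mdeg m + \<sigma> ! a = \<tau> ! b)"

definition mat_image :: "'r::comm_ring_1 mat \<Rightarrow> 'r vec set" where
  "mat_image A = (\<lambda>v. A *\<^sub>v v) ` carrier_vec (dim_col A)"

text \<open>In \<open>\<cdots> \<rightarrow> F\<^sub>2 \<rightarrow> F\<^sub>1 \<rightarrow> F\<^sub>0 \<rightarrow> I \<rightarrow> 0\<close> the module \<open>F\<^sub>i\<close> is given by the degree list \<open>\<sigma> i\<close>, the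
  augmentation \<open>F\<^sub>0 \<rightarrow> I \<subseteq> S\<close> is the one-row matrix \<open>D 0\<close>, and \<open>F\<^sub>i\<^sub>+\<^sub>1 \<rightarrow> F\<^sub>i\<close> is \<open>D (Suc i)\<close>.
  Minimality, that is, the image of \<open>F\<^sub>i\<^sub>+\<^sub>1\<close> lies in \<open>\<mm> F\<^sub>i\<close>, concerns only the maps between the
  free modules, not the augmentation.  Natural numbers suffice as degrees: in a minimal
  resolution of an ideal no basis element maps to zero, so none has negative degree.\<close>

definition minimal_graded_free_resolution ::
  "('v, 'k::field) mpoly set \<Rightarrow> (nat \<Rightarrow> nat list) \<Rightarrow> (nat \<Rightarrow> ('v, 'k) mpoly mat) \<Rightarrow> bool" where
  "minimal_graded_free_resolution I \<sigma> D \<longleftrightarrow>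
     graded_hom (\<sigma> 0) [0] (D 0) \<and>
     (\<forall>i. graded_hom (\<sigma> (Suc i)) (\<sigma> i) (D (Suc i))) \<and>
     (\<lambda>v. v $ 0) ` mat_image (D 0) = I \<and>
     (\<forall>i. mat_kernel (D i) = mat_image (D (Suc i))) \<and>
     (\<forall>i. elements_mat (D (Suc i)) \<subseteq> graded_max_ideal)"

text \<open>\<open>betti I i j\<close> is the number of summands \<open>S(-j)\<close> of \<open>F\<^sub>i\<close> in the minimal graded free resolution
  of \<open>I\<close>, which exists and is unique up to isomorphism for every graded ideal \<open>I\<close> (when \<open>'v\<close> is
  finite).\<close>

definition betti :: "('v::finite, 'k::field) mpoly set \<Rightarrow> nat \<Rightarrow> nat \<Rightarrow> nat" where
  "betti I i j =
     (THE b. \<exists>\<sigma> D. minimal_graded_free_resolution I \<sigma> D \<and> b = count_list (\<sigma> i) j)"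

definition has_linear_resolution :: "('v::finite, 'k::field) mpoly set \<Rightarrow> bool" where
  "has_linear_resolution I \<longleftrightarrow>
     (\<exists>d. generated_in_degree d I \<and> (\<forall>i j. j \<noteq> i + d \<longrightarrow> betti I i j = 0))"

end

theory Submission
  imports Defs
begin

text \<open>The monomials of degree \<open>2s\<close> that generate \<open>I(G)\<^sup>s\<close> are ordered in such a way that each colon ideal
  by the previous monomials is generated by variables. Since an extension of modules with
  \<open>d\<close>-linear resolutions has a \<open>d\<close>-linear resolution, such an ideal has a linear resolution, and all
  its minimal resolutions have the same degrees.

  By a theorem of Foeldes and Hammer, \<open>G\<close> consists of a clique \<open>K\<close>, an independent set \<open>S\<close> and
  possibly a 5-cycle \<open>C\<close> that is completely joined to \<open>K\<close> and not joined to \<open>S\<close>. The order compares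
  exponents in \<open>K\<close> lexicographically, then the degree in \<open>C\<close>, then the exponents in \<open>C\<close>, then those in
  \<open>S\<close>. That a suitable exchange of variables exists is shown by rearranging the edges of a
  multigraph; independent sets obstruct the exchange, and on the 5-cycle these obstructions are
  the five inequalities bounding the exponent sum of two non-adjacent vertices by \<open>s\<close>.\<close>

section \<open>Homogeneous polynomials\<close>

text \<open>The edge ideal of a 5-cycle has no linear resolution, so \<open>s \<ge> 2\<close> must
  enter, and it does so through the monomials supported on the cycle. There all \<open>2 * s\<close>
  units of degree lie in \<open>C\<close>, and the inequalities for non-adjacent pairs leave too
  little slack. One variable from \<open>K\<close> restores enough slack for the lexicographic
  order; hence the two lists of keys.

  \<open>betti\<close> is a definite description over all minimal resolutions. Constructing one
  linear resolution is therefore not enough: every minimal resolution has to be shown linear as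
  well. Both parts only need syzygy modules, so linearity is a coinductive property of modules. This
  allows resolutions of unknown length and replaces mapping cones and Tor by one extension lemma.

  After a move on the cycle no explicit product of edges is at hand; the new monomial is recognised
  by inequalities, which describe exactly the products of edges supported on \<open>K\<close> and
  \<open>C\<close>.\<close>

lemma module_mult: "Modules.module ((*) :: 'r::comm_ring_1 \<Rightarrow> 'r \<Rightarrow> 'r)"
  by unfold_locales (simp_all add: algebra_simps)

lemma ideal_of_base: "b \<in> B \<Longrightarrow> b \<in> ideal_of B"
  unfolding ideal_of_def by (rule Modules.module.span_base[OF module_mult])

lemma ideal_of_zero: "0 \<in> ideal_of B"
  unfolding ideal_of_def by (rule Modules.module.span_zero[OF module_mult])

lemma ideal_of_add: "p \<in> ideal_of B \<Longrightarrow> q \<in> ideal_of B \<Longrightarrow> p + q \<in> ideal_of B"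
  unfolding ideal_of_def by (rule Modules.module.span_add[OF module_mult])

lemma ideal_of_mult: "p \<in> ideal_of B \<Longrightarrow> r * p \<in> ideal_of B"
  unfolding ideal_of_def by (rule Modules.module.span_scale[OF module_mult])

lemma ideal_of_sum: "(\<And>i. i \<in> A \<Longrightarrow> f i \<in> ideal_of B) \<Longrightarrow> sum f A \<in> ideal_of B"
  unfolding ideal_of_def by (rule Modules.module.span_sum[OF module_mult])

lemma ideal_of_minimal:
  assumes "B \<subseteq> J" "0 \<in> J" "\<And>p q. p \<in> J \<Longrightarrow> q \<in> J \<Longrightarrow> p + q \<in> J" "\<And>r p. p \<in> J \<Longrightarrow> r * p \<in> J"
  shows "ideal_of B \<subseteq> J"
  unfolding ideal_of_def
  by (rule Modules.module.span_minimal[OF module_mult])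
    (use assms in \<open>auto simp: Modules.module.subspace_def[OF module_mult]\<close>)

lemma mdeg_UNIV: "mdeg (m :: 'v::finite \<Rightarrow>\<^sub>0 nat) = (\<Sum>v\<in>UNIV. Poly_Mapping.lookup m v)"
  unfolding mdeg_def by (rule sum.mono_neutral_left) (auto simp: in_keys_iff)

lemma mdeg_add [simp]: "mdeg (m + n) = mdeg m + mdeg (n :: 'v::finite \<Rightarrow>\<^sub>0 nat)"
  by (simp add: mdeg_UNIV lookup_add sum.distrib)

lemma mdeg_single [simp]: "mdeg (Poly_Mapping.single v n) = n"
  by (cases "n = 0") (auto simp: mdeg_def)

lemma mdeg_zero [simp]: "mdeg 0 = 0"
  by (simp add: mdeg_def)

lemma mdeg_eq_0_iff [simp]: "mdeg m = 0 \<longleftrightarrow> m = 0"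
  by (auto simp: mdeg_def in_keys_iff poly_mapping_eq_iff fun_eq_iff)

lemma mdeg_eq_1_iff: "mdeg (m :: 'v::finite \<Rightarrow>\<^sub>0 nat) = 1 \<longleftrightarrow> (\<exists>v. m = Poly_Mapping.single v 1)"
proof
  assume *: "mdeg m = 1"
  then obtain v where v: "Poly_Mapping.lookup m v \<noteq> 0"
    by (metis in_keys_iff mdeg_def sum.not_neutral_contains_not_neutral zero_neq_one)
  have "m = (m - Poly_Mapping.single v 1) + Poly_Mapping.single v 1"
    using v by (intro poly_mapping_eqI) (auto simp: lookup_add lookup_minus lookup_single when_def)
  moreover from this have "mdeg (m - Poly_Mapping.single v 1) = 0"
    using * by (metis add_cancel_left_left mdeg_add mdeg_single)
  ultimately show "\<exists>v. m = Poly_Mapping.single v 1"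
    by (metis add_0 mdeg_eq_0_iff)
qed auto

lemma poly_as_sum: "p = (\<Sum>m\<in>Poly_Mapping.keys p. Poly_Mapping.single m (Poly_Mapping.lookup p m))"
  by (rule poly_mapping_eqI)
    (simp add: lookup_sum lookup_single when_def in_keys_iff sum.delta')

lemma homogeneous_zero [simp]: "homogeneous d 0"
  by (simp add: homogeneous_def)

lemma homogeneous_add: "homogeneous d p \<Longrightarrow> homogeneous d q \<Longrightarrow> homogeneous d (p + q)"
  using keys_add[of p q] by (auto simp: homogeneous_def)

lemma homogeneous_uminus: "homogeneous d p \<Longrightarrow> homogeneous d (- p)"
  by (auto simp: homogeneous_def in_keys_iff)

lemma homogeneous_sum: "(\<And>i. i \<in> I \<Longrightarrow> homogeneous d (f i)) \<Longrightarrow> homogeneous d (sum f I)"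
  by (induction I rule: infinite_finite_induct) (auto intro: homogeneous_add)

lemma homogeneous_mult:
  fixes p q :: "('v::finite, 'k::comm_ring_1) mpoly"
  shows "homogeneous d p \<Longrightarrow> homogeneous e q \<Longrightarrow> homogeneous (d + e) (p * q)"
  using keys_mult[of p q] by (fastforce simp: homogeneous_def)

lemma homogeneous_single: "homogeneous (mdeg m) (Poly_Mapping.single m c)"
  by (simp add: homogeneous_def)

lemma homogeneous_one: "homogeneous 0 (1 :: ('v, 'k::comm_ring_1) mpoly)"
  by (simp add: homogeneous_def)

section \<open>Homogeneous components and constant coefficients\<close>

definition hcomp :: "nat \<Rightarrow> ('v, 'k::comm_ring_1) mpoly \<Rightarrow> ('v, 'k) mpoly" where
  "hcomp d p = Poly_Mapping.mapp (\<lambda>m c. if mdeg m = d then c else 0) p"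

lemma lookup_hcomp: "Poly_Mapping.lookup (hcomp d p) m = (if mdeg m = d then Poly_Mapping.lookup p m else 0)"
  by (auto simp: hcomp_def lookup_mapp when_def in_keys_iff)

lemma homogeneous_hcomp: "homogeneous d (hcomp d p)"
  by (auto simp: homogeneous_def in_keys_iff lookup_hcomp split: if_splits)

lemma hcomp_add: "hcomp d (p + q) = hcomp d p + hcomp d q"
  by (rule poly_mapping_eqI) (simp add: lookup_hcomp lookup_add)

lemma hcomp_zero [simp]: "hcomp d 0 = 0"
  by (rule poly_mapping_eqI) (simp add: lookup_hcomp)

lemma hcomp_sum: "hcomp d (sum f I) = (\<Sum>i\<in>I. hcomp d (f i))"
  by (induction I rule: infinite_finite_induct) (auto simp: hcomp_add)

lemma hcomp_homogeneous: "homogeneous e p \<Longrightarrow> hcomp d p = (if e = d then p else 0)"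
  by (rule poly_mapping_eqI) (auto simp: lookup_hcomp homogeneous_def in_keys_iff)

lemma hcomp_mult:
  fixes p q :: "('v::finite, 'k::comm_ring_1) mpoly"
  assumes "homogeneous e q"
  shows "hcomp d (p * q) = (if e \<le> d then hcomp (d - e) p * q else 0)"
proof -
  have *: "hcomp d (Poly_Mapping.single m c * q) =
      (if e \<le> d then hcomp (d - e) (Poly_Mapping.single m c) * q else 0)" for m and c :: 'k
    using homogeneous_mult[OF homogeneous_single assms, of m c]
    by (auto simp: hcomp_homogeneous[OF homogeneous_single] hcomp_homogeneous)
  have "hcomp d (p * q) = (\<Sum>m\<in>Poly_Mapping.keys p. hcomp d (Poly_Mapping.single m (Poly_Mapping.lookup p m) * q))"
    by (subst poly_as_sum[of p]) (simp add: sum_distrib_right hcomp_sum)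
  also have "\<dots> = (if e \<le> d then hcomp (d - e) (\<Sum>m\<in>Poly_Mapping.keys p. Poly_Mapping.single m (Poly_Mapping.lookup p m)) * q else 0)"
    by (simp add: * hcomp_sum sum_distrib_right)
  finally show ?thesis by (simp flip: poly_as_sum)
qed

text \<open>Two exponent vectors add up to 0 only if both are 0, so the part of \<open>q\<close>
  without constant term contributes nothing to the constant term of the product. Constant
  coefficients are how minimality of a resolution is tested throughout.\<close>

lemma const_coeff_mult:
  fixes p q :: "('v::finite, 'k::comm_ring_1) mpoly"
  shows "Poly_Mapping.lookup (p * q) 0 = Poly_Mapping.lookup p 0 * Poly_Mapping.lookup q 0"
proof -
  have c: "hcomp 0 p = Poly_Mapping.single 0 (Poly_Mapping.lookup p 0)" for p :: "('v, 'k) mpoly"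
    by (rule poly_mapping_eqI) (auto simp: lookup_hcomp lookup_single when_def)
  have add_eq_0: "b = 0" if "0 = a + b" for a b :: "'v \<Rightarrow>\<^sub>0 nat"
    by (metis that add_is_0 mdeg_add mdeg_eq_0_iff mdeg_zero)
  have hq: "hcomp 0 (p * q) = hcomp 0 p * hcomp 0 q"
  proof -
    have "hcomp 0 (p * (q - hcomp 0 q)) = 0"
    proof -
      have "0 \<notin> Poly_Mapping.keys (p * (q - hcomp 0 q))"
        using keys_mult[of p "q - hcomp 0 q"]
        using add_eq_0 by (fastforce simp: in_keys_iff lookup_minus lookup_hcomp split: if_splits)
      then show ?thesis
        by (intro poly_mapping_eqI) (auto simp: lookup_hcomp in_keys_iff)
    qed
    moreover have "p * q = p * (q - hcomp 0 q) + p * hcomp 0 q" by (simp add: algebra_simps)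
    ultimately show ?thesis
      by (simp add: hcomp_add hcomp_mult[OF homogeneous_hcomp])
  qed
  have "Poly_Mapping.lookup (p * q) 0 = Poly_Mapping.lookup (hcomp 0 p * hcomp 0 q) 0"
    by (simp add: lookup_hcomp flip: hq)
  then show ?thesis by (simp add: c mult_single)
qed

lemma max_ideal_const_coeff:
  fixes p :: "('v::finite, 'k::comm_ring_1) mpoly"
  assumes "p \<in> graded_max_ideal"
  shows "Poly_Mapping.lookup p 0 = 0"
proof -
  have nz: "Poly_Mapping.single v (Suc 0) \<noteq> 0" for v :: 'v
    by (metis mdeg_single mdeg_zero nat.distinct(1))
  have "graded_max_ideal \<subseteq> {p :: ('v, 'k) mpoly. Poly_Mapping.lookup p 0 = 0}"
    unfolding graded_max_ideal_def
    by (rule ideal_of_minimal) (auto simp: Var_def lookup_single lookup_add const_coeff_mult nz)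
  with assms show ?thesis by auto
qed

lemma linear_form_in_max_ideal:
  fixes p :: "('v::finite, 'k::comm_ring_1) mpoly"
  assumes "homogeneous 1 p"
  shows "p \<in> graded_max_ideal"
proof -
  have "Poly_Mapping.single m (Poly_Mapping.lookup p m) \<in> graded_max_ideal" if "m \<in> Poly_Mapping.keys p" for m
  proof -
    obtain v where "m = Poly_Mapping.single v 1"
      using \<open>m \<in> _\<close> assms mdeg_eq_1_iff[of m] by (auto simp: homogeneous_def)
    then have "Poly_Mapping.single m (Poly_Mapping.lookup p m) =
        Poly_Mapping.single 0 (Poly_Mapping.lookup p m) * Var v"
      by (simp add: Var_def mult_single)
    then show ?thesis
      by (simp add: graded_max_ideal_def ideal_of_base ideal_of_mult)
  qed
  then show ?thesis
    by (subst poly_as_sum) (auto simp: graded_max_ideal_def intro: ideal_of_sum)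
qed

section \<open>Linear quotients of submodules of free modules\<close>

text \<open>Elements of free modules of finite rank are functions on the natural numbers that vanish from the
  rank on. All basis elements are given degree 0, so in a linear resolution every syzygy module is
  generated by vectors of linear forms.\<close>

definition comb :: "nat \<Rightarrow> (nat \<Rightarrow> 'r::comm_ring_1) \<Rightarrow> (nat \<Rightarrow> nat \<Rightarrow> 'r) \<Rightarrow> nat \<Rightarrow> 'r" where
  "comb n c g = (\<lambda>i. \<Sum>j<n. c j * g j i)"

abbreviation zero_mod :: "(nat \<Rightarrow> 'r::comm_ring_1) set" where
  "zero_mod \<equiv> {\<lambda>_. 0}"

text \<open>The kernel of the map from the free module of rank \<open>n\<close> to the ambient
  module modulo \<open>M\<close>. The relative form handles a quotient \<open>M / N\<close> without
  forming it.\<close>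

definition syz :: "nat \<Rightarrow> (nat \<Rightarrow> nat \<Rightarrow> 'r::comm_ring_1) \<Rightarrow> (nat \<Rightarrow> 'r) set \<Rightarrow> (nat \<Rightarrow> 'r) set" where
  "syz n g M = {c. (\<forall>j\<ge>n. c j = 0) \<and> comb n c g \<in> M}"

definition submod :: "(nat \<Rightarrow> 'r::comm_ring_1) set \<Rightarrow> bool" where
  "submod M \<longleftrightarrow> (\<lambda>_. 0) \<in> M \<and> (\<forall>f\<in>M. \<forall>h\<in>M. (\<lambda>i. f i + h i) \<in> M) \<and> (\<forall>r. \<forall>f\<in>M. (\<lambda>i. r * f i) \<in> M)"

definition cover ::
  "nat \<Rightarrow> nat \<Rightarrow> (nat \<Rightarrow> nat \<Rightarrow> ('v::finite, 'k::comm_ring_1) mpoly) \<Rightarrow>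
    (nat \<Rightarrow> ('v, 'k) mpoly) set \<Rightarrow> (nat \<Rightarrow> ('v, 'k) mpoly) set \<Rightarrow> bool" where
  "cover e n g M N \<longleftrightarrow> (\<forall>j<n. g j \<in> M \<and> (\<forall>i. homogeneous e (g j i))) \<and>
     (\<forall>f\<in>M. \<exists>c. (\<lambda>i. f i - comb n c g i) \<in> N)"

lemma coverD: "cover e n g M N \<Longrightarrow> f \<in> M \<Longrightarrow> \<exists>c. (\<lambda>i. f i - comb n c g i) \<in> N"
  by (auto simp: cover_def)

text \<open>Degrees are reset at each step: the basis elements of every free module count as degree
  0, so the same condition with degree 1 recurs forever. The greatest fixed point imposes no bound
  on the length.\<close>

coinductive linear_mod :: "(nat \<Rightarrow> ('v::finite, 'k::comm_ring_1) mpoly) set \<Rightarrow> bool" where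
  "cover 1 n g M zero_mod \<Longrightarrow> linear_mod (syz n g zero_mod) \<Longrightarrow> linear_mod M"

text \<open>\<open>M / N\<close> has a resolution whose generators have degree \<open>e\<close> and
  whose later maps are linear; \<open>e\<close> matters only for the first map.\<close>

definition linear_quot ::
  "nat \<Rightarrow> (nat \<Rightarrow> ('v::finite, 'k::comm_ring_1) mpoly) set \<Rightarrow> (nat \<Rightarrow> ('v, 'k) mpoly) set \<Rightarrow> bool" where
  "linear_quot e M N \<longleftrightarrow> (\<exists>n g. cover e n g M N \<and> linear_mod (syz n g N))"

lemma linear_mod_iff: "linear_mod M \<longleftrightarrow> linear_quot 1 M zero_mod"
  unfolding linear_quot_def by (subst linear_mod.simps) auto

section \<open>Combinations of generators and extensions of modules\<close>

lemma sum_lessThan_add: "(\<Sum>j<m + (n::nat). f j) = (\<Sum>j<m. f j) + (\<Sum>j<n. f (m + j) :: 'a::comm_monoid_add)"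
  by (induction n) (auto simp: ac_simps)

lemma comb_comb: "comb n (comb m a h) g = comb m a (\<lambda>j. comb n (h j) g)"
  unfolding comb_def sum_distrib_left sum_distrib_right
  by (rule ext, subst sum.swap) (simp add: mult.assoc)

lemma comb_diff: "comb n (\<lambda>j. a j - b j) g i = comb n a g i - comb n b g i"
  by (simp add: comb_def algebra_simps sum_subtractf)

lemma comb_cong: "(\<And>j. j < n \<Longrightarrow> a j = b j) \<Longrightarrow> (\<And>j. j < n \<Longrightarrow> g j = h j) \<Longrightarrow> comb n a g = comb n b h"
  by (auto simp: comb_def)

lemma comb_zero [simp]: "comb n (\<lambda>_. 0) g = (\<lambda>_. 0)" "comb n c (\<lambda>_ _. 0) = (\<lambda>_. 0)"
  by (auto simp: comb_def)

lemma comb_append: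
  "comb (n' + n) c (\<lambda>j. if j < n' then g' j else g (j - n')) i =
    comb n' c g' i + comb n (\<lambda>j. c (n' + j)) g i"
  by (simp add: comb_def sum_lessThan_add)

lemma submod_comb:
  assumes "submod M" "\<And>j. j < n \<Longrightarrow> g j \<in> M"
  shows "comb n c g \<in> M"
  using assms(2)
proof (induction n)
  case 0
  then show ?case using assms(1) by (simp add: comb_def submod_def)
next
  case (Suc n)
  have "comb (Suc n) c g = (\<lambda>i. comb n c g i + c n * g n i)" by (simp add: comb_def)
  moreover have "comb n c g \<in> M" "g n \<in> M" using Suc by auto
  ultimately show ?case using assms(1) by (auto simp: submod_def)
qed

lemma submod_zero_mod: "submod zero_mod"
  by (auto simp: submod_def)

lemma submod_syz: "submod M \<Longrightarrow> submod (syz n g M)"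
  unfolding submod_def syz_def
  by (auto simp: comb_def algebra_simps sum.distrib simp flip: sum_distrib_left)

text \<open>Arbitrary coefficients of a homogeneous element may be replaced by their components of
  the right degree.\<close>

lemma cover_lift:
  assumes "cover e n g M zero_mod" "f \<in> M" "\<And>i. homogeneous (e + d) (f i)"
  obtains c where "\<And>j. homogeneous d (c j)" "f = comb n c g"
proof -
  obtain c where c: "(\<lambda>i. f i - comb n c g i) \<in> zero_mod"
    using assms(1,2) by (auto simp: cover_def)
  have "f i = comb n (\<lambda>j. hcomp d (c j)) g i" for i
  proof -
    have "f i = hcomp (e + d) (f i)" by (simp add: hcomp_homogeneous[OF assms(3)])
    also have "\<dots> = hcomp (e + d) (comb n c g i)" using c by (simp add: fun_eq_iff)
    also have "hcomp (e + d) (comb n c g i) = comb n (\<lambda>j. hcomp d (c j)) g i"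
      unfolding comb_def hcomp_sum
      using assms(1) by (intro sum.cong refl) (simp add: cover_def hcomp_mult[where e = e])
    finally show ?thesis .
  qed
  then show ?thesis using that[of "\<lambda>j. hcomp d (c j)"] by (auto simp: homogeneous_hcomp)
qed

text \<open>One step of the horseshoe lemma. Put the generators of \<open>N\<close> first and lifts
  of those of \<open>M / N\<close> after them. Projection to the last \<open>n\<close> coordinates
  identifies the syzygies of \<open>G\<close> modulo those of \<open>g'\<close> with
  \<open>syz n g N\<close>. So the situation of a submodule with linear quotient recurs among the
  syzygies.\<close>

lemma linear_quot_extension_step:
  assumes N: "submod N" "N \<subseteq> M"
    and g': "cover e n' g' N zero_mod"
    and g: "cover e n g M N" "linear_mod (syz n g N)"
  defines "G \<equiv> \<lambda>j. if j < n' then g' j else g (j - n')"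
  shows "cover e (n' + n) G M zero_mod"
    and "linear_quot 1 (syz (n' + n) G zero_mod) (syz n' g' zero_mod)"
    and "syz n' g' zero_mod \<subseteq> syz (n' + n) G zero_mod"
proof -
  note comb_G = comb_append[of n' n _ g' g, folded G_def]
  show "cover e (n' + n) G M zero_mod"
    unfolding cover_def
  proof (intro conjI ballI)
    show "\<forall>j<n' + n. G j \<in> M \<and> (\<forall>i. homogeneous e (G j i))"
      using g g' N(2) by (auto simp: G_def cover_def)
  next
    fix f assume "f \<in> M"
    then obtain c where "(\<lambda>i. f i - comb n c g i) \<in> N" using g by (auto simp: cover_def)
    then obtain c' where c': "(\<lambda>i. f i - comb n c g i - comb n' c' g' i) \<in> zero_mod"
      using coverD[OF g'] by blast
    let ?c = "\<lambda>j. if j < n' then c' j else c (j - n')"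
    have "comb n' ?c g' = comb n' c' g'" by (rule comb_cong) auto
    then have "(\<lambda>i. f i - comb (n' + n) ?c G i) = (\<lambda>i. f i - comb n c g i - comb n' c' g' i)"
      by (simp add: comb_G fun_eq_iff)
    then have "(\<lambda>i. f i - comb (n' + n) ?c G i) \<in> zero_mod" using c' by (simp only:)
    then show "\<exists>c. (\<lambda>i. f i - comb (n' + n) c G i) \<in> zero_mod" by (intro exI[of _ ?c])
  qed
  show "syz n' g' zero_mod \<subseteq> syz (n' + n) G zero_mod"
    by (auto simp: syz_def fun_eq_iff comb_G)
  have low: "comb (n' + n) c G = comb n' c g'" if "\<And>j. j \<ge> n' \<Longrightarrow> c j = 0" for c
    using that by (auto simp: fun_eq_iff comb_G)
  obtain m h where h: "cover 1 m h (syz n g N) zero_mod" "linear_mod (syz m h zero_mod)"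
    using g(2)[unfolded linear_mod_iff[of "syz n g N"]] by (auto simp: linear_quot_def)
  have "\<exists>c'. (\<forall>i. homogeneous 1 (c' i)) \<and> comb n (h j) g = comb n' c' g'" if "j < m" for j
  proof -
    have "h j \<in> syz n g N" "\<And>i. homogeneous 1 (h j i)" using h(1) that by (auto simp: cover_def)
    then have "comb n (h j) g \<in> N" "\<And>i. homogeneous (e + 1) (comb n (h j) g i)"
      using g(1) unfolding add.commute[of e]
      by (auto simp: syz_def comb_def cover_def intro!: homogeneous_sum homogeneous_mult simp del: One_nat_def)
    from cover_lift[OF g' this] show ?thesis by metis
  qed
  then obtain c' where c': "\<And>j i. j < m \<Longrightarrow> homogeneous 1 (c' j i)"
      "\<And>j. j < m \<Longrightarrow> comb n (h j) g = comb n' (c' j) g'"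
    by metis
  \<comment> \<open>A linear syzygy \<open>h j\<close> of \<open>M / N\<close> maps to an element of
    \<open>N\<close> of degree \<open>e + 1\<close>, hence to a combination of \<open>g'\<close>
    with linear coefficients \<open>c' j\<close>. Subtracting it gives a syzygy of \<open>G\<close>,
    again linear.\<close>
  define H where "H j i = (if i < n' then - c' j i else h j (i - n'))" for j i
  have upper: "comb m a H (n' + i) = comb m a h i" for a i by (simp add: comb_def H_def)
  have combH: "comb (n' + n) (H j) G = (\<lambda>_. 0)" if "j < m" for j
  proof
    fix i
    have "comb n' (H j) g' i = - comb n' (c' j) g' i"
      by (simp add: comb_def H_def sum_negf)
    then show "comb (n' + n) (H j) G i = 0"
      using c'(2)[OF that] by (simp add: comb_G H_def)
  qed
  have combH': "comb (n' + n) (comb m a H) G = (\<lambda>_. 0)" for a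
  proof -
    have "comb m a (\<lambda>j. comb (n' + n) (H j) G) = comb m a (\<lambda>_ _. 0)"
      by (rule comb_cong) (auto simp: combH)
    then show ?thesis by (simp add: comb_comb)
  qed
  have "cover 1 m H (syz (n' + n) G zero_mod) (syz n' g' zero_mod)"
    unfolding cover_def
  proof (intro conjI ballI allI impI)
    fix j i assume j: "j < m"
    then have hj: "h j \<in> syz n g N" "\<And>i. homogeneous 1 (h j i)" using h(1) by (auto simp: cover_def)
    show "homogeneous 1 (H j i)"
      using hj c'(1)[OF j] by (simp add: H_def homogeneous_uminus)
    show "H j \<in> syz (n' + n) G zero_mod"
      using hj(1) combH[OF j] by (auto simp: syz_def H_def)
  next
    fix z assume z: "z \<in> syz (n' + n) G zero_mod"
    then have z0: "comb n' z g' i + comb n (\<lambda>j. z (n' + j)) g i = 0" for i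
      by (auto simp: syz_def fun_eq_iff comb_G)
    have "comb n (\<lambda>j. z (n' + j)) g = comb n' (\<lambda>j. - z j) g'"
    proof
      fix i
      have "comb n' (\<lambda>j. - z j) g' i = - comb n' z g' i" by (simp add: comb_def sum_negf)
      then show "comb n (\<lambda>j. z (n' + j)) g i = comb n' (\<lambda>j. - z j) g' i"
        using z0[of i] by (metis add_eq_0_iff)
    qed
    also have "\<dots> \<in> N" using g' by (intro submod_comb[OF N(1)]) (auto simp: cover_def)
    finally have "(\<lambda>j. z (n' + j)) \<in> syz n g N" using z by (auto simp: syz_def)
    then obtain a where "(\<lambda>i. z (n' + i) - comb m a h i) \<in> zero_mod"
      using coverD[OF h(1)] by blast
    then have a: "z (n' + i) = comb m a h i" for i by (auto dest: fun_cong)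
    \<comment> \<open>After subtraction of the lifted combination the last \<open>n\<close>
      coordinates vanish, so the rest is a syzygy of \<open>g'\<close>.\<close>
    let ?r = "\<lambda>i. z i - comb m a H i"
    have r0: "?r i = 0" if "i \<ge> n'" for i
      using a[of "i - n'"] upper[of a "i - n'"] that by simp
    have "comb n' ?r g' = (\<lambda>i. comb (n' + n) z G i - comb (n' + n) (comb m a H) G i)"
      using low[of ?r, OF r0] by (simp add: comb_diff fun_eq_iff)
    also have "\<dots> = (\<lambda>_. 0)" using z by (simp add: combH' syz_def)
    finally show "\<exists>c. (\<lambda>i. z i - comb m c H i) \<in> syz n' g' zero_mod"
      using r0 by (auto simp: syz_def intro!: exI[of _ a])
  qed
  moreover have "syz m H (syz n' g' zero_mod) = syz m h zero_mod"
  proof -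
    have "comb m a H \<in> syz n' g' zero_mod \<longleftrightarrow> comb m a h \<in> zero_mod" for a
    proof
      assume "comb m a H \<in> syz n' g' zero_mod"
      then show "comb m a h \<in> zero_mod"
        using upper[of a] by (simp add: syz_def fun_eq_iff)
    next
      assume "comb m a h \<in> zero_mod"
      then have 0: "comb m a H i = 0" if "i \<ge> n'" for i
        using upper[of a "i - n'"] that by auto
      with low[of "comb m a H"] show "comb m a H \<in> syz n' g' zero_mod"
        by (auto simp: syz_def combH')
    qed
    then show ?thesis by (auto simp: syz_def)
  qed
  ultimately show "linear_quot 1 (syz (n' + n) G zero_mod) (syz n' g' zero_mod)"
    using h(2) unfolding linear_quot_def by metis
qed

text \<open>The coinduction invariant is the existence of a suitable \<open>N\<close>. It passes
  from \<open>M\<close> to its syzygies, with the syzygies of \<open>N\<close> as the new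
  submodule.\<close>

lemma linear_mod_extension:
  assumes "submod N" "N \<subseteq> M" "linear_mod N" "linear_quot 1 M N"
  shows "linear_mod M"
proof -
  have "\<exists>N. submod N \<and> N \<subseteq> M \<and> linear_mod N \<and> linear_quot 1 M N" using assms by auto
  then show ?thesis
  proof (coinduction arbitrary: M)
    case linear_mod
    then obtain N where N: "submod N" "N \<subseteq> M" "linear_mod N" "linear_quot 1 M N" by auto
    then obtain n' g' n g where
      "cover 1 n' g' N zero_mod" "linear_mod (syz n' g' zero_mod)"
      "cover 1 n g M N" "linear_mod (syz n g N)"
      using N(3)[unfolded linear_mod_iff[of N]] N(4) by (auto simp: linear_quot_def)
    with linear_quot_extension_step[OF N(1,2), of 1 n' g' n g] submod_syz[OF submod_zero_mod, of n' g']
    show ?case by blast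
  qed
qed

lemma linear_quot_extension:
  assumes "submod N" "N \<subseteq> M" "linear_quot e N zero_mod" "linear_quot e M N"
  shows "linear_quot e M zero_mod"
proof -
  obtain n' g' n g where
    "cover e n' g' N zero_mod" "linear_mod (syz n' g' zero_mod)"
    "cover e n g M N" "linear_mod (syz n g N)"
    using assms by (auto simp: linear_quot_def)
  with linear_quot_extension_step[OF assms(1,2), of e n' g' n g]
    linear_mod_extension[OF submod_syz[OF submod_zero_mod, of n' g']]
  show ?thesis unfolding linear_quot_def by blast
qed

section \<open>Monomial ideals with linear quotients\<close>

definition emb :: "'r::comm_ring_1 set \<Rightarrow> (nat \<Rightarrow> 'r) set" where
  "emb J = {f. f 0 \<in> J \<and> (\<forall>i>0. f i = 0)}"

text \<open>Membership is stated for each monomial separately, which makes colon ideals a matter of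
  divisibility; \<open>monomial_ideal_eq\<close> gives the description by generators.\<close>

definition monomial_ideal :: "('v \<Rightarrow>\<^sub>0 nat) set \<Rightarrow> ('v::finite, 'k::comm_ring_1) mpoly set" where
  "monomial_ideal B = {p. \<forall>m\<in>Poly_Mapping.keys p. \<exists>b\<in>B. \<exists>n. m = n + b}"

lemma monomial_ideal_zero: "0 \<in> monomial_ideal B"
  by (simp add: monomial_ideal_def)

lemma monomial_ideal_add: "p \<in> monomial_ideal B \<Longrightarrow> q \<in> monomial_ideal B \<Longrightarrow> p + q \<in> monomial_ideal B"
  using keys_add[of p q] by (auto simp: monomial_ideal_def)

lemma monomial_ideal_mult:
  assumes "p \<in> monomial_ideal B"
  shows "r * p \<in> monomial_ideal B"
  unfolding monomial_ideal_def
proof (clarify)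
  fix m assume "m \<in> Poly_Mapping.keys (r * p)"
  then obtain a m' where "m = a + m'" "m' \<in> Poly_Mapping.keys p" using keys_mult[of r p] by blast
  moreover from this obtain b n where "b \<in> B" "m' = n + b" using assms by (auto simp: monomial_ideal_def)
  ultimately show "\<exists>b\<in>B. \<exists>n. m = n + b" by (auto simp flip: add.assoc)
qed

lemma monomial_ideal_eq:
  fixes B :: "('v::finite \<Rightarrow>\<^sub>0 nat) set"
  shows "(monomial_ideal B :: ('v, 'k::comm_ring_1) mpoly set) = ideal_of ((\<lambda>b. Poly_Mapping.single b 1) ` B)"
proof
  show "monomial_ideal B \<subseteq> ideal_of ((\<lambda>b. Poly_Mapping.single b (1 :: 'k)) ` B)"
  proof
    fix p :: "('v, 'k) mpoly" assume p: "p \<in> monomial_ideal B"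
    have "Poly_Mapping.single m (Poly_Mapping.lookup p m) \<in> ideal_of ((\<lambda>b. Poly_Mapping.single b 1) ` B)"
      if m: "m \<in> Poly_Mapping.keys p" for m
    proof -
      obtain b n where "b \<in> B" "m = n + b" using p m by (auto simp: monomial_ideal_def)
      then have "Poly_Mapping.single m (Poly_Mapping.lookup p m) =
          Poly_Mapping.single n (Poly_Mapping.lookup p m) * Poly_Mapping.single b 1"
        by (simp add: mult_single)
      then show ?thesis using \<open>b \<in> B\<close> by (auto intro: ideal_of_mult ideal_of_base)
    qed
    then show "p \<in> ideal_of ((\<lambda>b. Poly_Mapping.single b 1) ` B)"
      by (subst poly_as_sum) (auto intro: ideal_of_sum)
  qed
  show "ideal_of ((\<lambda>b. Poly_Mapping.single b (1 :: 'k)) ` B) \<subseteq> monomial_ideal B"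
  proof (rule ideal_of_minimal)
    show "(\<lambda>b. Poly_Mapping.single b (1 :: 'k)) ` B \<subseteq> monomial_ideal B"
      by (auto simp: monomial_ideal_def) (metis add_0)
  qed (auto intro: monomial_ideal_zero monomial_ideal_add monomial_ideal_mult)
qed

lemma submod_emb: "submod (emb (monomial_ideal B))"
  by (auto simp: submod_def emb_def intro: monomial_ideal_zero monomial_ideal_add monomial_ideal_mult)

lemma emb_mono: "A \<subseteq> B \<Longrightarrow> emb (monomial_ideal A) \<subseteq> emb (monomial_ideal B)"
  by (auto simp: emb_def monomial_ideal_def) blast

lemma emb_empty: "emb (monomial_ideal {}) = zero_mod"
  by (auto simp: emb_def monomial_ideal_def fun_eq_iff) (metis gr0I)

lemma lookup_times_single:
  fixes p :: "('v::finite, 'k::comm_ring_1) mpoly"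
  shows "Poly_Mapping.lookup (p * Poly_Mapping.single w 1) (m + w) = Poly_Mapping.lookup p m"
proof -
  have "p * Poly_Mapping.single w 1 = (\<Sum>n\<in>Poly_Mapping.keys p. Poly_Mapping.single (n + w) (Poly_Mapping.lookup p n))"
    by (subst poly_as_sum[of p]) (simp add: sum_distrib_right mult_single)
  then show ?thesis
    by (simp add: lookup_sum lookup_single when_def in_keys_iff sum.delta')
qed

lemma keys_times_single:
  fixes p :: "('v::finite, 'k::comm_ring_1) mpoly"
  shows "Poly_Mapping.keys (p * Poly_Mapping.single w 1) = (\<lambda>m. m + w) ` Poly_Mapping.keys p"
proof
  show "Poly_Mapping.keys (p * Poly_Mapping.single w 1) \<subseteq> (\<lambda>m. m + w) ` Poly_Mapping.keys p"
    using keys_mult[of p "Poly_Mapping.single w 1"] by (auto split: if_splits)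
qed (auto simp: in_keys_iff lookup_times_single)

text \<open>The quotient \<open>(J + (x\<^sup>w)) / J\<close> is a shifted copy of \<open>S / (J : x\<^sup>w)\<close>.\<close>

lemma linear_quot_colon:
  fixes B :: "('v::finite \<Rightarrow>\<^sub>0 nat) set"
  assumes colon: "\<And>m. (\<exists>b\<in>B. \<exists>n. m + w = n + b) \<longleftrightarrow> (\<exists>c\<in>C. \<exists>n. m = n + c)"
    and "linear_mod (emb (monomial_ideal C) :: (nat \<Rightarrow> ('v, 'k::comm_ring_1) mpoly) set)"
  shows "linear_quot (mdeg w) (emb (monomial_ideal (insert w B)) :: (nat \<Rightarrow> ('v, 'k) mpoly) set)
    (emb (monomial_ideal B))"
proof -
  define g :: "nat \<Rightarrow> nat \<Rightarrow> ('v, 'k) mpoly"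
    where "g j i = (if i = 0 then Poly_Mapping.single w 1 else 0)" for j i
  have g: "comb 1 c g i = (if i = 0 then c 0 * Poly_Mapping.single w 1 else 0)" for c i
    by (simp add: comb_def g_def)
  have "cover (mdeg w) 1 g (emb (monomial_ideal (insert w B))) (emb (monomial_ideal B))"
    unfolding cover_def
  proof (intro conjI ballI allI impI)
    fix j i :: nat
    show "homogeneous (mdeg w) (g j i)" by (simp add: g_def homogeneous_single)
    show "g j \<in> emb (monomial_ideal (insert w B))"
      by (auto simp: emb_def g_def monomial_ideal_def intro: exI[of _ 0])
  next
    fix f :: "nat \<Rightarrow> ('v, 'k) mpoly" assume f: "f \<in> emb (monomial_ideal (insert w B))"
    define A where "A = {m. \<exists>b\<in>B. \<exists>n. m = n + b}"
    \<comment> \<open>All terms of \<open>f 0\<close> outside the ideal of \<open>B\<close> are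
      multiples of the monomial \<open>w\<close>, so the truncated subtraction of exponents is exact
      division.\<close>
    define q where "q = (\<Sum>m\<in>Poly_Mapping.keys (f 0) - A. Poly_Mapping.single (m - w) (Poly_Mapping.lookup (f 0) m))"
    have "q * Poly_Mapping.single w 1 =
        (\<Sum>m\<in>Poly_Mapping.keys (f 0) - A. Poly_Mapping.single m (Poly_Mapping.lookup (f 0) m))"
      unfolding q_def sum_distrib_right
    proof (rule sum.cong[OF refl])
      fix m assume "m \<in> Poly_Mapping.keys (f 0) - A"
      then obtain n where "m = n + w" using f unfolding emb_def monomial_ideal_def A_def by blast
      then show "Poly_Mapping.single (m - w) (Poly_Mapping.lookup (f 0) m) * Poly_Mapping.single w 1 =
          Poly_Mapping.single m (Poly_Mapping.lookup (f 0) m)"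
        by (simp add: mult_single)
    qed
    then have l: "Poly_Mapping.lookup (q * Poly_Mapping.single w 1) m =
        (if m \<in> A then 0 else Poly_Mapping.lookup (f 0) m)" for m
      by (auto simp: lookup_sum lookup_single when_def in_keys_iff sum.delta')
    have "f 0 - q * Poly_Mapping.single w 1 \<in> monomial_ideal B"
      by (auto simp: monomial_ideal_def in_keys_iff lookup_minus l A_def split: if_splits)
    then have "(\<lambda>i. f i - comb 1 (\<lambda>_. q) g i) \<in> emb (monomial_ideal B)"
      using f by (auto simp: emb_def g simp del: One_nat_def)
    then show "\<exists>c. (\<lambda>i. f i - comb 1 c g i) \<in> emb (monomial_ideal B)"
      by (intro exI[of _ "\<lambda>_. q"])
  qed
  moreover have "syz 1 g (emb (monomial_ideal B)) = emb (monomial_ideal C)"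
  proof -
    have "1 \<le> j \<longleftrightarrow> 0 < j" for j :: nat by auto
    then show ?thesis
      using colon by (auto simp: syz_def emb_def g monomial_ideal_def keys_times_single simp del: One_nat_def)
  qed
  ultimately show ?thesis using assms(2) unfolding linear_quot_def by metis
qed

lemma linear_quot_zero: "linear_quot e zero_mod zero_mod"
proof -
  have "cover e 0 (\<lambda>_ _. 0) zero_mod zero_mod" for e by (auto simp: cover_def comb_def)
  moreover have "syz 0 (\<lambda>_ _. 0) zero_mod = zero_mod" by (auto simp: syz_def comb_def fun_eq_iff)
  moreover have "linear_mod zero_mod"
  proof (coinduction)
    case linear_mod
    show ?case using calculation by metis
  qed
  ultimately show ?thesis unfolding linear_quot_def by metis
qed

abbreviation evar :: "'v \<Rightarrow> ('v \<Rightarrow>\<^sub>0 nat)" where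
  "evar v \<equiv> Poly_Mapping.single v 1"

lemma evar_dvd_iff: "(\<exists>n. m = n + evar v) \<longleftrightarrow> Poly_Mapping.lookup m v > 0"
proof
  assume "Poly_Mapping.lookup m v > 0"
  then have "m = (m - evar v) + evar v"
    by (intro poly_mapping_eqI) (auto simp: lookup_add lookup_minus lookup_single when_def)
  then show "\<exists>n. m = n + evar v" by blast
qed (auto simp: lookup_add)

text \<open>The colon ideal of \<open>X\<close> by a new variable \<open>x\<close> is generated by
  \<open>X\<close> again. The induction hypothesis thus serves twice, for the submodule and for the
  quotient; no Koszul complex is written down.\<close>

lemma linear_mod_variables:
  fixes X :: "'v::finite set"
  shows "linear_mod (emb (monomial_ideal (evar ` X)) :: (nat \<Rightarrow> ('v, 'k::comm_ring_1) mpoly) set)"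
proof (induction X rule: finite_induct[OF finite])
  case 1
  show ?case using linear_quot_zero[of 1] by (simp add: emb_empty linear_mod_iff)
next
  case (2 x X)
  have "(\<exists>b\<in>evar ` X. \<exists>n. m + evar x = n + b) \<longleftrightarrow> (\<exists>c\<in>evar ` X. \<exists>n. m = n + c)" for m :: "'v \<Rightarrow>\<^sub>0 nat"
    using 2 by (auto simp: evar_dvd_iff lookup_add lookup_single when_def simp del: One_nat_def)
  from linear_quot_colon[OF this 2(3)] show ?case
    by (intro linear_mod_extension[OF submod_emb[of "evar ` X"] _ 2(3)])
      (simp_all add: emb_mono subset_insertI)
qed

text \<open>\<open>r w' w\<close> reads: \<open>w'\<close> comes before \<open>w\<close>. An element
  \<open>w\<close> that precedes no other is split off, so the first alternative of the exchange
  hypothesis is excluded for every other \<open>u\<close>. The second one gives a variable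
  \<open>a\<close> that divides any \<open>m\<close> for which \<open>u\<close> divides
  \<open>m + w\<close>, by comparison of exponents at \<open>a\<close>.\<close>

lemma linear_quotients:
  fixes B :: "('v::finite \<Rightarrow>\<^sub>0 nat) set" and r :: "('v \<Rightarrow>\<^sub>0 nat) \<Rightarrow> ('v \<Rightarrow>\<^sub>0 nat) \<Rightarrow> bool"
  assumes "finite B" "\<And>b. b \<in> B \<Longrightarrow> mdeg b = d" "transp r" "asymp r"
    and lq: "\<And>u w. u \<in> B \<Longrightarrow> w \<in> B \<Longrightarrow> u \<noteq> w \<Longrightarrow> r w u \<or>
      (\<exists>a b w'. w' \<in> B \<and> w' + evar b = w + evar a \<and> Poly_Mapping.lookup w a < Poly_Mapping.lookup u a \<and> r w' w)"
  shows "linear_quot d (emb (monomial_ideal B) :: (nat \<Rightarrow> ('v, 'k::comm_ring_1) mpoly) set) zero_mod"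
  using assms
proof (induction "card B" arbitrary: B)
  case 0
  then show ?case by (simp add: emb_empty linear_quot_zero)
next
  case (Suc k)
  then have "B \<noteq> {}" by auto
  then obtain w where w: "w \<in> B" "\<And>u. u \<in> B \<Longrightarrow> u \<noteq> w \<Longrightarrow> \<not> r w u"
    using Finite_Set.bex_max_element[of B r] Suc.prems
    by (meson asymp_on_subset subset_UNIV transp_on_subset)
  define A where "A = B - {w}"
  have B: "B = insert w A" and "w \<notin> A" using w by (auto simp: A_def)
  have IH: "linear_quot d (emb (monomial_ideal A) :: (nat \<Rightarrow> ('v, 'k) mpoly) set) zero_mod"
  proof (rule Suc.hyps(1))
    show "k = card A" "finite A" using Suc.hyps(2) Suc.prems(1) w by (auto simp: A_def)
    \<comment> \<open>The exchanged element \<open>v'\<close> stays in \<open>A\<close>: it comes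
      before \<open>v\<close>, whereas \<open>w\<close> comes before nothing.\<close>
    fix u v assume uv: "u \<in> A" "v \<in> A" "u \<noteq> v"
    then show "r v u \<or> (\<exists>a b v'. v' \<in> A \<and> v' + evar b = v + evar a \<and>
        Poly_Mapping.lookup v a < Poly_Mapping.lookup u a \<and> r v' v)"
      using Suc.prems(5)[of u v] w(2)[of v] unfolding A_def by blast
  qed (use Suc.prems in \<open>auto simp: A_def\<close>)
  \<comment> \<open>These variables visibly lie in the colon ideal; conversely every monomial of the
    colon ideal will be divisible by one of them.\<close>
  define X where "X = {a. \<exists>b w'. w' \<in> A \<and> w' + evar b = w + evar a}"
  have colon: "(\<exists>b\<in>A. \<exists>n. m + w = n + b) \<longleftrightarrow> (\<exists>c\<in>evar ` X. \<exists>n. m = n + c)" for m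
  proof
    assume "\<exists>b\<in>A. \<exists>n. m + w = n + b"
    then obtain u n where u: "u \<in> A" "m + w = n + u" by auto
    then have "u \<in> B" "u \<noteq> w" "\<not> r w u" using w by (auto simp: A_def)
    with Suc.prems(5)[OF this(1) w(1)] obtain a b w' where
      w': "w' \<in> B" "w' + evar b = w + evar a" "Poly_Mapping.lookup w a < Poly_Mapping.lookup u a" "r w' w"
      by auto
    have "w' \<in> A" using w' Suc.prems(4) by (auto simp: A_def dest: asympD)
    then have "a \<in> X" using w' by (auto simp: X_def)
    moreover have "Poly_Mapping.lookup m a + Poly_Mapping.lookup w a = Poly_Mapping.lookup n a + Poly_Mapping.lookup u a"
      using u(2) by (simp flip: lookup_add)
    then have "Poly_Mapping.lookup m a > 0" using w'(3) by linarith
    ultimately show "\<exists>c\<in>evar ` X. \<exists>n. m = n + c" using evar_dvd_iff[of m a] by auto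
  next
    assume "\<exists>c\<in>evar ` X. \<exists>n. m = n + c"
    then obtain a n where a: "a \<in> X" "m = n + evar a" by auto
    then obtain b w' where w': "w' \<in> A" "w' + evar b = w + evar a" by (auto simp: X_def)
    have "m + w = n + (w + evar a)" using a by (simp add: ac_simps)
    also have "\<dots> = (n + evar b) + w'" using w'(2) by (simp add: ac_simps)
    finally show "\<exists>b\<in>A. \<exists>n. m + w = n + b" using w'(1) by blast
  qed
  have "mdeg w = d" using Suc.prems w by auto
  with linear_quot_colon[OF colon linear_mod_variables]
  have "linear_quot d (emb (monomial_ideal B) :: (nat \<Rightarrow> ('v, 'k) mpoly) set) (emb (monomial_ideal A))"
    by (simp add: B)
  moreover have "emb (monomial_ideal A) \<subseteq> emb (monomial_ideal B)" by (rule emb_mono) (simp add: A_def)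
  ultimately show ?case using linear_quot_extension[OF submod_emb _ IH] by blast
qed

section \<open>Minimal generating systems of modules with linear resolutions\<close>

lemma homogeneous_0_eq_0:
  "homogeneous 0 p \<Longrightarrow> Poly_Mapping.lookup p 0 = 0 \<Longrightarrow> p = 0"
  by (rule poly_mapping_eqI) (metis homogeneous_def in_keys_iff lookup_zero mdeg_eq_0_iff)

lemma homogeneous_pos_const_coeff: "homogeneous d p \<Longrightarrow> d > 0 \<Longrightarrow> Poly_Mapping.lookup p 0 = 0"
  by (metis homogeneous_def in_keys_iff less_irrefl mdeg_zero)

lemma const_coeff_comb:
  fixes g :: "nat \<Rightarrow> nat \<Rightarrow> ('v::finite, 'k::comm_ring_1) mpoly"
  shows "Poly_Mapping.lookup (comb n c g i) 0 = (\<Sum>j<n. Poly_Mapping.lookup (c j) 0 * Poly_Mapping.lookup (g j i) 0)"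
  by (simp add: comb_def lookup_sum const_coeff_mult)

lemma homogeneous_comb:
  fixes g :: "nat \<Rightarrow> nat \<Rightarrow> ('v::finite, 'k::comm_ring_1) mpoly"
  shows "(\<And>j. j < n \<Longrightarrow> homogeneous d (c j)) \<Longrightarrow> (\<And>j. j < n \<Longrightarrow> homogeneous e (g j i)) \<Longrightarrow>
    homogeneous (d + e) (comb n c g i)"
  by (auto simp: comb_def intro!: homogeneous_sum homogeneous_mult)

definition unit :: "nat \<Rightarrow> nat \<Rightarrow> 'r::comm_ring_1" where
  "unit j = (\<lambda>i. if i = j then 1 else 0)"

lemma comb_unit: "j < n \<Longrightarrow> comb n (unit j) g = g j"
  by (simp add: comb_def unit_def fun_eq_iff if_distrib[of "\<lambda>x. x * _"] sum.delta cong: if_cong)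

lemma comb_unit_right: "(\<And>i. i \<ge> n \<Longrightarrow> c i = 0) \<Longrightarrow> comb n c unit = c"
  by (auto simp: comb_def unit_def fun_eq_iff if_distrib sum.delta' cong: if_cong)

lemma syz_const_coeff:
  fixes g :: "nat \<Rightarrow> nat \<Rightarrow> ('v::finite, 'k::comm_ring_1) mpoly"
  assumes "linear_mod M" "f \<in> M"
  shows "Poly_Mapping.lookup (f i) 0 = 0"
proof -
  obtain m h where h: "cover 1 m h M zero_mod"
    using assms(1) linear_mod_iff[of M] by (auto simp: linear_quot_def)
  obtain c where "(\<lambda>i. f i - comb m c h i) \<in> zero_mod" using coverD[OF h assms(2)] by blast
  then have "f i = comb m c h i" by (simp add: fun_eq_iff)
  also have "Poly_Mapping.lookup \<dots> 0 = 0"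
    using h unfolding const_coeff_comb
    by (intro sum.neutral) (auto simp: cover_def homogeneous_pos_const_coeff[of 1])
  finally show ?thesis .
qed

text \<open>A graded form of Nakayama's lemma. Expressing \<open>g'\<close> by the linear system
  \<open>g\<close> and back changes \<open>g'\<close> only by a syzygy, and by minimality syzygies
  have no constant terms. This forces all degrees to be \<open>e\<close>. The two base changes are
  then constant and inverse to each other, so linear syzygies can be carried from \<open>g\<close>
  to \<open>g'\<close>.\<close>

lemma minimal_cover:
  fixes g' :: "nat \<Rightarrow> nat \<Rightarrow> ('v::finite, 'k::comm_ring_1) mpoly"
  assumes M: "linear_quot e M zero_mod"
    and g': "\<And>j. j < n' \<Longrightarrow> g' j \<in> M" "\<And>j i. j < n' \<Longrightarrow> homogeneous (\<tau> j) (g' j i)"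
    and gen: "\<And>f. f \<in> M \<Longrightarrow> \<exists>c. f = comb n' c g'"
    and min: "\<And>c j. c \<in> syz n' g' zero_mod \<Longrightarrow> Poly_Mapping.lookup (c j) 0 = 0"
  shows "\<And>j. j < n' \<Longrightarrow> \<tau> j = e" and "linear_mod (syz n' g' zero_mod)"
proof -
  obtain n g where g: "cover e n g M zero_mod" "linear_mod (syz n g zero_mod)"
    using M by (auto simp: linear_quot_def)
  have gM: "g l \<in> M" if "l < n" for l using g(1) that by (auto simp: cover_def)
  show \<tau>: "\<tau> j = e" if j: "j < n'" for j
  proof -
    \<comment> \<open>A zero generator would make \<open>unit j\<close> a syzygy with constant term
      1.\<close>
    have "\<exists>i. g' j i \<noteq> 0"
    proof (rule ccontr)
      assume "\<nexists>i. g' j i \<noteq> 0"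
      then have "unit j \<in> syz n' g' zero_mod"
        using j comb_unit[OF j, of g'] by (auto simp: syz_def unit_def)
      from min[OF this, of j] show False by (simp add: unit_def)
    qed
    then obtain i where i: "g' j i \<noteq> 0" by blast
    have "e \<le> \<tau> j"
    proof (rule ccontr)
      assume lt: "\<not> e \<le> \<tau> j"
      obtain c where "(\<lambda>i. g' j i - comb n c g i) \<in> zero_mod" using coverD[OF g(1) g'(1)[OF j]] by blast
      then have "g' j i = comb n c g i" by (simp add: fun_eq_iff)
      moreover have "hcomp (\<tau> j) (comb n c g i) = 0"
        using g(1) lt unfolding comb_def hcomp_sum
        by (intro sum.neutral) (simp add: cover_def hcomp_mult[where e = e])
      ultimately show False using i hcomp_homogeneous[OF g'(2)[OF j, of i], of "\<tau> j"] by simp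
    qed
    then obtain t where t: "\<tau> j = e + t" by (auto simp: le_iff_add)
    obtain c where c: "\<And>l. homogeneous t (c l)" "g' j = comb n c g"
      using cover_lift[OF g(1) g'(1)[OF j], of t] g'(2)[OF j] t by metis
    have "\<exists>q. g l = comb n' q g'" if "l < n" for l using gen[OF gM[OF that]] .
    then obtain q where q: "\<And>l. l < n \<Longrightarrow> g l = comb n' (q l) g'" by metis
    have "comb n' (comb n c q) g' = g' j"
      unfolding comb_comb c(2) using q by (intro comb_cong) auto
    then have "comb n' (\<lambda>k. unit j k - comb n c q k) g' = (\<lambda>_. 0)"
      by (auto simp: comb_diff comb_unit[OF j])
    moreover have "comb n' (\<lambda>k. if k < n' then unit j k - comb n c q k else 0) g' =
        comb n' (\<lambda>k. unit j k - comb n c q k) g'"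
      by (rule comb_cong) auto
    ultimately have "(\<lambda>k. if k < n' then unit j k - comb n c q k else 0) \<in> syz n' g' zero_mod"
      by (simp add: syz_def)
    \<comment> \<open>The round trip has constant term 1 at \<open>j\<close>, so some
      \<open>c l\<close> has a non-zero constant term. As \<open>c l\<close> is homogeneous of
      degree \<open>t\<close>, this forces \<open>t = 0\<close>.\<close>
    from min[OF this, of j] have "Poly_Mapping.lookup (comb n c q j) 0 = 1"
      using j by (simp add: lookup_minus unit_def)
    then have "\<not> (\<forall>l. Poly_Mapping.lookup (c l) 0 = 0)"
 
      using sum.neutral[of "{..<n}"] by (force simp: const_coeff_comb)
    then have "t = 0" using homogeneous_pos_const_coeff[OF c(1)] by auto
    then show ?thesis by (simp add: t)
  qed
  have cov': "cover e n' g' M zero_mod"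
    unfolding cover_def
  proof (intro conjI ballI allI impI)
    fix f assume "f \<in> M"
    then obtain c where "f = comb n' c g'" using gen by blast
    then show "\<exists>c. (\<lambda>i. f i - comb n' c g' i) \<in> zero_mod" by (auto intro!: exI[of _ c])
  next
    fix j i assume "j < n'"
    then show "homogeneous e (g' j i)" using g'(2)[of j i] \<tau>[of j] by simp
  qed (use g' in auto)
  have trunc: "\<exists>c. (\<forall>j\<ge>k. c j = 0) \<and> (\<forall>j. homogeneous 0 (c j)) \<and> f = comb k c u"
    if cov: "cover e k u M zero_mod" and f: "f \<in> M" "\<And>i. homogeneous e (f i)"
    for k f and u :: "nat \<Rightarrow> nat \<Rightarrow> ('v, 'k) mpoly"
  proof -
    obtain c where c: "\<And>j. homogeneous 0 (c j)" "f = comb k c u"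
      using cover_lift[OF cov f(1), of 0] f(2) by auto
    then show ?thesis
      by (intro exI[of _ "\<lambda>j. if j < k then c j else 0"]) (auto intro!: comb_cong)
  qed
  have "\<exists>c. (\<forall>l\<ge>n. c l = 0) \<and> (\<forall>l. homogeneous 0 (c l)) \<and> g' j = comb n c g" if "j < n'" for j
    using trunc[OF g(1)] g' \<tau> that by auto
  then obtain p where p: "\<And>j l. j < n' \<Longrightarrow> l \<ge> n \<Longrightarrow> p j l = 0" "\<And>j l. j < n' \<Longrightarrow> homogeneous 0 (p j l)"
    "\<And>j. j < n' \<Longrightarrow> g' j = comb n (p j) g" by metis
  have "\<exists>c. (\<forall>j\<ge>n'. c j = 0) \<and> (\<forall>j. homogeneous 0 (c j)) \<and> g l = comb n' c g'" if "l < n" for l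
    using trunc[OF cov'] gM[OF that] g(1) that by (auto simp: cover_def)
  then obtain q where q: "\<And>l j. l < n \<Longrightarrow> j \<ge> n' \<Longrightarrow> q l j = 0" "\<And>l j. l < n \<Longrightarrow> homogeneous 0 (q l j)"
    "\<And>l. l < n \<Longrightarrow> g l = comb n' (q l) g'" by metis
  \<comment> \<open>The difference from the identity is a syzygy, so its constant terms vanish;
    since its entries are also homogeneous of degree 0, they are zero. Stated for general families
    because it is applied in both directions.\<close>
  have inverse: "comb k (a j) b = unit j"
    if j: "j < k'" and a: "\<And>l. homogeneous 0 (a j l)" "v j = comb k (a j) u"
      and b: "\<And>l i. l < k \<Longrightarrow> i \<ge> k' \<Longrightarrow> b l i = 0" "\<And>l i. l < k \<Longrightarrow> homogeneous 0 (b l i)"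
        "\<And>l. l < k \<Longrightarrow> u l = comb k' (b l) v"
      and syz: "\<And>c j. c \<in> syz k' v zero_mod \<Longrightarrow> Poly_Mapping.lookup (c j) 0 = 0"
    for k k' j and a b u v :: "nat \<Rightarrow> nat \<Rightarrow> ('v, 'k) mpoly"
  proof
    fix i
    let ?x = "\<lambda>i. unit j i - comb k (a j) b i"
    have "comb k' (comb k (a j) b) v = v j"
      unfolding comb_comb a(2) using b(3) by (intro comb_cong) auto
    then have "comb k' ?x v = (\<lambda>_. 0)"
      using comb_unit[OF j, of v] by (simp add: fun_eq_iff comb_diff)
    moreover have "?x i = 0" if "i \<ge> k'" for i
      using that j b(1) by (auto simp: unit_def comb_def)
    ultimately have "?x \<in> syz k' v zero_mod" by (simp add: syz_def)
    then have "Poly_Mapping.lookup (?x i) 0 = 0" by (rule syz)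
    moreover have "homogeneous (0 + 0) (comb k (a j) b i)"
      by (rule homogeneous_comb) (use a b in auto)
    then have "homogeneous 0 (?x i)"
      using homogeneous_add[of 0 "unit j i" "- comb k (a j) b i"]
      by (auto simp: unit_def homogeneous_one homogeneous_uminus)
    ultimately have "?x i = 0" by (rule homogeneous_0_eq_0[rotated])
    then show "comb k (a j) b i = unit j i" by simp
  qed
  have pq: "comb n (p j) q = unit j" if "j < n'" for j
    by (rule inverse[where v = g' and u = g and k' = n']) (use that p q min in auto)
  have qp: "comb n' (q l) p = unit l" if "l < n" for l
    by (rule inverse[where v = g and u = g' and k' = n])
      (use that p q syz_const_coeff[OF g(2)] in auto)
  obtain m h where h: "cover 1 m h (syz n g zero_mod) zero_mod" "linear_mod (syz m h zero_mod)"
    using g(2) linear_mod_iff[of "syz n g zero_mod"] by (auto simp: linear_quot_def)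
  have hj: "h j \<in> syz n g zero_mod" if "j < m" for j using h(1) that by (auto simp: cover_def)
  \<comment> \<open>The syzygies of \<open>g\<close> are moved to syzygies of \<open>g'\<close> by
    the constant matrix \<open>q\<close>; as it is invertible, the next syzygy module does not
    change.\<close>
  define h' where "h' = (\<lambda>j. comb n (h j) q)"
  have "cover 1 m h' (syz n' g' zero_mod) zero_mod"
    unfolding cover_def
  proof (intro conjI ballI allI impI)
    fix j i assume j: "j < m"
    have "homogeneous (1 + 0) (comb n (h j) q i)"
      by (rule homogeneous_comb) (use h(1) j q in \<open>auto simp: cover_def\<close>)
    then show "homogeneous 1 (h' j i)" by (simp add: h'_def)
    have "comb n' (h' j) g' = comb n (h j) g"
      unfolding h'_def comb_comb using q(3) by (intro comb_cong) auto
    then show "h' j \<in> syz n' g' zero_mod"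
      using hj[OF j] q(1) by (auto simp: syz_def h'_def comb_def)
  next
    fix c assume c: "c \<in> syz n' g' zero_mod"
    have "comb n (comb n' c p) g = comb n' c g'"
      unfolding comb_comb using p(3) by (intro comb_cong) auto
    then have "comb n' c p \<in> syz n g zero_mod"
      using c p(1) by (auto simp: syz_def comb_def)
    from coverD[OF h(1) this] obtain a where "(\<lambda>i. comb n' c p i - comb m a h i) \<in> zero_mod" by blast
    then have a: "comb n' c p = comb m a h" by (simp add: fun_eq_iff)
    have "c = comb n' c (\<lambda>j. comb n (p j) q)"
    proof -
      have "comb n' c (\<lambda>j. comb n (p j) q) = comb n' c unit" by (intro comb_cong) (auto simp: pq)
      then show ?thesis using c by (simp add: comb_unit_right syz_def)
    qed
    also have "\<dots> = comb n (comb m a h) q" by (simp add: a flip: comb_comb)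
    also have "\<dots> = comb m a h'" unfolding h'_def comb_comb ..
    finally show "\<exists>a. (\<lambda>i. c i - comb m a h' i) \<in> zero_mod" by (auto intro!: exI[of _ a])
  qed
  moreover have "syz m h' zero_mod = syz m h zero_mod"
  proof -
    have "comb m a h' = (\<lambda>_. 0) \<longleftrightarrow> comb m a h = (\<lambda>_. 0)" for a
    proof
      have x: "comb m a h' = comb n (comb m a h) q" by (simp add: h'_def comb_comb)
      show "comb m a h' = (\<lambda>_. 0)" if "comb m a h = (\<lambda>_. 0)" using that by (simp add: x)
      assume 0: "comb m a h' = (\<lambda>_. 0)"
      have "comb m a h = comb n (comb m a h) unit"
        using hj by (intro comb_unit_right[symmetric]) (auto simp: comb_def syz_def)
      also have "\<dots> = comb n (comb m a h) (\<lambda>l. comb n' (q l) p)" by (intro comb_cong) (auto simp: qp)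
      also have "\<dots> = comb n' (comb m a h') p" by (simp add: x comb_comb)
      finally show "comb m a h = (\<lambda>_. 0)" by (simp add: 0)
    qed
    then show ?thesis by (auto simp: syz_def)
  qed
  ultimately show "linear_mod (syz n' g' zero_mod)"
    using h(2) linear_mod.intros by metis
qed

section \<open>Linear resolutions\<close>

definition coeffs :: "nat \<Rightarrow> 'r::comm_ring_1 vec \<Rightarrow> nat \<Rightarrow> 'r" where
  "coeffs n v = (\<lambda>j. if j < n then v $ j else 0)"

lemma comb_coeffs: "comb n (coeffs n v) g = comb n (($) v) g"
  by (rule comb_cong) (auto simp: coeffs_def)

lemma comb_vec: "comb n (($) (vec n c)) g = comb n c g"
  by (rule comb_cong) auto

text \<open>The indices are swapped and the entries padded with zeros, to match families of
  generators \<open>g j i\<close>.\<close>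

definition columns :: "'r::comm_ring_1 mat \<Rightarrow> nat \<Rightarrow> nat \<Rightarrow> 'r" where
  "columns A b a = (if a < dim_row A \<and> b < dim_col A then A $$ (a, b) else 0)"

lemma mult_columns:
  assumes "v \<in> carrier_vec (dim_col A)"
  shows "A *\<^sub>v v = vec (dim_row A) (comb (dim_col A) (($) v) (columns A))"
  using assms
  by (intro eq_vecI) (auto simp: comb_def scalar_prod_def atLeast0LessThan columns_def mult.commute intro!: sum.cong)

lemma comb_columns_ge: "a \<ge> dim_row A \<Longrightarrow> comb n c (columns A) a = 0"
  by (simp add: comb_def columns_def)

lemma vec_comb_columns_eq_0_iff:
  "vec (dim_row A) (comb n c (columns A)) = 0\<^sub>v (dim_row A) \<longleftrightarrow> comb n c (columns A) = (\<lambda>_. 0)"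
proof
  assume *: "vec (dim_row A) (comb n c (columns A)) = 0\<^sub>v (dim_row A)"
  show "comb n c (columns A) = (\<lambda>_. 0)"
  proof
    fix a show "comb n c (columns A) a = 0"
      using arg_cong[OF *, of "\<lambda>v. v $ a"] by (cases "a < dim_row A") (auto simp: comb_columns_ge)
  qed
qed (simp add: zero_vec_def)

lemma mat_kernel_columns:
  "mat_kernel A = {v \<in> carrier_vec (dim_col A). coeffs (dim_col A) v \<in> syz (dim_col A) (columns A) zero_mod}"
  by (auto simp: mat_kernel_def mult_columns syz_def comb_coeffs vec_comb_columns_eq_0_iff)
    (auto simp: coeffs_def)

lemma mat_image_columns:
  "mat_image A = {vec (dim_row A) (comb (dim_col A) c (columns A)) | c. True}"
proof -
  have "vec (dim_row A) (comb (dim_col A) c (columns A)) \<in> mat_image A" for c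
    unfolding mat_image_def
    by (rule image_eqI[of _ _ "vec (dim_col A) c"]) (simp_all add: mult_columns comb_vec)
  then show ?thesis by (auto simp: mat_image_def mult_columns)
qed

text \<open>Truncation to vectors is injective on functions supported below
  \<open>dim_col A\<close>, so exactness may be read off from functions.\<close>

lemma exact_columns_iff:
  assumes "dim_row A' = dim_col A"
  shows "mat_kernel A = mat_image A' \<longleftrightarrow>
    syz (dim_col A) (columns A) zero_mod = {comb (dim_col A') c (columns A') | c. True}"
proof -
  let ?n = "dim_col A"
  have "mat_kernel A = vec ?n ` syz ?n (columns A) zero_mod"
  proof -
    have 1: "coeffs ?n (vec ?n c) = c" if "c \<in> syz ?n (columns A) zero_mod" for c
      using that by (auto simp: coeffs_def syz_def)
    have 2: "vec ?n (coeffs ?n v) = v" if "v \<in> carrier_vec ?n" for v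
      using that by (auto simp: coeffs_def)
    show ?thesis
      unfolding mat_kernel_columns
    proof (intro equalityI subsetI)
      fix v assume "v \<in> {v \<in> carrier_vec ?n. coeffs ?n v \<in> syz ?n (columns A) zero_mod}"
      then show "v \<in> vec ?n ` syz ?n (columns A) zero_mod"
        by (intro image_eqI[of _ _ "coeffs ?n v"]) (simp_all add: 2)
    qed (auto simp: 1)
  qed
  moreover have "mat_image A' = vec ?n ` {comb (dim_col A') c (columns A') | c. True}"
    using assms by (auto simp: mat_image_columns)
  moreover have "inj_on (vec ?n) {c. \<forall>j\<ge>?n. c j = (0 :: 'a)}"
  proof (rule inj_onI, rule ext)
    fix c c' :: "nat \<Rightarrow> 'a" and j
    assume c: "c \<in> {c. \<forall>j\<ge>?n. c j = 0}" "c' \<in> {c. \<forall>j\<ge>?n. c j = 0}" and eq: "vec ?n c = vec ?n c'"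
    show "c j = c' j"
    proof (cases "j < ?n")
      case True
      then have "c j = vec ?n c $ j" by simp
      also have "\<dots> = c' j" unfolding eq using True by simp
      finally show ?thesis .
    qed (use c in auto)
  qed
  moreover have "syz ?n (columns A) zero_mod \<subseteq> {c. \<forall>j\<ge>?n. c j = 0}"
    by (auto simp: syz_def)
  moreover have "{comb (dim_col A') c (columns A') | c. True} \<subseteq> {c. \<forall>j\<ge>?n. c j = 0}"
    using assms by (auto simp: comb_columns_ge)
  ultimately show ?thesis by (auto simp: inj_on_image_eq_iff)
qed

lemma columns_mat:
  assumes "\<And>b a. b < n \<Longrightarrow> a \<ge> r \<Longrightarrow> g b a = 0"
  shows "b < n \<Longrightarrow> columns (mat r n (\<lambda>(a, b). g b a)) b = g b"
  using assms by (auto simp: columns_def fun_eq_iff)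

lemma cover_image:
  assumes "cover e n g M zero_mod" "submod M"
  shows "M = {comb n c g | c. True}"
proof
  show "M \<subseteq> {comb n c g | c. True}"
  proof
    fix f assume "f \<in> M"
    then obtain c where "(\<lambda>i. f i - comb n c g i) \<in> zero_mod" using coverD[OF assms(1)] by blast
    then have "f = comb n c g" by (simp add: fun_eq_iff)
    then show "f \<in> {comb n c g | c. True}" by blast
  qed
qed (use assms in \<open>auto simp: cover_def intro!: submod_comb\<close>)

text \<open>Dependent choice unrolls the coinductive predicate into a sequence of generating
  systems. Minimality is automatic, since linear forms lie in the maximal ideal.\<close>

lemma linear_resolution_exists:
  fixes J :: "('v::finite, 'k::field) mpoly set"
  assumes "linear_quot d (emb J) zero_mod" "submod (emb J)"
  obtains n D where "minimal_graded_free_resolution J (\<lambda>i. replicate (n i) (i + d)) D"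
proof -
  \<comment> \<open>Only the first generating system is tied to \<open>J\<close> and has degree
    \<open>d\<close>; the later ones are tied to their predecessors by \<open>?Q\<close>.\<close>
  let ?P = "\<lambda>i (n, g). (i = (0::nat) \<longrightarrow> cover d n g (emb J) zero_mod) \<and>
    linear_mod (syz n (g :: nat \<Rightarrow> nat \<Rightarrow> ('v, 'k) mpoly) zero_mod)"
  let ?Q = "\<lambda>(n, g) (n', g'). cover 1 n' g' (syz n (g :: nat \<Rightarrow> nat \<Rightarrow> ('v, 'k) mpoly) zero_mod) zero_mod"
  have start: "\<exists>s. ?P 0 s" using assms(1) by (auto simp: linear_quot_def)
  have step: "\<exists>s'. ?P (Suc i) s' \<and> ?Q s s'" if "?P i s" for i s
  proof -
    obtain n g where s: "s = (n, g)" by force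
    then have "linear_quot 1 (syz n g zero_mod) zero_mod" using that by (simp flip: linear_mod_iff del: One_nat_def)
    then show ?thesis by (auto simp: linear_quot_def s)
  qed
  have "\<exists>F. \<forall>i. ?P i (F i) \<and> ?Q (F i) (F (Suc i))"
    by (rule dependent_nat_choice[of ?P "\<lambda>_. ?Q"]) (fact start, fact step)
  then obtain F where F: "\<And>i. ?P i (F i) \<and> ?Q (F i) (F (Suc i))" by blast
  define n where "n i = fst (F i)" for i
  define g where "g i = snd (F i)" for i
  have F_eq: "F i = (n i, g i)" for i by (simp add: n_def g_def)
  have cov0: "cover d (n 0) (g 0) (emb J) zero_mod" using F[of 0] by (simp add: F_eq)
  have covS: "cover 1 (n (Suc i)) (g (Suc i)) (syz (n i) (g i) zero_mod) zero_mod" for i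
    using F[of i] by (simp add: F_eq)
  \<comment> \<open>The rank of the target of \<open>D i\<close>; it starts with 1 because the
    augmentation maps to the polynomial ring itself.\<close>
  define r where "r i = (case i of 0 \<Rightarrow> 1 | Suc i \<Rightarrow> n i)" for i
  define D where "D i = mat (r i) (n i) (\<lambda>(a, b). g i b a)" for i
  have dims: "dim_row (D i) = r i" "dim_col (D i) = n i" for i by (simp_all add: D_def)
  have g0: "g i b a = 0" if "b < n i" "a \<ge> r i" for i b a
  proof (cases i)
    case 0
    then show ?thesis using cov0 that by (auto simp: cover_def emb_def r_def)
  next
    case (Suc i')
    then show ?thesis using covS[of i'] that by (auto simp: cover_def syz_def r_def)
  qed
  have comb: "comb (n i) c (columns (D i)) = comb (n i) c (g i)" for i c
    unfolding D_def by (intro comb_cong refl columns_mat g0)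
  have syz: "syz (n i) (columns (D i)) zero_mod = syz (n i) (g i) zero_mod" for i
    by (simp add: syz_def comb)
  have hom1: "homogeneous 1 (D (Suc i) $$ (a, b))" if "a < n i" "b < n (Suc i)" for i a b
    using covS[of i] that by (auto simp: cover_def D_def r_def)
  have hom0: "homogeneous d (D 0 $$ (0, b))" if "b < n 0" for b
    using cov0 that by (auto simp: cover_def D_def r_def)
  have "minimal_graded_free_resolution J (\<lambda>i. replicate (n i) (i + d)) D"
    unfolding minimal_graded_free_resolution_def
  proof (intro conjI allI)
    show "graded_hom (replicate (n 0) (0 + d)) [0] (D 0)"
      using hom0 by (auto simp: graded_hom_def homogeneous_def D_def r_def)
    show "graded_hom (replicate (n (Suc i)) (Suc i + d)) (replicate (n i) (i + d)) (D (Suc i))" for i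
      unfolding graded_hom_def
    proof (intro conjI allI impI ballI)
      show "D (Suc i) \<in> carrier_mat (length (replicate (n i) (i + d))) (length (replicate (n (Suc i)) (Suc i + d)))"
        by (simp add: D_def r_def)
      fix a b m
      assume "a < length (replicate (n i) (i + d))" "b < length (replicate (n (Suc i)) (Suc i + d))"
        "m \<in> Poly_Mapping.keys (D (Suc i) $$ (a, b))"
      with hom1[of a i b] show "mdeg m + replicate (n i) (i + d) ! a = replicate (n (Suc i)) (Suc i + d) ! b"
        by (simp add: homogeneous_def)
    qed
    have "mat_image (D 0) = vec 1 ` emb J"
      using cover_image[OF cov0 assms(2)] by (auto simp: mat_image_columns dims comb r_def)
    moreover have "(\<lambda>v. v $ 0) ` vec 1 ` emb J = J"
    proof -
      have "p \<in> (\<lambda>f. f 0) ` emb J" if "p \<in> J" for p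
        using that by (intro image_eqI[of _ _ "\<lambda>i. if i = 0 then p else 0"]) (auto simp: emb_def)
      then show ?thesis by (auto simp: image_image emb_def)
    qed
    ultimately show "(\<lambda>v. v $ 0) ` mat_image (D 0) = J" by simp
    show "mat_kernel (D i) = mat_image (D (Suc i))" for i
    proof -
      have "syz (dim_col (D i)) (columns (D i)) zero_mod =
          {comb (dim_col (D (Suc i))) c (columns (D (Suc i))) | c. True}"
        unfolding dims syz comb by (rule cover_image[OF covS submod_syz[OF submod_zero_mod]])
      moreover have "dim_row (D (Suc i)) = dim_col (D i)" by (simp add: dims r_def)
      ultimately show ?thesis using exact_columns_iff by blast
    qed
    show "elements_mat (D (Suc i)) \<subseteq> graded_max_ideal" for i
      using linear_form_in_max_ideal[OF hom1[of _ i]] by (auto simp: elements_mat_def dims r_def)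
  qed
  then show ?thesis using that by blast
qed

text \<open>Each map of a minimal resolution is a minimal generating system of the preceding syzygy
  module, so \<open>minimal_cover\<close> applies at every stage and passes linearity on to the
  next.\<close>

lemma minimal_resolution_linear:
  fixes J :: "('v::finite, 'k::field) mpoly set"
  assumes lin: "linear_quot d (emb J) zero_mod"
    and res: "minimal_graded_free_resolution J \<sigma> D"
  shows "set (\<sigma> i) \<subseteq> {i + d}"
proof -
  have hom0: "graded_hom (\<sigma> 0) [0] (D 0)" and homS: "\<And>i. graded_hom (\<sigma> (Suc i)) (\<sigma> i) (D (Suc i))"
    and im: "(\<lambda>v. v $ 0) ` mat_image (D 0) = J" and ex: "\<And>i. mat_kernel (D i) = mat_image (D (Suc i))"
    and min: "\<And>i. elements_mat (D (Suc i)) \<subseteq> graded_max_ideal"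
    using res by (auto simp: minimal_graded_free_resolution_def)
  have carr0: "D 0 \<in> carrier_mat 1 (length (\<sigma> 0))" using hom0 unfolding graded_hom_def by simp
  have carrS: "D (Suc i) \<in> carrier_mat (length (\<sigma> i)) (length (\<sigma> (Suc i)))" for i
    using homS[of i] unfolding graded_hom_def by blast
  have dimS: "dim_row (D (Suc i)) = length (\<sigma> i)" "dim_col (D i) = length (\<sigma> i)" for i
    using carrier_matD[OF carr0] carrier_matD[OF carrS] by (simp, cases i) auto
  have dim0: "dim_row (D 0) = 1" using carrier_matD[OF carr0] by simp
  define g where "g i = columns (D i)" for i
  let ?n = "\<lambda>i. length (\<sigma> i)"
  have syzS: "syz (?n i) (g i) zero_mod = {comb (?n (Suc i)) c (g (Suc i)) | c. True}" for i
    using ex[of i] by (simp add: exact_columns_iff dimS g_def)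
  \<comment> \<open>By exactness a syzygy is a combination of columns of the next matrix, and the
    entries of that matrix have no constant terms.\<close>
  have min': "Poly_Mapping.lookup (c j) 0 = 0" if "c \<in> syz (?n i) (g i) zero_mod" for c i j
  proof -
    obtain c' where c: "c = comb (?n (Suc i)) c' (g (Suc i))" using \<open>c \<in> _\<close> unfolding syzS by blast
    have "Poly_Mapping.lookup (g (Suc i) l j) 0 = 0" for l
      using min[of i] elements_matI[OF carrS[of i]]
      by (auto simp: g_def columns_def dimS intro!: max_ideal_const_coeff)
    then show ?thesis by (simp add: c const_coeff_comb)
  qed
  have "set (\<sigma> i) \<subseteq> {i + d} \<and> linear_mod (syz (?n i) (g i) zero_mod)"
  proof (induction i)
    case 0
    have img: "emb J = {comb (?n 0) c (g 0) | c. True}"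
    proof -
      have im0: "(\<lambda>f. f 0) ` {comb (?n 0) c (g 0) | c. True} = J"
      proof -
        have "mat_image (D 0) = vec 1 ` {comb (?n 0) c (g 0) | c. True}"
          by (auto simp: mat_image_columns dimS dim0 g_def)
        then show ?thesis using im by (simp add: image_image)
      qed
      have "f i = 0" if "i > 0" "f = comb (?n 0) c (g 0)" for f c i
        using that by (simp add: g_def comb_columns_ge dim0)
      with im0 have 1: "f \<in> emb J" if "f \<in> {comb (?n 0) c (g 0) | c. True}" for f
        using that by (auto simp: emb_def)
      moreover have "f \<in> {comb (?n 0) c (g 0) | c. True}" if f: "f \<in> emb J" for f
      proof -
        obtain h where h: "h \<in> {comb (?n 0) c (g 0) | c. True}" "f 0 = h 0"
          using f im0 by (auto simp: emb_def)
        have "f = h"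
        proof
          fix i show "f i = h i" using h f 1[OF h(1)] by (cases "i = 0") (auto simp: emb_def)
        qed
        with h show ?thesis by simp
      qed
      ultimately show ?thesis by blast
    qed
    have gM: "g 0 j \<in> emb J" if "j < ?n 0" for j
      unfolding img using comb_unit[OF that, of "g 0"] by (auto intro!: exI[of _ "unit j"])
    have hom: "homogeneous (\<sigma> 0 ! j) (g 0 j i)" if "j < ?n 0" for i j
      using hom0 that by (auto simp: g_def columns_def dim0 dimS graded_hom_def homogeneous_def)
    have gen: "\<exists>c. f = comb (?n 0) c (g 0)" if "f \<in> emb J" for f using that unfolding img by blast
    note mc = minimal_cover[where \<tau> = "(!) (\<sigma> 0)" and g' = "g 0" and n' = "?n 0", OF lin]
    have "\<sigma> 0 ! j = d" if "j < ?n 0" for j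
      by (rule mc) (fact gM hom gen min' that)+
    moreover have "linear_mod (syz (?n 0) (g 0) zero_mod)"
      by (rule mc) (fact gM hom gen min')+
    ultimately show ?case by (auto simp: in_set_conv_nth)
  next
    case (Suc i)
    then have lin': "linear_quot 1 (syz (?n i) (g i) zero_mod) zero_mod" by (simp flip: linear_mod_iff del: One_nat_def)
    have \<sigma>i: "\<sigma> i ! a = i + d" if "a < ?n i" for a using Suc that nth_mem by fastforce
    have gM: "g (Suc i) j \<in> syz (?n i) (g i) zero_mod" if "j < ?n (Suc i)" for j
      unfolding syzS using comb_unit[OF that, of "g (Suc i)"] by (auto intro!: exI[of _ "unit j"])
    \<comment> \<open>Truncation is harmless: if the degree were below \<open>i + d\<close>, the
      column would be zero and hence homogeneous of any degree. The value 1 obtained below for the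
      difference excludes this case.\<close>
    have hom: "homogeneous (\<sigma> (Suc i) ! j - (i + d)) (g (Suc i) j a)" if "j < ?n (Suc i)" for a j
      using homS[of i] that \<sigma>i by (fastforce simp: g_def columns_def dimS graded_hom_def homogeneous_def)
    have gen: "\<exists>c. f = comb (?n (Suc i)) c (g (Suc i))" if "f \<in> syz (?n i) (g i) zero_mod" for f
      using that unfolding syzS by blast
    note mc = minimal_cover[where \<tau> = "\<lambda>j. \<sigma> (Suc i) ! j - (i + d)" and g' = "g (Suc i)" and n' = "?n (Suc i)",
        OF lin']
    have "\<sigma> (Suc i) ! j - (i + d) = 1" if "j < ?n (Suc i)" for j
      by (rule mc) (fact gM hom gen min' that)+
    then have "\<sigma> (Suc i) ! j = Suc i + d" if "j < ?n (Suc i)" for j using that by fastforce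
    moreover have "linear_mod (syz (?n (Suc i)) (g (Suc i)) zero_mod)"
      by (rule mc) (fact gM hom gen min')+
    ultimately show ?case by (auto simp: in_set_conv_nth)
  qed
  then show ?thesis by blast
qed

text \<open>Existence makes 0 a value of the definite description in \<open>betti\<close>, and
  \<open>minimal_resolution_linear\<close> makes it the only one.\<close>

lemma linear_quot_imp_linear_resolution:
  fixes B :: "('v::finite \<Rightarrow>\<^sub>0 nat) set"
  defines "J \<equiv> monomial_ideal B :: ('v, 'k::field) mpoly set"
  assumes "linear_quot d (emb J) zero_mod" "\<And>b. b \<in> B \<Longrightarrow> mdeg b = d"
  shows "has_linear_resolution J"
  unfolding has_linear_resolution_def
proof (intro exI conjI allI impI)
  show "generated_in_degree d J"
    unfolding generated_in_degree_def J_def monomial_ideal_eq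
    using assms(3) homogeneous_single by (intro exI[of _ "(\<lambda>b. Poly_Mapping.single b 1) ` B"]) fastforce
  obtain n D where ex: "minimal_graded_free_resolution J (\<lambda>i. replicate (n i) (i + d)) D"
    using linear_resolution_exists[OF assms(2)] submod_emb unfolding J_def by blast
  fix i j assume j: "j \<noteq> i + d"
  show "betti J i j = 0"
    unfolding betti_def
  proof (rule the_equality)
    show "\<exists>\<sigma> D. minimal_graded_free_resolution J \<sigma> D \<and> 0 = count_list (\<sigma> i) j"
      using ex j by (auto intro!: exI[of _ "\<lambda>i. replicate (n i) (i + d)"] exI[of _ D] simp: count_list_0_iff)
    fix b assume "\<exists>\<sigma> D. minimal_graded_free_resolution J \<sigma> D \<and> b = count_list (\<sigma> i) j"
    then obtain \<sigma> D where "minimal_graded_free_resolution J \<sigma> D" "b = count_list (\<sigma> i) j" by blast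
    with minimal_resolution_linear[OF assms(2) this(1), of i] j show "b = 0"
      by (auto simp: count_list_0_iff)
  qed
qed

section \<open>Exchange properties of edge multisets\<close>

abbreviation exponent :: "('v \<Rightarrow>\<^sub>0 nat) \<Rightarrow> 'v \<Rightarrow> nat" where
  "exponent \<equiv> Poly_Mapping.lookup"

definition edge_multiset :: "('v \<Rightarrow> 'v \<Rightarrow> bool) \<Rightarrow> 'v set multiset \<Rightarrow> bool" where
  "edge_multiset E W \<longleftrightarrow> (\<forall>e\<in>#W. \<exists>x y. E x y \<and> e = {x, y})"

definition degrees :: "'v set multiset \<Rightarrow> ('v \<Rightarrow>\<^sub>0 nat)" where
  "degrees W = (\<Sum>e\<in>#W. \<Sum>v\<in>e. evar v)"

text \<open>The exponent vectors of the generators of the \<open>s\<close>-th power. One vector may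
  come from several multisets, which is what leaves room for rearranging edges.\<close>

definition edge_sums :: "('v \<Rightarrow> 'v \<Rightarrow> bool) \<Rightarrow> nat \<Rightarrow> ('v \<Rightarrow>\<^sub>0 nat) set" where
  "edge_sums E s = {degrees W | W. edge_multiset E W \<and> size W = s}"

definition total :: "'v set \<Rightarrow> ('v \<Rightarrow>\<^sub>0 nat) \<Rightarrow> nat" where
  "total A m = (\<Sum>v\<in>A. exponent m v)"

lemma total_add [simp]: "total A (m + n) = total A m + total A n"
  by (simp add: total_def lookup_add sum.distrib)

lemma total_zero [simp]: "total A 0 = 0"
  by (simp add: total_def)

lemma total_evar: "finite A \<Longrightarrow> total A (Poly_Mapping.single v (Suc 0)) = (if v \<in> A then 1 else 0)"
  by (simp add: total_def lookup_single when_def)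

lemma exponent_evar: "exponent (Poly_Mapping.single v (Suc 0)) x = (if x = v then 1 else 0)"
  by (auto simp: lookup_single when_def)

lemma degrees_empty [simp]: "degrees {#} = 0"
  by (simp add: degrees_def)

lemma edge_multiset_add [simp]:
  "edge_multiset E (add_mset e W) \<longleftrightarrow> (\<exists>x y. E x y \<and> e = {x, y}) \<and> edge_multiset E W"
  by (auto simp: edge_multiset_def)

lemma edge_multiset_empty [simp]: "edge_multiset E {#}"
  by (simp add: edge_multiset_def)

locale symmetric_relation =
  fixes E :: "'v::finite \<Rightarrow> 'v \<Rightarrow> bool"
  assumes sym: "E x y \<Longrightarrow> E y x" and irrefl: "\<not> E x x"
begin

lemma degrees_add: "E x y \<Longrightarrow> degrees (add_mset {x, y} W) = degrees W + evar x + evar y"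
  using irrefl by (cases "x = y") (auto simp: degrees_def ac_simps)

lemma edge_at:
  assumes "edge_multiset E W" "exponent (degrees W) v > 0"
  obtains y W' where "E v y" "W = add_mset {v, y} W'"
proof -
  have "\<exists>e\<in>#W. v \<in> e"
  proof (rule ccontr)
    assume "\<not> ?thesis"
    then have "exponent (degrees W) v = 0"
      by (induction W) (auto simp: degrees_def lookup_add lookup_sum lookup_single when_def intro!: sum.neutral)
    with assms(2) show False by simp
  qed
  then obtain e where e: "e \<in># W" "v \<in> e" by blast
  then obtain x y where xy: "E x y" "e = {x, y}" using assms(1) by (auto simp: edge_multiset_def)
  obtain W' where "W = add_mset e W'" using e(1) by (metis multi_member_split)
  then show ?thesis using that[of y] that[of x] e(2) xy sym by (auto simp: insert_commute)
qed

lemma edge_sumsI: "edge_multiset E W \<Longrightarrow> size W = s \<Longrightarrow> degrees W = m \<Longrightarrow> m \<in> edge_sums E s"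
  by (auto simp: edge_sums_def)

lemma edge_sums_Suc: "E x y \<Longrightarrow> m \<in> edge_sums E s \<Longrightarrow> m + evar x + evar y \<in> edge_sums E (Suc s)"
proof -
  assume E: "E x y" and "m \<in> edge_sums E s"
  then obtain W where "m = degrees W" "edge_multiset E W" "size W = s" by (auto simp: edge_sums_def)
  with E show ?thesis by (intro edge_sumsI[of "add_mset {x, y} W"]) (auto simp: degrees_add)
qed

text \<open>Each edge has at most one end in \<open>T\<close>. The opposite bound for sets meeting
  every edge follows below; exchanges are forced by playing the two off against each other.\<close>

lemma total_le_of_independent:
  assumes "edge_multiset E W" "\<And>x y. x \<in> T \<Longrightarrow> y \<in> T \<Longrightarrow> \<not> E x y"
  shows "total T (degrees W) \<le> size W"
  using assms(1)
proof (induction W)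
  case (add e W)
  then obtain x y where "E x y" "e = {x, y}" by auto
  then show ?case using add assms(2)[of x y] by (auto simp: degrees_add total_evar)
qed simp

lemma total_ge_of_cover:
  assumes "edge_multiset E W" "\<And>e. e \<in># W \<Longrightarrow> e \<inter> T \<noteq> {}"
  shows "total T (degrees W) \<ge> size W"
  using assms
proof (induction W)
  case (add e W)
  then obtain x y where "E x y" "e = {x, y}" by auto
  moreover have "e \<inter> T \<noteq> {}" using add(3)[of e] by simp
  moreover have "size W \<le> total T (degrees W)" using add by auto
  ultimately show ?case by (auto simp: degrees_add total_evar)
qed simp

lemma total_UNIV: "edge_multiset E W \<Longrightarrow> total UNIV (degrees W) = 2 * size W"
proof (induction W)
  case (add e W)
  then obtain x y where "E x y" "e = {x, y}" by auto
  then show ?case using add by (auto simp: degrees_add total_evar)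
qed simp

text \<open>The total degrees agree, so an excess of \<open>U\<close> outside \<open>L\<close> must
  be balanced by a variable of \<open>W\<close> inside \<open>L\<close>.\<close>

lemma edge_in_deficit:
  assumes W: "edge_multiset E W" and U: "edge_multiset E U" and size: "size U = size W"
    and le: "\<And>v. v \<notin> L \<Longrightarrow> exponent (degrees W) v \<le> exponent (degrees U) v"
    and y: "y \<notin> L" "exponent (degrees W) y < exponent (degrees U) y"
  obtains b where "b \<in> L" "exponent (degrees W) b > 0"
proof (rule ccontr)
  assume "\<not> thesis"
  with that have 0: "exponent (degrees W) b = 0" if "b \<in> L" for b using \<open>b \<in> L\<close> by blast
  have "total UNIV (degrees W) < total UNIV (degrees U)"
    unfolding total_def
    by (rule sum_strict_mono_ex1) (use 0 le y in \<open>auto intro: le\<close>, metis le le0)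
  with total_UNIV W U size show False by simp
qed

text \<open>If no exchange were possible, \<open>y\<close> together with its non-neighbours outside \<open>L\<close> would be an
  independent set meeting every edge of \<open>W\<close>, so that \<open>U\<close> could not have larger degree on it.\<close>

lemma exchange_dominating:
  assumes S: "\<And>x z. x \<in> S \<Longrightarrow> z \<in> S \<Longrightarrow> \<not> E x z"
    and y: "y \<notin> S" "y \<notin> L" "\<And>x. x \<notin> S \<Longrightarrow> x \<noteq> y \<Longrightarrow> E y x"
    and L: "L \<subseteq> S \<or> S \<subseteq> L"
    and W: "edge_multiset E W" and U: "edge_multiset E U" and size: "size U = size W"
    and le: "\<And>v. v \<notin> L \<Longrightarrow> exponent (degrees W) v \<le> exponent (degrees U) v"
    and lt: "exponent (degrees W) y < exponent (degrees U) y"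
  shows "\<exists>b\<in>L. \<exists>W'. edge_multiset E W' \<and> size W' = size W \<and> degrees W' + evar b = degrees W + evar y"
proof (rule ccontr)
  assume no: "\<not> ?thesis"
  have swap1: False if "E b q" "W = add_mset {b, q} W'" "b \<in> L" "E y q" for b q W'
  proof -
    have "degrees (add_mset {y, q} W') + evar b = degrees W + evar y"
      using that by (simp add: degrees_add ac_simps)
    moreover have "edge_multiset E (add_mset {y, q} W')" "size (add_mset {y, q} W') = size W"
      using that W by auto
    ultimately show False using no \<open>b \<in> L\<close> by blast
  qed
  \<comment> \<open>Otherwise one end of the edge could be replaced by \<open>y\<close> at
    once.\<close>
  have L_edges: "y \<in> e" if e: "e \<in># W" "b \<in> e" "b \<in> L" for e b
  proof (rule ccontr)
    assume "y \<notin> e"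
    obtain x z where "E x z" "e = {x, z}" using W e by (auto simp: edge_multiset_def)
    then obtain q where q: "E b q" "e = {b, q}" using e(2) sym by auto
    obtain W' where W': "W = add_mset e W'" using e(1) by (metis multi_member_split)
    show False
    proof (cases "q \<in> S")
      case False
      with y \<open>y \<notin> e\<close> q have "E y q" by auto
      then show False using swap1[of b q W'] q W' e(3) by simp
    next
      case True
      then have "b \<notin> S" using S q sym by blast
      \<comment> \<open>Since \<open>b\<close> lies in \<open>L\<close> but not in \<open>S\<close>,
        the hypothesis on \<open>L\<close> gives \<open>S \<subseteq> L\<close>. Hence the other end
        \<open>q\<close> may be lowered instead.\<close>
      then have "q \<in> L" "E y b" using L e(3) True y \<open>y \<notin> e\<close> q by auto
      then show False using swap1[of q b W'] q W' sym by (simp add: insert_commute)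
    qed
  qed
  obtain b where b: "b \<in> L" "exponent (degrees W) b > 0"
    using edge_in_deficit[OF W U size le y(2) lt] by blast
  obtain z W1 where "E b z" "W = add_mset {b, z} W1" using edge_at[OF W b(2)] by blast
  then have W1: "E b y" "W = add_mset {b, y} W1" using L_edges[of "{b, z}" b] b y by auto
  define T where "T = insert y {q. q \<noteq> y \<and> \<not> E y q \<and> q \<notin> L}"
  have "e \<inter> T \<noteq> {}" if e: "e \<in># W" for e
  proof (rule ccontr)
    assume "\<not> e \<inter> T \<noteq> {}"
    then have nT: "e \<inter> T = {}" by simp
    obtain p q where pq: "E p q" "e = {p, q}" using W e by (auto simp: edge_multiset_def)
    have "y \<notin> e" using nT by (auto simp: T_def)
    then have "p \<notin> L" "q \<notin> L" using L_edges[OF e] pq by auto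
    then have adj: "E y p" "E y q" using nT \<open>y \<notin> e\<close> pq by (auto simp: T_def)
    have "e \<in># W1" using e W1 \<open>y \<notin> e\<close> by auto
    then obtain W2 where "W1 = add_mset e W2" by (metis multi_member_split)
    then have W2: "W = add_mset {b, y} (add_mset {p, q} W2)" using W1 pq by simp
    \<comment> \<open>The edges \<open>by\<close> and \<open>pq\<close> become \<open>yp\<close> and
      \<open>yq\<close>: the net effect is one \<open>y\<close> more and one \<open>b\<close>
      less.\<close>
    let ?W' = "add_mset {y, p} (add_mset {y, q} W2)"
    have "degrees ?W' + evar b = degrees W + evar y"
      unfolding W2 using adj pq(1) W1(1) by (simp add: degrees_add ac_simps)
    moreover have "edge_multiset E ?W'" "size ?W' = size W" using W2 W adj by auto
    ultimately show False using no b(1) by blast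
  qed
  with total_ge_of_cover[OF W] have "size W \<le> total T (degrees W)" by blast
  also have "\<dots> < total T (degrees U)"
    unfolding total_def
    by (rule sum_strict_mono_ex1) (use le y(2) lt in \<open>auto simp: T_def\<close>)
  also have "\<dots> \<le> size U"
  proof (rule total_le_of_independent[OF U])
    fix x z assume "x \<in> T" "z \<in> T"
    then have "x = y \<or> x \<in> S \<and> \<not> E y x" "z = y \<or> z \<in> S \<and> \<not> E y z" using y(3) by (auto simp: T_def)
    then show "\<not> E x z" using S[of x z] irrefl sym by blast
  qed
  finally show False using size by simp
qed

end

text \<open>The last assumption says that \<open>S = - (K \<union> C)\<close> is independent and has no neighbours in \<open>C\<close>.\<close>

locale pseudo_split = symmetric_relation E for E :: "'v::finite \<Rightarrow> 'v \<Rightarrow> bool" +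
  fixes K C :: "'v set"
  assumes disjoint: "K \<inter> C = {}"
    and clique: "x \<in> K \<Longrightarrow> y \<in> K \<union> C \<Longrightarrow> x \<noteq> y \<Longrightarrow> E x y"
    and indep: "x \<notin> K \<union> C \<Longrightarrow> y \<notin> K \<Longrightarrow> \<not> E x y"
begin

abbreviation S :: "'v set" where "S \<equiv> - (K \<union> C)"

lemma exchange_clique:
  assumes "y \<in> K" "y \<notin> L" "L \<subseteq> S \<or> S \<subseteq> L" "edge_multiset E W" "edge_multiset E U" "size U = size W"
    "\<And>v. v \<notin> L \<Longrightarrow> exponent (degrees W) v \<le> exponent (degrees U) v"
    "exponent (degrees W) y < exponent (degrees U) y"
  shows "\<exists>b\<in>L. \<exists>W'. edge_multiset E W' \<and> size W' = size W \<and> degrees W' + evar b = degrees W + evar y"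
  by (rule exchange_dominating[where S = S]) (use assms indep clique in auto)

text \<open>An alternating trail of \<open>U\<close>- and \<open>W\<close>-edges is followed from \<open>a\<close>, removing its edges, until it
  leaves \<open>S - L\<close> and \<open>K\<close> along a \<open>W\<close>-edge or traverses a \<open>W\<close>-edge inside \<open>K \<union> C\<close>.\<close>

lemma exchange_independent:
  assumes "L \<subseteq> S" "a \<in> S" "a \<notin> L" "edge_multiset E W" "edge_multiset E U" "size U = size W"
    "\<And>v. v \<in> K \<union> C \<Longrightarrow> exponent (degrees W) v = exponent (degrees U) v"
    "\<And>v. v \<in> S - L \<Longrightarrow> exponent (degrees W) v \<le> exponent (degrees U) v"
    "exponent (degrees W) a < exponent (degrees U) a"
  shows "\<exists>b\<in>L. \<exists>W'. edge_multiset E W' \<and> size W' = size W \<and> degrees W' + evar b = degrees W + evar a"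
  using assms(2-)
proof (induction "size W" arbitrary: U W a)
  case 0
  then show ?case by simp
next
  case (Suc n)
  have "exponent (degrees U) a > 0" using Suc.prems(8) by simp
  from edge_at[OF Suc.prems(4) this] obtain k U' where k: "E a k" and U: "U = add_mset {a, k} U'" by blast
  have kK: "k \<in> K" using k indep[of a k] Suc.prems(1) by blast
  have degU: "degrees U = degrees U' + evar a + evar k" by (simp add: U degrees_add k)
  have "exponent (degrees W) k > 0"
    using Suc.prems(6)[of k] kK by (simp add: degU lookup_add exponent_evar)
  from edge_at[OF Suc.prems(3) this] obtain y W' where y: "E k y" and W: "W = add_mset {k, y} W'" by blast
  have degW: "degrees W = degrees W' + evar k + evar y" by (simp add: W degrees_add y)
  have "y \<noteq> k" "a \<noteq> k" using y k irrefl by auto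
  have W': "edge_multiset E W'" and U': "edge_multiset E U'" and size': "size U' = size W'" and n: "n = size W'"
    using Suc W U by auto
  have K': "exponent (degrees W') v \<le> exponent (degrees U') v" if "v \<in> K \<union> C" for v
    using Suc.prems(6)[OF that] Suc.prems(1) that
    by (auto simp: degU degW lookup_add exponent_evar split: if_splits)
  have K'': "exponent (degrees W') v = exponent (degrees U') v" if "v \<in> K \<union> C" "v \<noteq> y" for v
    using Suc.prems(6)[OF that(1)] Suc.prems(1) that
    by (auto simp: degU degW lookup_add exponent_evar split: if_splits)
  have S': "exponent (degrees W') v \<le> exponent (degrees U') v" if "v \<in> S - L" for v
    using Suc.prems(7)[OF that] Suc.prems(8)
    by (auto simp: degU degW lookup_add exponent_evar split: if_splits)
  have le': "exponent (degrees W') v \<le> exponent (degrees U') v" if "v \<notin> L" for v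
    using K' S' that by blast
  have lt': "exponent (degrees W') y < exponent (degrees U') y" if "y \<notin> L"
  proof (cases "y \<in> K \<union> C")
    case True
    then show ?thesis using Suc.prems(6)[of y] Suc.prems(1) \<open>y \<noteq> k\<close>
      by (auto simp: degU degW lookup_add exponent_evar split: if_splits)
  next
    case False
    then show ?thesis using Suc.prems(7)[of y] Suc.prems(8) \<open>y \<noteq> k\<close> \<open>y \<notin> L\<close>
      by (auto simp: degU degW lookup_add exponent_evar split: if_splits)
  qed
  \<comment> \<open>It suffices to raise \<open>y\<close> in \<open>W'\<close>: adding the edge
    \<open>ak\<close> in place of the removed \<open>ky\<close> then raises \<open>a\<close> in
    \<open>W\<close>. If \<open>y\<close> lies in \<open>L\<close>, the trail ends and
    \<open>y\<close> itself is lowered.\<close>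
  have "\<exists>b\<in>L. \<exists>W''. edge_multiset E W'' \<and> size W'' = size W' \<and> degrees W'' + evar b = degrees W' + evar y"
  proof -
    consider "y \<in> L" | "y \<in> S" "y \<notin> L" | "y \<in> K" "y \<notin> L" | "y \<in> C" "y \<notin> L" by blast
    then show ?thesis
    proof cases
      case 1
      then show ?thesis using W' by blast
    next
      case 2
      then show ?thesis
        using Suc.hyps(1)[OF n 2 W' U' size'] K'' S' lt' by auto
    next
      case 3
      then show ?thesis using exchange_clique[OF 3 _ W' U' size' le'] lt' assms(1) by blast
    next
      case 4
      \<comment> \<open>All neighbours of \<open>b\<close> lie in \<open>K\<close>, and
        \<open>K\<close> is completely joined to \<open>C\<close>, so \<open>b\<close> can be
        replaced by \<open>y\<close> directly.\<close>
      obtain b where b: "b \<in> L" "exponent (degrees W') b > 0"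
        using edge_in_deficit[OF W' U' size' le' 4(2) lt'[OF 4(2)]] by blast
      from edge_at[OF W' b(2)] obtain q W2 where q: "E b q" and W2: "W' = add_mset {b, q} W2" by blast
      have "q \<in> K" using indep[of b q] b(1) assms(1) q by blast
      then have "E y q" using clique[of q y] 4 disjoint sym by blast
      then have "degrees (add_mset {y, q} W2) + evar b = degrees W' + evar y"
        using q by (simp add: W2 degrees_add ac_simps)
      then show ?thesis
        using b(1) W' W2 \<open>E y q\<close> by (intro bexI[of _ b] exI[of _ "add_mset {y, q} W2"]) auto
    qed
  qed
  then obtain b W'' where b: "b \<in> L" "edge_multiset E W''" "size W'' = size W'"
    "degrees W'' + evar b = degrees W' + evar y" by blast
  have "degrees (add_mset {a, k} W'') + evar b = (degrees W'' + evar b) + evar a + evar k"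
    using k by (simp add: degrees_add ac_simps)
  also have "\<dots> = degrees W + evar a" unfolding b(4) degW by (simp add: ac_simps)
  finally show ?case
    using b k W by (intro bexI[of _ b] exI[of _ "add_mset {a, k} W''"]) auto
qed

end

section \<open>Lexicographic orders by integer keys\<close>

fun lexless :: "('a \<Rightarrow> int) list \<Rightarrow> 'a \<Rightarrow> 'a \<Rightarrow> bool" where
  "lexless [] u w \<longleftrightarrow> False"
| "lexless (f # fs) u w \<longleftrightarrow> f u < f w \<or> f u = f w \<and> lexless fs u w"

lemma transp_lexless: "transp (lexless fs)"
  by (induction fs) (fastforce simp: transp_def)+

lemma asymp_lexless: "asymp (lexless fs)"
proof (rule asympI)
  show "\<not> lexless fs w u" if "lexless fs u w" for u w using that by (induction fs) auto
qed

lemma lexless_appendI: "(\<And>f. f \<in> set fs \<Longrightarrow> f u = f w) \<Longrightarrow> lexless gs u w \<Longrightarrow> lexless (fs @ gs) u w"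
  by (induction fs) auto

lemma lexless_appendI1: "lexless fs u w \<Longrightarrow> lexless (fs @ gs) u w"
  by (induction fs) auto

lemma first_difference:
  assumes "x \<in> set xs" "f x \<noteq> g x"
  obtains ys z zs where "xs = ys @ z # zs" "f z \<noteq> g z" "\<And>y. y \<in> set ys \<Longrightarrow> f y = g y"
proof -
  have "\<exists>x\<in>set xs. f x \<noteq> g x" using assms by blast
  from split_list_first_prop[OF this] that show thesis by blast
qed

section \<open>The exchange property for all products of edges\<close>

context pseudo_split
begin

text \<open>Every edge at a vertex of \<open>S\<close> ends in \<open>K\<close>, where each vertex
  is joined to all of \<open>C\<close>.\<close>

lemma edge_sums_replace:
  assumes "w \<in> edge_sums E s" "exponent w v > 0" "v \<in> S" "a \<in> C"
  obtains w' where "w' \<in> edge_sums E s" "w' + evar v = w + evar a"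
proof -
  obtain W where W: "edge_multiset E W" "size W = s" "w = degrees W" using assms by (auto simp: edge_sums_def)
  obtain k W' where k: "E v k" "W = add_mset {v, k} W'" using edge_at[OF W(1)] assms(2) W(3) by metis
  then have "k \<in> K" using indep[of v k] assms(3) by blast
  then have "E a k" using clique[of k a] assms(4) disjoint sym by blast
  then have "degrees (add_mset {a, k} W') + evar v = w + evar a"
    using k W(3) by (simp add: degrees_add ac_simps)
  moreover have "degrees (add_mset {a, k} W') \<in> edge_sums E s"
    using W k \<open>E a k\<close> by (intro edge_sumsI) auto
  ultimately show thesis using that by blast
qed

lemma total_split: "total UNIV m = total K m + total C m + total S m"
proof -
  have "UNIV = (K \<union> C) \<union> S" by auto
  then have "total UNIV m = total (K \<union> C) m + total S m"
    unfolding total_def by (metis sum.union_disjoint finite Compl_disjoint)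
  also have "total (K \<union> C) m = total K m + total C m"
    unfolding total_def using disjoint by (simp add: sum.union_disjoint)
  finally show ?thesis .
qed

lemma edge_sums_total: "m \<in> edge_sums E s \<Longrightarrow> total UNIV m = 2 * s"
  using total_UNIV by (auto simp: edge_sums_def)

lemma exponent_eq_of_move:
  assumes "w' + evar b = w + evar a" "v \<noteq> a" "v \<noteq> b"
  shows "exponent w' v = exponent w v"
  using assms(2,3) arg_cong[OF assms(1), of "\<lambda>m. exponent m v"]
  by (simp add: lookup_add exponent_evar)

lemma exponent_raised:
  assumes "w' + evar b = w + evar a" "a \<noteq> b"
  shows "exponent w' a = Suc (exponent w a)"
  using assms(2) arg_cong[OF assms(1), of "\<lambda>m. exponent m a"]
  by (simp add: lookup_add exponent_evar)

lemma total_eq_of_move: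
  fixes A :: "'v set"
  assumes "w' + evar b = w + evar a" "a \<notin> A" "b \<notin> A"
  shows "total A w' = total A w"
  using assms(2,3) arg_cong[OF assms(1), of "total A"] by (simp add: total_evar)

lemma total_raised:
  fixes A :: "'v set"
  assumes "w' + evar b = w + evar a" "a \<in> A" "b \<notin> A"
  shows "total A w' = Suc (total A w)"
  using assms(2,3) arg_cong[OF assms(1), of "total A"] by (simp add: total_evar)

lemma exists_less_of_total_less:
  assumes "total A w < total A u"
  obtains a where "a \<in> A" "exponent w a < exponent u a"
  using assms unfolding total_def by (metis not_le sum_mono)

lemma exists_less_of_total_eq:
  fixes A :: "'v set"
  assumes "total A w = total A u" "x \<in> A" "exponent w x \<noteq> exponent u x"
  obtains (less) a where "a \<in> A" "exponent w a < exponent u a"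
proof (rule ccontr)
  assume no: "\<not> thesis"
  have le: "exponent u a \<le> exponent w a" if "a \<in> A" for a
    using no less[OF that] by (cases "exponent w a < exponent u a") auto
  have "total A u < total A w"
    unfolding total_def using le assms(2,3) by (intro sum_strict_mono_ex1 bexI[of _ x]) (auto simp: order.strict_iff_order)
  with assms(1) show False by simp
qed

text \<open>The monomials are ordered by their exponents in \<open>K\<close>, then by their degree in \<open>C\<close>, then by the
  functions \<open>fc\<close> and finally by their exponents in \<open>S\<close>. A monomial that contains a variable of \<open>S\<close>
  precedes, up to one variable, all monomials of larger degree in \<open>C\<close>; so the functions \<open>fc\<close> only
  have to compare monomials without variables from \<open>S\<close>.\<close>

lemma edge_sums_linear_quotients:
  assumes fc: "\<And>f m m'. f \<in> set fc \<Longrightarrow> (\<And>v. v \<in> K \<union> C \<Longrightarrow> exponent m v = exponent m' v) \<Longrightarrow> f m = f m'"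
    and fc_move: "\<And>u w. u \<in> edge_sums E s \<Longrightarrow> w \<in> edge_sums E s \<Longrightarrow> u \<noteq> w \<Longrightarrow>
      (\<And>v. v \<in> K \<Longrightarrow> exponent u v = exponent w v) \<Longrightarrow>
      (\<And>v. v \<in> S \<Longrightarrow> exponent u v = 0 \<and> exponent w v = 0) \<Longrightarrow>
      lexless fc w u \<or> (\<exists>a\<in>C. \<exists>b\<in>C. \<exists>w'\<in>edge_sums E s. w' + evar b = w + evar a \<and>
        exponent w a < exponent u a \<and> lexless fc w' w)"
  shows "\<exists>r. transp r \<and> asymp r \<and> (\<forall>u\<in>edge_sums E s. \<forall>w\<in>edge_sums E s. u \<noteq> w \<longrightarrow> r w u \<or>
    (\<exists>a b w'. w' \<in> edge_sums E s \<and> w' + evar b = w + evar a \<and> exponent w a < exponent u a \<and> r w' w))"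
proof -
  define neg where "neg v m = - int (exponent m v)" for v and m :: "'v \<Rightarrow>\<^sub>0 nat"
  obtain ks where ks: "set ks = K" "distinct ks" using finite_distinct_list[OF finite, of K] by blast
  obtain ss where ss: "set ss = S" "distinct ss" using finite_distinct_list[OF finite, of S] by blast
  define fs where "fs = map neg ks @ [\<lambda>m. - int (total C m)] @ fc @ map neg ss"
  have "lexless fs w u \<or> (\<exists>a b w'. w' \<in> edge_sums E s \<and> w' + evar b = w + evar a \<and>
      exponent w a < exponent u a \<and> lexless fs w' w)" (is "_ \<or> ?move")
    if u: "u \<in> edge_sums E s" and w: "w \<in> edge_sums E s" and "u \<noteq> w" for u w
  proof (cases "\<forall>k\<in>K. exponent u k = exponent w k")
    case False
    then obtain k0 where "k0 \<in> set ks" "exponent u k0 \<noteq> exponent w k0" using ks by auto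
    then obtain p k q where pkq: "ks = p @ k # q" "exponent u k \<noteq> exponent w k"
      "\<And>v. v \<in> set p \<Longrightarrow> exponent u v = exponent w v"
      by (rule first_difference) blast
    have fs': "fs = map neg p @ neg k # (map neg q @ [\<lambda>m. - int (total C m)] @ fc @ map neg ss)"
      by (simp add: fs_def pkq)
    consider "exponent u k < exponent w k" | "exponent w k < exponent u k" using pkq(2) by linarith
    then show ?thesis
    proof cases
      case 1
      then have "lexless fs w u" unfolding fs' by (intro lexless_appendI) (auto simp: neg_def pkq)
      then show ?thesis ..
    next
      case 2
      obtain U W where U: "edge_multiset E U" "size U = s" "u = degrees U"
        and W: "edge_multiset E W" "size W = s" "w = degrees W"
        using u w by (auto simp: edge_sums_def)
      have "k \<in> K" using ks pkq by auto
      \<comment> \<open>The exponents in \<open>p\<close> must stay fixed so that \<open>k\<close>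
        decides the comparison; every other variable may be lowered, including all of
        \<open>S\<close>.\<close>
      have "\<exists>b\<in>- insert k (set p). \<exists>W'. edge_multiset E W' \<and> size W' = size W \<and>
          degrees W' + evar b = degrees W + evar k"
      proof (rule exchange_clique[OF \<open>k \<in> K\<close> _ _ W(1) U(1)])
        show "- insert k (set p) \<subseteq> S \<or> S \<subseteq> - insert k (set p)" using ks pkq(1) by auto
        show "exponent (degrees W) v \<le> exponent (degrees U) v" if "v \<notin> - insert k (set p)" for v
          using that pkq(3)[of v] 2 unfolding U(3) W(3) by (cases "v = k") simp_all
      qed (use U W 2 in simp_all)
      then obtain b W' where b: "b \<notin> set p" "b \<noteq> k" and W': "edge_multiset E W'" "size W' = size W"
        "degrees W' + evar b = w + evar k" unfolding W(3) by blast
      have "k \<notin> set p" using ks pkq by auto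
      have "lexless fs (degrees W') w" unfolding fs'
      proof (rule lexless_appendI)
        fix f assume "f \<in> set (map neg p)"
        then show "f (degrees W') = f w"
          using exponent_eq_of_move[OF W'(3)] b \<open>k \<notin> set p\<close> by (fastforce simp: neg_def)
      qed (use exponent_raised[OF W'(3)] b in \<open>simp add: neg_def\<close>)
      moreover have "degrees W' \<in> edge_sums E s" using W' W by (intro edge_sumsI) auto
      ultimately show ?thesis using W'(3) 2 by blast
    qed
  next
    case True
    have neg_ks: "f w = f u" if "f \<in> set (map neg ks)" for f using that True ks by (auto simp: neg_def)
    have ks_append: "lexless gs w u \<Longrightarrow> lexless (map neg ks @ gs) w u" for gs
      using lexless_appendI[of "map neg ks" w u gs] neg_ks by blast
    have tot: "total C u + total S u = total C w + total S w"
    proof -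
      have "total K u = total K w" unfolding total_def using True by auto
      then show ?thesis using edge_sums_total[OF u] edge_sums_total[OF w] total_split[of u] total_split[of w] by linarith
    qed
    \<comment> \<open>Trading a variable of \<open>S\<close> for one of \<open>C\<close> raises the
      degree in \<open>C\<close>, which is compared before \<open>fc\<close>; no condition on
      \<open>fc\<close> is involved.\<close>
    have raise: ?move if a: "a \<in> C" "exponent w a < exponent u a" and v: "v \<in> S" "exponent w v > 0" for a v
    proof -
      obtain w' where w': "w' \<in> edge_sums E s" "w' + evar v = w + evar a"
        using edge_sums_replace[OF w v(2,1) a(1)] by blast
      have "lexless fs w' w" unfolding fs_def
      proof (rule lexless_appendI)
        fix f assume "f \<in> set (map neg ks)"
        then show "f w' = f w" using exponent_eq_of_move[OF w'(2)] a v ks disjoint by (fastforce simp: neg_def)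
      next
        have "total C w' = Suc (total C w)" using total_raised[OF w'(2) a(1)] v by blast
        then show "lexless ([\<lambda>m. - int (total C m)] @ fc @ map neg ss) w' w" by simp
      qed
      then show ?move using w' a by blast
    qed
    consider "total C u < total C w" | "total C w < total C u" | "total C u = total C w" by linarith
    then show ?thesis
    proof cases
      case 1
      then have "lexless fs w u" unfolding fs_def by (intro ks_append) auto
      then show ?thesis ..
    next
      case 2
      then obtain a where a: "a \<in> C" "exponent w a < exponent u a" using exists_less_of_total_less by blast
      have "total S u < total S w" using 2 tot by linarith
      then obtain v where "v \<in> S" "exponent u v < exponent w v" using exists_less_of_total_less by blast
      then show ?thesis using raise[OF a] by auto
    next
      case 3
      show ?thesis
      proof (cases "\<forall>v\<in>C. exponent u v = exponent w v")
        case False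
        then obtain a where a: "a \<in> C" "exponent w a < exponent u a"
          using exists_less_of_total_eq[OF 3[symmetric]] by metis
        show ?thesis
        proof (cases "\<exists>v\<in>S. exponent w v > 0")
          case True
          then show ?thesis using raise[OF a] by blast
        next
          case no: False
          then have "total S w = 0" by (simp add: total_def)
          then have "total S u = 0" using 3 tot by linarith
          then have "exponent u v = 0 \<and> exponent w v = 0" if "v \<in> S" for v using no that by (simp add: total_def)
          from fc_move[OF u w \<open>u \<noteq> w\<close> _ this] True
          consider "lexless fc w u" | a b w' where "a \<in> C" "b \<in> C" "w' \<in> edge_sums E s" "w' + evar b = w + evar a"
            "exponent w a < exponent u a" "lexless fc w' w" by blast
          then show ?thesis
          proof cases
            case 1
            then have "lexless fs w u" unfolding fs_def
              using \<open>total C u = total C w\<close> by (intro ks_append) (auto intro: lexless_appendI1)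
            then show ?thesis ..
          next
            case 2
            have "total C w' = total C w"
              using arg_cong[OF 2(4), of "total C"] 2(1,2) by (simp add: total_evar)
            moreover have "f w' = f w" if "f \<in> set (map neg ks)" for f
              using that exponent_eq_of_move[OF 2(4)] 2(1,2) ks disjoint by (fastforce simp: neg_def)
            ultimately have "lexless fs w' w" unfolding fs_def
              using 2(6) by (intro lexless_appendI[of "map neg ks"]) (auto intro: lexless_appendI1)
            then show ?thesis using 2 by blast
          qed
        qed
      next
        case C_eq: True
        have KC_eq: "exponent w v = exponent u v" if "v \<in> K \<union> C" for v using True C_eq that by auto
        have pre_eq: "f w = f u" if "f \<in> set (map neg ks @ [\<lambda>m. - int (total C m)] @ fc)" for f
          using that neg_ks 3 fc[OF _ KC_eq] by auto
        have "\<exists>v. exponent u v \<noteq> exponent w v" using \<open>u \<noteq> w\<close> by (metis poly_mapping_eqI)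
        then obtain v where "v \<in> set ss" "exponent u v \<noteq> exponent w v" using KC_eq ss by (metis ComplI)
        then obtain p a q where paq: "ss = p @ a # q" "exponent u a \<noteq> exponent w a"
          "\<And>v. v \<in> set p \<Longrightarrow> exponent u v = exponent w v"
          by (rule first_difference) blast
        have fs': "fs = ((map neg ks @ [\<lambda>m. - int (total C m)] @ fc) @ map neg p) @ neg a # map neg q"
          by (simp add: fs_def paq)
        consider "exponent u a < exponent w a" | "exponent w a < exponent u a" using paq(2) by linarith
        then show ?thesis
        proof cases
          case 1
          then have "lexless fs w u" unfolding fs'
            by (intro lexless_appendI) (use pre_eq paq(3) in \<open>auto simp: neg_def\<close>)
          then show ?thesis ..
        next
          case 2
          obtain U W where U: "edge_multiset E U" "size U = s" "u = degrees U"
            and W: "edge_multiset E W" "size W = s" "w = degrees W"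
            using u w by (auto simp: edge_sums_def)
          have "S - set q = insert a (set p)" using ss paq by auto
          \<comment> \<open>Only the variables of \<open>S\<close> listed after \<open>a\<close> may
            be lowered.\<close>
          have "\<exists>b\<in>set q. \<exists>W'. edge_multiset E W' \<and> size W' = size W \<and> degrees W' + evar b = degrees W + evar a"
          proof (rule exchange_independent[OF _ _ _ W(1) U(1)])
            show "exponent (degrees W) v \<le> exponent (degrees U) v" if "v \<in> S - set q" for v
              using that paq(3)[of v] 2 unfolding U(3) W(3) \<open>S - set q = _\<close> by (cases "v = a") simp_all
            show "exponent (degrees W) v = exponent (degrees U) v" if "v \<in> K \<union> C" for v
              using KC_eq[OF that] U W by simp
            show "set q \<subseteq> S" "a \<in> S" "a \<notin> set q" using ss paq by auto
          qed (use U W 2 in simp_all)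
          then obtain b W' where b: "b \<in> set q" and W': "edge_multiset E W'" "size W' = size W"
            "degrees W' + evar b = w + evar a" unfolding W(3) by blast
          have ab: "a \<in> S" "b \<in> S" "a \<noteq> b" "a \<notin> set p" "b \<notin> set p" using b ss paq by auto
          note eq = exponent_eq_of_move[OF W'(3)]
          have "lexless fs (degrees W') w" unfolding fs'
          proof (rule lexless_appendI)
            fix f assume "f \<in> set ((map neg ks @ [\<lambda>m. - int (total C m)] @ fc) @ map neg p)"
            moreover have "exponent (degrees W') v = exponent w v" if "v \<in> K \<union> C \<union> set p" for v
              using eq[of v] ab that by blast
            moreover have "total C (degrees W') = total C w"
              using total_eq_of_move[OF W'(3)] ab by blast
            ultimately show "f (degrees W') = f w"
              using fc[of f "degrees W'" w] ks by (auto simp: neg_def)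
          qed (use exponent_raised[OF W'(3)] ab in \<open>simp add: neg_def\<close>)
          moreover have "degrees W' \<in> edge_sums E s" using W' W by (intro edge_sumsI) auto
          ultimately show ?thesis using W'(3) 2 by blast
        qed
      qed
    qed
  qed
  then show ?thesis using transp_lexless asymp_lexless by blast
qed

end

section \<open>The five-cycle\<close>

definition pair_bounded :: "int \<Rightarrow> int list \<Rightarrow> bool" where
  "pair_bounded s g \<longleftrightarrow> g ! 0 + g ! 1 \<le> s \<and> g ! 1 + g ! 2 \<le> s \<and> g ! 2 + g ! 3 \<le> s \<and>
    g ! 3 + g ! 4 \<le> s \<and> g ! 4 + g ! 0 \<le> s"

text \<open>Only vectors of equal sum are compared, so four exponents determine the fifth.\<close>

definition lex_keys :: "(int list \<Rightarrow> int) list" where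
  "lex_keys = [\<lambda>g. - g ! 0, \<lambda>g. - g ! 1, \<lambda>g. - g ! 2, \<lambda>g. - g ! 3]"

text \<open>The lexicographic order does not work for the products of \<open>s\<close> edges of the 5-cycle alone. Listing the vertices \<open>p\<^sub>0, \<dots>, p\<^sub>4\<close> so
  that neighbours in the list are not adjacent, the exponent of \<open>p\<^sub>0\<close> cannot be raised in products without
  the edges \<open>p\<^sub>2p\<^sub>4\<close> and \<open>p\<^sub>1p\<^sub>3\<close>. The order below places these after suitable products with one such edge;
  the exceptional value 3 puts the power \<open>(p\<^sub>1p\<^sub>4)\<^sup>s\<close> right after the product of \<open>(p\<^sub>1p\<^sub>4)\<^sup>s\<^sup>-\<^sup>1\<close> and \<open>p\<^sub>2p\<^sub>4\<close>,
  which requires \<open>s \<ge> 2\<close>.\<close>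

definition cycle_keys :: "(int list \<Rightarrow> int) list" where
  "cycle_keys =
    [\<lambda>g. - g ! 0,
     \<lambda>g. if g ! 0 > 0 then - (g ! 2 + g ! 3) else g ! 4,
     \<lambda>g. if g ! 0 > 0 then - g ! 2 else if g ! 2 + g ! 3 = 0 then 3 else 2 * (g ! 2 + g ! 3),
     \<lambda>g. if g ! 0 > 0 then g ! 1 else 0]"

abbreviation move :: "int list \<Rightarrow> nat \<Rightarrow> nat \<Rightarrow> int list" where
  "move w a b \<equiv> w[a := w ! a + 1, b := w ! b - 1]"

definition admissible :: "(int list \<Rightarrow> int) list \<Rightarrow> int \<Rightarrow> int list \<Rightarrow> int list \<Rightarrow> nat \<Rightarrow> nat \<Rightarrow> bool" where
  "admissible ks s u w a b \<longleftrightarrow> w ! b > 0 \<and> w ! a < u ! a \<and> pair_bounded s (move w a b) \<and> lexless ks (move w a b) w"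

text \<open>Moves with \<open>a < b\<close> always go to an earlier vector. The slack matters when
  \<open>w0 < u0\<close> and both pairs containing index 0 are tight in \<open>w\<close>: then
  \<open>w2 + w3 < w0\<close>, and index 2 or 3 can be raised at the expense of index 4. With sum
  \<open>2 * s\<close> this may be blocked.\<close>

lemma lex_move:
  fixes u0 u1 u2 u3 u4 w0 w1 w2 w3 w4 s :: int
  defines "u \<equiv> [u0, u1, u2, u3, u4]" and "w \<equiv> [w0, w1, w2, w3, w4]"
  assumes nonneg: "0 \<le> u0" "0 \<le> u1" "0 \<le> u2" "0 \<le> u3" "0 \<le> u4" "0 \<le> w0" "0 \<le> w1" "0 \<le> w2" "0 \<le> w3" "0 \<le> w4"
    and bounded: "pair_bounded s u" "pair_bounded s w"
    and sum: "u0 + u1 + u2 + u3 + u4 = w0 + w1 + w2 + w3 + w4" "w0 + w1 + w2 + w3 + w4 < 2 * s"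
    and ne: "u \<noteq> w" and nless: "\<not> lexless lex_keys w u"
  shows "\<exists>a<5. \<exists>b<5. a \<noteq> b \<and> admissible lex_keys s u w a b"
proof (rule ccontr)
  assume no: "\<not> ?thesis"
  have N: "\<not> admissible lex_keys s u w a b" if "a < 5" "b < 5" "a \<noteq> b" for a b using no that by blast
  note defs = admissible_def pair_bounded_def lex_keys_def u_def w_def
  have "\<not> admissible lex_keys s u w 0 1" "\<not> admissible lex_keys s u w 0 2" "\<not> admissible lex_keys s u w 0 3"
    "\<not> admissible lex_keys s u w 0 4" "\<not> admissible lex_keys s u w 1 2" "\<not> admissible lex_keys s u w 1 3"
    "\<not> admissible lex_keys s u w 1 4" "\<not> admissible lex_keys s u w 2 3" "\<not> admissible lex_keys s u w 2 4"
    "\<not> admissible lex_keys s u w 3 4"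
    by (rule N; simp)+
  note this[unfolded defs, simplified]
  then show False using nonneg bounded sum ne nless
    unfolding defs by (simp only: nth_Cons_0 nth_Cons_Suc numeral_nat lexless.simps) (smt (verit))
qed

lemma nth_list5:
  fixes x0 x1 x2 x3 x4 y :: 'a
  shows "[x0, x1, x2, x3, x4] ! 0 = x0" "[x0, x1, x2, x3, x4] ! 1 = x1" "[x0, x1, x2, x3, x4] ! 2 = x2" "[x0, x1, x2, x3, x4] ! 3 = x3" "[x0, x1, x2, x3, x4] ! 4 = x4"
    "[x0, x1, x2, x3, x4][0 := y] = [y, x1, x2, x3, x4]"
    "[x0, x1, x2, x3, x4][1 := y] = [x0, y, x2, x3, x4]"
    "[x0, x1, x2, x3, x4][2 := y] = [x0, x1, y, x3, x4]"
    "[x0, x1, x2, x3, x4][3 := y] = [x0, x1, x2, y, x4]"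
    "[x0, x1, x2, x3, x4][4 := y] = [x0, x1, x2, x3, y]"
  by (simp_all add: numeral_nat)

text \<open>If the first exponent is 0, the sum \<open>2 * s\<close> forces exponents 1 and 2, and
  likewise 3 and 4, to add up to \<open>s\<close>. Such a vector is determined by exponents 2 and 4,
  which is why the keys for this case need only two non-trivial entries.\<close>

lemma cycle_move:
  fixes u0 u1 u2 u3 u4 w0 w1 w2 w3 w4 s :: int
  defines "u \<equiv> [u0, u1, u2, u3, u4]" and "w \<equiv> [w0, w1, w2, w3, w4]"
  assumes nonneg: "0 \<le> u0" "0 \<le> u1" "0 \<le> u2" "0 \<le> u3" "0 \<le> u4" "0 \<le> w0" "0 \<le> w1" "0 \<le> w2" "0 \<le> w3" "0 \<le> w4"
    and bounded: "pair_bounded s u" "pair_bounded s w"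
    and sum: "u0 + u1 + u2 + u3 + u4 = 2 * s" "w0 + w1 + w2 + w3 + w4 = 2 * s" and s: "s \<ge> 2"
    and ne: "u \<noteq> w" and nless: "\<not> lexless cycle_keys w u"
  shows "\<exists>a<5. \<exists>b<5. a \<noteq> b \<and> admissible cycle_keys s u w a b"
proof (rule ccontr)
  assume no: "\<not> ?thesis"
  have N: "\<not> admissible cycle_keys s u w a b" if "a < 5" "b < 5" "a \<noteq> b" for a b using no that by blast
  note defs = admissible_def pair_bounded_def cycle_keys_def u_def w_def
  have all: "\<not> admissible cycle_keys s u w 0 1" "\<not> admissible cycle_keys s u w 0 2" "\<not> admissible cycle_keys s u w 0 3"
    "\<not> admissible cycle_keys s u w 0 4" "\<not> admissible cycle_keys s u w 1 0" "\<not> admissible cycle_keys s u w 1 2" "\<not> admissible cycle_keys s u w 1 3"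
    "\<not> admissible cycle_keys s u w 1 4" "\<not> admissible cycle_keys s u w 2 0" "\<not> admissible cycle_keys s u w 2 1" "\<not> admissible cycle_keys s u w 2 3"
    "\<not> admissible cycle_keys s u w 2 4" "\<not> admissible cycle_keys s u w 3 0" "\<not> admissible cycle_keys s u w 3 1" "\<not> admissible cycle_keys s u w 3 2" "\<not> admissible cycle_keys s u w 3 4" "\<not> admissible cycle_keys s u w 4 0" "\<not> admissible cycle_keys s u w 4 1" "\<not> admissible cycle_keys s u w 4 2" "\<not> admissible cycle_keys s u w 4 3"
   
    by (rule N; simp)+
  note all' = all[unfolded defs, unfolded nth_list5 lexless.simps list.inject]
  note hyps = nonneg bounded[unfolded defs, unfolded nth_list5 lexless.simps list.inject] sum s ne[unfolded defs, unfolded nth_list5 lexless.simps list.inject] nless[unfolded defs, unfolded nth_list5 lexless.simps list.inject]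
  \<comment> \<open>The leading key leaves only \<open>w0 \<le> u0\<close>; in case of equality,
    whether the common value vanishes selects the branch of the remaining keys.\<close>
  consider "w0 < u0" | "u0 = w0" "w0 > 0" | "u0 = 0" "w0 = 0" using hyps by (smt (verit))
  then show False
  proof cases
    case 1
    then show False using all' hyps by (smt (verit))
  next
    case 2
    then show False using all' hyps by (smt (verit))
  next
    case 3
    then show False using all' hyps by (smt (verit))
  qed
qed

section \<open>Products of edges supported on the clique and the cycle\<close>

lemma finite_has_maximum:
  fixes f :: "'a \<Rightarrow> nat"
  assumes "finite A" "A \<noteq> {}"
  obtains x where "x \<in> A" "\<And>y. y \<in> A \<Longrightarrow> f y \<le> f x"
proof -
  have "Max (f ` A) \<in> f ` A" using assms by (intro Max_in) auto
  then obtain x where "x \<in> A" "f x = Max (f ` A)" by (metis imageE)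
  then show thesis using that assms(1) by simp
qed

text \<open>The cycle is listed such that consecutive vertices \<open>p\<^sub>j\<close>, \<open>p\<^sub>j\<^sub>+\<^sub>1\<close> are \<^emph>\<open>not\<close> adjacent.\<close>

locale pseudo_split_C5 = pseudo_split E K C for E :: "'v::finite \<Rightarrow> 'v \<Rightarrow> bool" and K C +
  fixes p0 p1 p2 p3 p4 :: 'v
  assumes C_eq: "C = {p0, p1, p2, p3, p4}" and dist: "distinct [p0, p1, p2, p3, p4]"
    and cycle: "E p0 p2" "E p1 p3" "E p2 p4" "E p3 p0" "E p4 p1"
    and chordless: "\<not> E p0 p1" "\<not> E p1 p2" "\<not> E p2 p3" "\<not> E p3 p4" "\<not> E p4 p0"
begin

text \<open>Every independent set inside \<open>K \<union> C\<close> is contained in one of these,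
  so they carry all the bounds coming from independence.\<close>

definition tight_sets :: "'v set set" where
  "tight_sets = (\<lambda>k. {k}) ` K \<union> {{p0, p1}, {p1, p2}, {p2, p3}, {p3, p4}, {p4, p0}}"

lemma total_tight_le:
  assumes "m \<in> edge_sums E s" "T \<in> tight_sets"
  shows "total T m \<le> s"
proof -
  have "\<not> E x y" if "x \<in> T" "y \<in> T" for x y
    using assms(2) that chordless irrefl sym unfolding tight_sets_def by blast
  then show ?thesis using assms(1) total_le_of_independent by (auto simp: edge_sums_def)
qed

lemma total_C: "total C m = exponent m p0 + exponent m p1 + exponent m p2 + exponent m p3 + exponent m p4"
  using dist by (simp add: total_def C_eq)

lemma total_pairs:
  "total {p0, p1} m = exponent m p0 + exponent m p1" "total {p1, p2} m = exponent m p1 + exponent m p2"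
  "total {p2, p3} m = exponent m p2 + exponent m p3" "total {p3, p4} m = exponent m p3 + exponent m p4"
  "total {p4, p0} m = exponent m p4 + exponent m p0" "total {k} m = exponent m k"
  using dist by (auto simp: total_def)

text \<open>Removing an edge lowers the bound by one. Sets containing an end of the edge lose at
  least one as well; the others need slack beforehand.\<close>

lemma split_edge:
  assumes IH: "\<And>m. (\<And>v. v \<in> S \<Longrightarrow> exponent m v = 0) \<Longrightarrow> total UNIV m = 2 * s \<Longrightarrow>
      (\<And>T. T \<in> tight_sets \<Longrightarrow> total T m \<le> s) \<Longrightarrow> m \<in> edge_sums E s"
    and m: "\<And>v. v \<in> S \<Longrightarrow> exponent m v = 0" "total UNIV m = 2 * Suc s"
      "\<And>T. T \<in> tight_sets \<Longrightarrow> total T m \<le> Suc s"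
    and xy: "E x y" "exponent m x > 0" "exponent m y > 0"
    and tight: "\<And>T. T \<in> tight_sets \<Longrightarrow> x \<notin> T \<Longrightarrow> y \<notin> T \<Longrightarrow> total T m \<le> s"
  shows "m \<in> edge_sums E (Suc s)"
proof -
  define m' where "m' = m - evar x - evar y"
  have "x \<noteq> y" using xy irrefl by auto
  then have m': "m = m' + evar x + evar y"
    using xy(2,3) by (intro poly_mapping_eqI)
      (auto simp: m'_def lookup_add lookup_minus exponent_evar)
  have tot: "total A m = total A m' + (if x \<in> A then 1 else 0) + (if y \<in> A then 1 else 0)" for A
    by (subst m') (simp add: total_evar)
  have "m' \<in> edge_sums E s"
  proof (rule IH)
    show "exponent m' v = 0" if "v \<in> S" for v
      using m(1)[OF that] by (simp add: m'_def lookup_minus)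
    show "total UNIV m' = 2 * s" using tot[of UNIV] m(2) by simp
    show "total T m' \<le> s" if "T \<in> tight_sets" for T
      using m(3)[OF that] tight[OF that] tot[of T] by (auto split: if_splits)
  qed
  then show ?thesis using edge_sums_Suc[OF xy(1)] m' by simp
qed

lemma tight_pair_vertex:
  fixes a b c d e s :: int
  assumes "0 \<le> a" "0 \<le> b" "0 \<le> c" "0 \<le> d" "0 \<le> e" "a + b = s" "b + c \<le> s" "e + a \<le> s"
    "a + b + c + d + e < 2 * s"
  shows "a > 0 \<and> b + c < s \<and> c + d < s \<and> d + e < s \<or> b > 0 \<and> c + d < s \<and> d + e < s \<and> e + a < s"
  using assms by (smt (verit))

text \<open>Two disjoint tight pairs would already have sum \<open>2 * s\<close>. So tight pairs
  intersect pairwise, and in a 5-cycle of pairs they share a vertex. Its exponent is positive if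
  there are two such pairs, again because the sum is below \<open>2 * s\<close>; for one pair a
  vertex of positive exponent is chosen.\<close>

lemma exists_tight_vertex:
  assumes "total C m > 0" "total C m < 2 * s" "\<And>T. T \<in> tight_sets \<Longrightarrow> total T m \<le> s"
  shows "\<exists>c\<in>C. exponent m c > 0 \<and>
    (\<forall>T\<in>{{p0, p1}, {p1, p2}, {p2, p3}, {p3, p4}, {p4, p0}}. c \<notin> T \<longrightarrow> total T m < s)"
proof (rule ccontr)
  assume no: "\<not> ?thesis"
  define g0 g1 g2 g3 g4 where g: "g0 = int (exponent m p0)" "g1 = int (exponent m p1)"
    "g2 = int (exponent m p2)" "g3 = int (exponent m p3)" "g4 = int (exponent m p4)"
  have le: "g0 + g1 \<le> int s" "g1 + g2 \<le> int s" "g2 + g3 \<le> int s" "g3 + g4 \<le> int s" "g4 + g0 \<le> int s"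
    using assms(3)[of "{p0, p1}"] assms(3)[of "{p1, p2}"] assms(3)[of "{p2, p3}"] assms(3)[of "{p3, p4}"]
      assms(3)[of "{p4, p0}"] by (auto simp: tight_sets_def total_pairs g)
  have nonneg: "0 \<le> g0" "0 \<le> g1" "0 \<le> g2" "0 \<le> g3" "0 \<le> g4" by (simp_all add: g)
  have sum: "0 < g0 + g1 + g2 + g3 + g4" "g0 + g1 + g2 + g3 + g4 < 2 * int s"
    using assms(1,2) unfolding total_C g by linarith+
  have N: "\<exists>T\<in>{{p0, p1}, {p1, p2}, {p2, p3}, {p3, p4}, {p4, p0}}. c \<notin> T \<and> int s \<le> int (total T m)"
    if "c \<in> C" "exponent m c > 0" for c
    using no that by (meson not_le of_nat_le_iff)
  have not0: "\<not> (g0 > 0 \<and> g1 + g2 < int s \<and> g2 + g3 < int s \<and> g3 + g4 < int s)"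
    using N[of p0] by (auto simp: C_eq total_pairs g)
  have not1: "\<not> (g1 > 0 \<and> g2 + g3 < int s \<and> g3 + g4 < int s \<and> g4 + g0 < int s)"
    using N[of p1] by (auto simp: C_eq total_pairs g)
  have not2: "\<not> (g2 > 0 \<and> g3 + g4 < int s \<and> g4 + g0 < int s \<and> g0 + g1 < int s)"
    using N[of p2] by (auto simp: C_eq total_pairs g)
  have not3: "\<not> (g3 > 0 \<and> g4 + g0 < int s \<and> g0 + g1 < int s \<and> g1 + g2 < int s)"
    using N[of p3] by (auto simp: C_eq total_pairs g)
  have not4: "\<not> (g4 > 0 \<and> g0 + g1 < int s \<and> g1 + g2 < int s \<and> g2 + g3 < int s)"
    using N[of p4] by (auto simp: C_eq total_pairs g)
  note not_all = not0 not1 not2 not3 not4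
  have "g0 + g1 < int s"
  proof (rule ccontr)
    assume "\<not> ?thesis"
    with le have "g0 + g1 = int s" by linarith
    moreover have "g0 + g1 + g2 + g3 + g4 < 2 * int s" using sum by linarith
    ultimately show False
      using tight_pair_vertex[OF nonneg(1,2,3,4,5) _ le(2,5)] not_all by blast
  qed
  moreover have "g1 + g2 < int s"
  proof (rule ccontr)
    assume "\<not> ?thesis"
    with le have "g1 + g2 = int s" by linarith
    moreover have "g1 + g2 + g3 + g4 + g0 < 2 * int s" using sum by linarith
    ultimately show False
      using tight_pair_vertex[OF nonneg(2,3,4,5,1) _ le(3,1)] not_all by blast
  qed
  moreover have "g2 + g3 < int s"
  proof (rule ccontr)
    assume "\<not> ?thesis"
    with le have "g2 + g3 = int s" by linarith
    moreover have "g2 + g3 + g4 + g0 + g1 < 2 * int s" using sum by linarith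
    ultimately show False
      using tight_pair_vertex[OF nonneg(3,4,5,1,2) _ le(4,2)] not_all by blast
  qed
  moreover have "g3 + g4 < int s"
  proof (rule ccontr)
    assume "\<not> ?thesis"
    with le have "g3 + g4 = int s" by linarith
    moreover have "g3 + g4 + g0 + g1 + g2 < 2 * int s" using sum by linarith
    ultimately show False
      using tight_pair_vertex[OF nonneg(4,5,1,2,3) _ le(5,3)] not_all by blast
  qed
  moreover have "g4 + g0 < int s"
  proof (rule ccontr)
    assume "\<not> ?thesis"
    with le have "g4 + g0 = int s" by linarith
    moreover have "g4 + g0 + g1 + g2 + g3 < 2 * int s" using sum by linarith
    ultimately show False
      using tight_pair_vertex[OF nonneg(5,1,2,3,4) _ le(1,4)] not_all by blast
  qed
  moreover have "g0 > 0 \<or> g1 > 0 \<or> g2 > 0 \<or> g3 > 0 \<or> g4 > 0" using sum(1) by linarith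
  ultimately show False using not_all by blast
qed

text \<open>The converse of the bounds in \<open>total_tight_le\<close>. The induction peels off one
  edge that meets every set attaining its bound: a cycle edge, an edge from the clique to the cycle,
  or an edge between the two largest clique exponents.\<close>

lemma edge_sums_of_bounded:
  assumes "\<And>v. v \<in> S \<Longrightarrow> exponent m v = 0" "total UNIV m = 2 * s" "\<And>T. T \<in> tight_sets \<Longrightarrow> total T m \<le> s"
  shows "m \<in> edge_sums E s"
  using assms
proof (induction s arbitrary: m)
  case 0
  then have "m = 0" by (intro poly_mapping_eqI) (simp add: total_def)
  then show ?case by (intro edge_sumsI[of "{#}"]) auto
next
  case (Suc s)
  have tot: "total K m + total C m = 2 * Suc s"
    using total_split[of m] Suc.prems(1,2) by (simp add: total_def)
  have split: "m \<in> edge_sums E (Suc s)" if "E x y" "exponent m x > 0" "exponent m y > 0"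
    "\<And>T. T \<in> tight_sets \<Longrightarrow> x \<notin> T \<Longrightarrow> y \<notin> T \<Longrightarrow> total T m \<le> s" for x y
    by (rule split_edge[of s m x y]) (fact Suc.IH Suc.prems that)+
  have K_le: "exponent m k \<le> Suc s" if "k \<in> K" for k
    using Suc.prems(3)[of "{k}"] that by (auto simp: tight_sets_def total_pairs)
  have K_sum: "(\<Sum>k\<in>A. exponent m k) \<le> total K m" if "A \<subseteq> K" for A
    unfolding total_def by (rule sum_mono2) (use that in auto)
  show ?case
  proof (cases "total K m = 0")
    case True
    then have K0: "exponent m k = 0" if "k \<in> K" for k using that by (simp add: total_def)
    define g0 g1 g2 g3 g4 where g: "g0 = exponent m p0" "g1 = exponent m p1" "g2 = exponent m p2"
      "g3 = exponent m p3" "g4 = exponent m p4"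
    have le: "g0 + g1 \<le> Suc s" "g1 + g2 \<le> Suc s" "g2 + g3 \<le> Suc s" "g3 + g4 \<le> Suc s" "g4 + g0 \<le> Suc s"
      using Suc.prems(3)[of "{p0, p1}"] Suc.prems(3)[of "{p1, p2}"] Suc.prems(3)[of "{p2, p3}"]
        Suc.prems(3)[of "{p3, p4}"] Suc.prems(3)[of "{p4, p0}"] by (auto simp: tight_sets_def total_pairs g)
    have sum: "g0 + g1 + g2 + g3 + g4 = 2 * s + 2" using tot True by (simp add: total_C g)
    have tight: "total T m \<le> s" if "T \<in> tight_sets" "x \<notin> T" "y \<notin> T"
      "\<And>T. T \<in> {{p0, p1}, {p1, p2}, {p2, p3}, {p3, p4}, {p4, p0}} \<Longrightarrow> x \<notin> T \<Longrightarrow> y \<notin> T \<Longrightarrow> total T m \<le> s" for x y T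
    proof (cases "\<exists>k\<in>K. T = {k}")
      case True
      then show ?thesis using K0 by (auto simp: total_pairs)
    next
      case False
      then have "T \<in> {{p0, p1}, {p1, p2}, {p2, p3}, {p3, p4}, {p4, p0}}"
        using that(1) by (auto simp: tight_sets_def)
      then show ?thesis using that by blast
    qed
    have split_cycle: "m \<in> edge_sums E (Suc s)" if xy: "E x y" "exponent m x > 0" "exponent m y > 0"
      and cyc: "\<And>T. T \<in> {{p0, p1}, {p1, p2}, {p2, p3}, {p3, p4}, {p4, p0}} \<Longrightarrow> x \<notin> T \<Longrightarrow> y \<notin> T \<Longrightarrow> total T m \<le> s"
      for x y
    proof (rule split[OF xy])
      fix T assume T: "T \<in> tight_sets" "x \<notin> T" "y \<notin> T"
      show "total T m \<le> s" by (rule tight[OF T]) (rule cyc)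
    qed
    \<comment> \<open>Each exponent lies in two pairs, so five tight pairs would give
      \<open>5 * (s + 1)\<close> instead of \<open>4 * (s + 1)\<close>. The cycle edge disjoint from
      a slack pair meets the other four, and the sum makes both its exponents positive.\<close>
    have "g3 + g4 \<le> s \<or> g4 + g0 \<le> s \<or> g0 + g1 \<le> s \<or> g1 + g2 \<le> s \<or> g2 + g3 \<le> s"
    proof (rule ccontr)
      assume "\<not> ?thesis"
      then have "s < g3 + g4" "s < g4 + g0" "s < g0 + g1" "s < g1 + g2" "s < g2 + g3" by auto
      with sum show False by linarith
    qed
    then consider "g3 + g4 \<le> s" | "g4 + g0 \<le> s" | "g0 + g1 \<le> s" | "g1 + g2 \<le> s" | "g2 + g3 \<le> s"
      by blast
    then show ?thesis
    proof cases
      case 1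
      have "g0 > 0" "g2 > 0" using 1 le sum by linarith+
      then show ?thesis using 1 unfolding g
        by (intro split_cycle[OF cycle(1)]) (auto simp: total_pairs)
    next
      case 2
      have "g1 > 0" "g3 > 0" using 2 le sum by linarith+
      then show ?thesis using 2 unfolding g
        by (intro split_cycle[OF cycle(2)]) (auto simp: total_pairs)
    next
      case 3
      have "g2 > 0" "g4 > 0" using 3 le sum by linarith+
      then show ?thesis using 3 unfolding g
        by (intro split_cycle[OF cycle(3)]) (auto simp: total_pairs)
    next
      case 4
      have "g3 > 0" "g0 > 0" using 4 le sum by linarith+
      then show ?thesis using 4 unfolding g
        by (intro split_cycle[OF cycle(4)]) (auto simp: total_pairs)
    next
      case 5
      have "g4 > 0" "g1 > 0" using 5 le sum by linarith+
      then show ?thesis using 5 unfolding g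
        by (intro split_cycle[OF cycle(5)]) (auto simp: total_pairs)
    qed
  next
    case False
    then have "K \<noteq> {}" by (auto simp: total_def)
    then obtain k where k: "k \<in> K" "\<And>k'. k' \<in> K \<Longrightarrow> exponent m k' \<le> exponent m k"
      using finite_has_maximum[OF finite] by metis
    have k_pos: "exponent m k > 0"
      using False k by (auto simp: total_def intro!: gr0I)
    \<comment> \<open>A second clique exponent above \<open>s\<close>, together with that of
      \<open>k\<close>, would use up the whole degree and leave nothing for
      \<open>C\<close>.\<close>
    have k_max: "exponent m k' \<le> s" if "k' \<in> K" "k' \<noteq> k" "total C m > 0" for k'
      using K_sum[of "{k, k'}"] that k(1) k(2)[of k'] tot by auto
    show ?thesis
    proof (cases "total C m > 0")
      case True
      have "total C m < 2 * Suc s" using tot False by linarith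
      from exists_tight_vertex[OF True this Suc.prems(3)] obtain c where c: "c \<in> C" "exponent m c > 0"
        "\<And>T. T \<in> {{p0, p1}, {p1, p2}, {p2, p3}, {p3, p4}, {p4, p0}} \<Longrightarrow> c \<notin> T \<Longrightarrow> total T m \<le> s"
        by (metis less_Suc_eq_le)
      have "E k c" using clique[of k c] k(1) c(1) disjoint by blast
      then show ?thesis
      proof (rule split[OF _ k_pos c(2)])
        fix T assume T: "T \<in> tight_sets" "k \<notin> T" "c \<notin> T"
        then consider k' where "k' \<in> K" "T = {k'}" | "T \<in> {{p0, p1}, {p1, p2}, {p2, p3}, {p3, p4}, {p4, p0}}"
          unfolding tight_sets_def by blast
        then show "total T m \<le> s"
        proof cases
          case 1
          then show ?thesis using k_max[of k'] T True by (auto simp: total_pairs)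
        next
          case 2
          then show ?thesis using c(3) T by blast
        qed
      qed
    next
      case C0: False
      then have totK: "total K m = 2 * s + 2" using tot by simp
      have "total K m = exponent m k + (\<Sum>k\<in>K - {k}. exponent m k)"
        unfolding total_def using k(1) by (simp add: sum.remove)
      then have pos: "(\<Sum>k\<in>K - {k}. exponent m k) > 0" using totK K_le[OF k(1)] by linarith
      then have "K - {k} \<noteq> {}" by (metis less_irrefl sum.empty)
      then obtain l where l: "l \<in> K - {k}" "\<And>k'. k' \<in> K - {k} \<Longrightarrow> exponent m k' \<le> exponent m l"
        using finite_has_maximum[OF finite] by metis
      have "exponent m l > 0"
      proof (rule ccontr)
        assume "\<not> exponent m l > 0"
        then have "(\<Sum>k\<in>K - {k}. exponent m k) = 0" using l(2) by (auto intro!: sum.neutral)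
        with pos show False by simp
      qed
      moreover have "E k l" using clique[of k l] k(1) l(1) by blast
      ultimately show ?thesis
      proof (intro split[OF _ k_pos])
        fix T assume T: "T \<in> tight_sets" "k \<notin> T" "l \<notin> T"
        have "exponent m v = 0" if "v \<in> C" for v using C0 that by (simp add: total_def)
        \<comment> \<open>A third exponent is at most a third of the total
          \<open>2 * s + 2\<close>.\<close>
        moreover have "exponent m k' \<le> s" if "k' \<in> K" "k' \<noteq> k" "k' \<noteq> l" for k'
        proof -
          have "exponent m k + (exponent m l + exponent m k') \<le> 2 * s + 2"
            using K_sum[of "{k, l, k'}"] that k(1) l(1) totK by auto
          moreover have "exponent m k' \<le> exponent m k" "exponent m k' \<le> exponent m l"
            using k(2) l(2) that by auto
          ultimately show ?thesis by linarith
        qed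
        ultimately show "total T m \<le> s" using T unfolding tight_sets_def C_eq
          by (auto simp: total_pairs)
      qed auto
    qed
  qed
qed

section \<open>The order on the exponents of the cycle\<close>

definition cycle_exponents :: "('v \<Rightarrow>\<^sub>0 nat) \<Rightarrow> int list" where
  "cycle_exponents m = map (\<lambda>v. int (exponent m v)) [p0, p1, p2, p3, p4]"

text \<open>The choice of keys is made inside each function, since the list itself must be fixed.
  Both lists have four entries, and monomials compared by them agree on \<open>K\<close>, so they
  use the same keys.\<close>

definition cycle_order :: "(('v \<Rightarrow>\<^sub>0 nat) \<Rightarrow> int) list" where
  "cycle_order = map (\<lambda>i m. ((if total K m = 0 then cycle_keys else lex_keys) ! i) (cycle_exponents m)) [0, 1, 2, 3]"

lemma lexless_cycle_order:
  assumes "total K m = total K m'"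
  shows "lexless cycle_order m m' \<longleftrightarrow>
    lexless (if total K m = 0 then cycle_keys else lex_keys) (cycle_exponents m) (cycle_exponents m')"
  using assms by (cases "total K m' = 0")
    (simp_all add: cycle_order_def cycle_keys_def lex_keys_def numeral_nat)

lemma cycle_order_move:
  assumes "s \<ge> 2" and u: "u \<in> edge_sums E s" and w: "w \<in> edge_sums E s" and ne: "u \<noteq> w"
    and K_eq: "\<And>v. v \<in> K \<Longrightarrow> exponent u v = exponent w v"
    and S0: "\<And>v. v \<in> S \<Longrightarrow> exponent u v = 0 \<and> exponent w v = 0"
  shows "lexless cycle_order w u \<or> (\<exists>a\<in>C. \<exists>b\<in>C. \<exists>w'\<in>edge_sums E s. w' + evar b = w + evar a \<and>
    exponent w a < exponent u a \<and> lexless cycle_order w' w)"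
proof (cases "lexless cycle_order w u")
  case False
  let ?u = "cycle_exponents u" and ?w = "cycle_exponents w" and ?s = "int s"
  define ks where "ks = (if total K w = 0 then cycle_keys else lex_keys)"
  have totK: "total K u = total K w" unfolding total_def using K_eq by auto
  have tot: "total K m + total C m = 2 * s" if "m = u \<or> m = w" for m
    using that total_split[of m] edge_sums_total[OF u] edge_sums_total[OF w] S0 by (auto simp: total_def)
  have bounded: "pair_bounded ?s (cycle_exponents m)" if "m \<in> edge_sums E s" for m
    using total_tight_le[OF that, of "{p0, p1}"] total_tight_le[OF that, of "{p1, p2}"]
      total_tight_le[OF that, of "{p2, p3}"] total_tight_le[OF that, of "{p3, p4}"]
      total_tight_le[OF that, of "{p4, p0}"]
    by (simp add: pair_bounded_def cycle_exponents_def tight_sets_def total_pairs numeral_nat)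
  have "\<not> lexless ks ?w ?u" using False by (simp add: lexless_cycle_order totK ks_def)
  moreover have "?u \<noteq> ?w"
  proof
    assume "?u = ?w"
    then have "exponent u v = exponent w v" for v
      using K_eq[of v] S0[of v] by (cases "v \<in> K"; cases "v \<in> C") (auto simp: cycle_exponents_def C_eq)
    with ne show False by (metis poly_mapping_eqI)
  qed
  ultimately have "\<exists>a<5. \<exists>b<5. a \<noteq> b \<and> admissible ks ?s ?u ?w a b"
    using bounded[OF u] bounded[OF w] tot[of u] tot[of w] totK \<open>s \<ge> 2\<close>
    unfolding ks_def cycle_exponents_def list.map
    by (cases "total K w = 0")
      (simp only: if_True if_False simp_thms, rule cycle_move lex_move; simp add: total_C; linarith)+
  then obtain a b where ab: "a < 5" "b < 5" "a \<noteq> b" "admissible ks ?s ?u ?w a b" by blast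
  define p where "p = [p0, p1, p2, p3, p4]"
  have p: "length p = 5" "distinct p" "set p = C" using dist by (auto simp: p_def C_eq)
  have pC: "p ! a \<in> C" "p ! b \<in> C" "p ! a \<noteq> p ! b"
    using ab p by (auto simp: nth_eq_iff_index_eq simp flip: p(3))
  have len: "length (cycle_exponents m) = 5" for m by (simp add: cycle_exponents_def)
  have nth: "cycle_exponents m ! j = int (exponent m (p ! j))" if "j < 5" for m j
    using that p(1) unfolding cycle_exponents_def p_def[symmetric] by simp
  have w_b: "exponent w (p ! b) > 0" and less: "exponent w (p ! a) < exponent u (p ! a)"
    and bd: "pair_bounded ?s (move ?w a b)" and lx: "lexless ks (move ?w a b) ?w"
    using ab by (auto simp: admissible_def nth)
  define w' where "w' = (w - evar (p ! b)) + evar (p ! a)"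
  have w': "w' + evar (p ! b) = w + evar (p ! a)"
    using w_b pC(3) by (intro poly_mapping_eqI)
      (auto simp: w'_def lookup_add lookup_minus exponent_evar)
  have eq: "exponent w' v = exponent w v" if "v \<notin> C" for v
    using exponent_eq_of_move[OF w', of v] pC that by metis
  have totK': "total K w' = total K w" using total_eq_of_move[OF w'] pC disjoint by blast
  have exps: "cycle_exponents w' = move ?w a b"
  proof (rule nth_equalityI)
    fix j assume "j < length (cycle_exponents w')"
    then have j: "j < 5" by (simp add: len)
    have "p ! j = p ! i \<longleftrightarrow> j = i" if "i < 5" for i using p j that by (simp add: nth_eq_iff_index_eq)
    then show "cycle_exponents w' ! j = move ?w a b ! j"
      using j ab w_b by (auto simp: nth w'_def lookup_add lookup_minus exponent_evar nth_list_update
          len)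
  qed (simp add: len)
  \<comment> \<open>The move does not touch \<open>K\<close> and \<open>S\<close>, and admissibility
    contains the five pair bounds, so the characterisation by inequalities applies.\<close>
  have "w' \<in> edge_sums E s"
  proof (rule edge_sums_of_bounded)
    show "exponent w' v = 0" if "v \<in> S" for v using eq[of v] S0[OF that] that by simp
    show "total UNIV w' = 2 * s"
      using arg_cong[OF w', of "total UNIV"] edge_sums_total[OF w] by (simp add: total_evar)
    show "total T w' \<le> s" if "T \<in> tight_sets" for T
    proof (cases "\<exists>k\<in>K. T = {k}")
      case True
      then obtain k where "k \<in> K" "T = {k}" by blast
      then show ?thesis using total_tight_le[OF w that] eq[of k] disjoint by (fastforce simp: total_pairs)
    next
      case False
      then show ?thesis using that bd[folded exps]
        by (auto simp: tight_sets_def total_pairs pair_bounded_def cycle_exponents_def numeral_nat)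
    qed
  qed
  moreover have "lexless cycle_order w' w"
    using lx totK' by (simp add: lexless_cycle_order exps ks_def)
  ultimately show ?thesis using w' less pC by blast
qed simp

lemma cycle_order_cong:
  assumes "f \<in> set cycle_order" "\<And>v. v \<in> K \<union> C \<Longrightarrow> exponent m v = exponent m' v"
  shows "f m = f m'"
proof -
  have "total K m = total K m'" unfolding total_def using assms(2) by auto
  moreover have "cycle_exponents m = cycle_exponents m'" using assms(2) by (simp add: cycle_exponents_def C_eq)
  ultimately show ?thesis using assms(1) by (auto simp: cycle_order_def)
qed

end

section \<open>The structure of \<open>(C\<^sub>4, 2K\<^sub>2)\<close>-free graphs\<close>

locale C4_2K2_free = symmetric_relation E for E :: "'v::finite \<Rightarrow> 'v \<Rightarrow> bool" +
  assumes no_C4: "E a b \<Longrightarrow> E b c \<Longrightarrow> E c d \<Longrightarrow> E d a \<Longrightarrow> a \<noteq> c \<Longrightarrow> b \<noteq> d \<Longrightarrow> E a c \<or> E b d"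
    and no_2K2: "E a b \<Longrightarrow> E c d \<Longrightarrow> a \<noteq> c \<Longrightarrow> a \<noteq> d \<Longrightarrow> b \<noteq> c \<Longrightarrow> b \<noteq> d \<Longrightarrow> E a c \<or> E a d \<or> E b c \<or> E b d"
begin

text \<open>A vertex outside the cycle sees all of it or none of it; \<open>K\<close> collects those
  that see all. The final listing walks along the cycle in steps of three, which makes consecutive
  vertices non-adjacent.\<close>

lemma pseudo_split_of_C5:
  assumes c: "E c0 c1" "E c1 c2" "E c2 c3" "E c3 c4" "E c4 c0"
    and n: "\<not> E c0 c2" "\<not> E c1 c3" "\<not> E c2 c4" "\<not> E c3 c0" "\<not> E c4 c1"
  shows "\<exists>K. pseudo_split_C5 E K {c0, c3, c1, c4, c2} c0 c3 c1 c4 c2"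
proof -
  define C where "C = {c0, c3, c1, c4, c2}"
  define K where "K = {v. v \<notin> C \<and> (\<forall>c\<in>C. E v c)}"
  have d: "distinct [c0, c1, c2, c3, c4]" using c n irrefl sym by auto
  note s = c[THEN sym]
  have n': "\<not> E c2 c0" "\<not> E c3 c1" "\<not> E c4 c2" "\<not> E c0 c3" "\<not> E c1 c4" using n sym by blast+
  have none: "\<not> E v c" if v: "v \<notin> C" "v \<notin> K" and "c \<in> C" for v c
  proof -
    have ne: "v \<noteq> c0" "v \<noteq> c1" "v \<noteq> c2" "v \<noteq> c3" "v \<noteq> c4" using v by (auto simp: C_def)
    \<comment> \<open>A vertex seeing both ends of an induced path of length two sees its middle, by
      \<open>no_C4\<close>. A vertex seeing \<open>a\<close> sees an end of the opposite edge, by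
      \<open>no_2K2\<close>. Around the cycle, the two rules spread one adjacency to all
      five.\<close>
    have skip: "E v b" if "E v a" "E v c" "E a b" "E b c" "a \<noteq> c" "v \<noteq> b" "\<not> E a c" for a b c
      using no_C4[of v a b c] that sym by blast
    have opp: "E v b \<or> E v c" if "E v a" "E b c" "\<not> E a b" "\<not> E a c" "v \<noteq> b" "v \<noteq> c" "a \<noteq> b" "a \<noteq> c" for a b c
      using no_2K2[of v a b c] that by blast
    have A0: "E v c1" if "E v c0" "E v c2"
      by (rule skip[of c0 c2 c1]) (use that c n d ne in auto)
    have A1: "E v c2" if "E v c1" "E v c3"
      by (rule skip[of c1 c3 c2]) (use that c n d ne in auto)
    have A2: "E v c3" if "E v c2" "E v c4"
      by (rule skip[of c2 c4 c3]) (use that c n d ne in auto)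
    have A3: "E v c4" if "E v c3" "E v c0"
      by (rule skip[of c3 c0 c4]) (use that c n d ne in auto)
    have A4: "E v c0" if "E v c4" "E v c1"
      by (rule skip[of c4 c1 c0]) (use that c n d ne in auto)
    have B0: "E v c2 \<or> E v c3" if "E v c0"
      by (rule opp[of c0 c2 c3]) (use that c n n' d ne in auto)
    have B1: "E v c3 \<or> E v c4" if "E v c1"
      by (rule opp[of c1 c3 c4]) (use that c n n' d ne in auto)
    have B2: "E v c4 \<or> E v c0" if "E v c2"
      by (rule opp[of c2 c4 c0]) (use that c n n' d ne in auto)
    have B3: "E v c0 \<or> E v c1" if "E v c3"
      by (rule opp[of c3 c0 c1]) (use that c n n' d ne in auto)
    have B4: "E v c1 \<or> E v c2" if "E v c4"
      by (rule opp[of c4 c1 c2]) (use that c n n' d ne in auto)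
    have "\<not> (E v c0 \<and> E v c1 \<and> E v c2 \<and> E v c3 \<and> E v c4)" using v by (auto simp: K_def C_def)
    then have "\<not> E v c0 \<and> \<not> E v c1 \<and> \<not> E v c2 \<and> \<not> E v c3 \<and> \<not> E v c4" using A0 A1 A2 A3 A4 B0 B1 B2 B3 B4 by blast
    then show ?thesis using \<open>c \<in> C\<close> by (auto simp: C_def)
  qed
  have "pseudo_split_C5 E K C c0 c3 c1 c4 c2"
  proof
    show "K \<inter> C = {}" by (auto simp: K_def)
    show "E x y" if "x \<in> K" "y \<in> K \<union> C" "x \<noteq> y" for x y
    proof (cases "y \<in> C")
      case False
      then have "E x c0" "E x c2" "E y c0" "E y c2" using that by (auto simp: K_def C_def)
      then show ?thesis using no_C4[of x c0 y c2] that(3) d n sym by auto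
    qed (use that in \<open>auto simp: K_def\<close>)
    show "\<not> E x y" if "x \<notin> K \<union> C" "y \<notin> K" for x y
    proof (cases "y \<in> C")
      case False
      show ?thesis
      proof
        assume "E x y"
        moreover have "\<not> E x c0" "\<not> E x c1" "\<not> E y c0" "\<not> E y c1"
          using none that False by (auto simp: C_def)
        ultimately show False using no_2K2[of x y c0 c1] c that False by (auto simp: C_def)
      qed
    qed (use that none in auto)
  qed (use c d n n' s in \<open>auto simp: C_def\<close>)
  then show ?thesis unfolding C_def by blast
qed

text \<open>Take a maximum clique \<open>K\<close> for which the graph outside \<open>K\<close> has as few edges as possible. An edge
  \<open>xy\<close> outside \<open>K\<close> then yields a 5-cycle (Golumbic's proof of the theorem of Foeldes and Hammer).\<close>

lemma C5_of_edge_outside_clique: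
  assumes clique: "\<And>a b. a \<in> K \<Longrightarrow> b \<in> K \<Longrightarrow> a \<noteq> b \<Longrightarrow> E a b"
    and few: "\<And>y v. y \<notin> K \<Longrightarrow> v \<in> K \<Longrightarrow> (\<And>w. w \<in> K - {v} \<Longrightarrow> E y w) \<Longrightarrow>
      card {(a, b). E a b \<and> a \<notin> K \<and> b \<notin> K} \<le>
      card {(a, b). E a b \<and> a \<notin> insert y (K - {v}) \<and> b \<notin> insert y (K - {v})}"
    and xy: "E x y" "x \<notin> K" "y \<notin> K"
    and uv: "u \<in> K" "v \<in> K" "u \<noteq> v" "\<not> E x u" "\<not> E x v" "\<not> E y v" "E y u"
  shows "\<exists>z. E v z \<and> E z x \<and> \<not> E z y \<and> \<not> E u z"
proof -
  have ne: "x \<noteq> u" "x \<noteq> v" "y \<noteq> u" "y \<noteq> v" "x \<noteq> y" using xy uv irrefl by auto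
  have Euv: "E u v" using clique uv by blast
  \<comment> \<open>Hence exchanging \<open>v\<close> for \<open>y\<close> in \<open>K\<close> gives
    another clique of the same size, to which \<open>few\<close> applies.\<close>
  have adj: "E y w" if "w \<in> K - {v}" for w
  proof (rule ccontr)
    assume yw: "\<not> E y w"
    then have w: "w \<in> K" "w \<noteq> v" "w \<noteq> u" "w \<noteq> x" "w \<noteq> y" using that uv xy by auto
    show False
    proof (cases "E x w")
      case True
      then show False
        using no_C4[of x y u w] clique[of u w] w uv xy ne sym yw by blast
    next
      case False
      then show False
        using no_2K2[of x y w v] clique[of w v] w uv xy ne sym yw by blast
    qed
  qed
  let ?K' = "insert y (K - {v})"
  define P where "P = {(a, b). E a b \<and> a \<notin> K \<and> b \<notin> K}"
  define P' where "P' = {(a, b). E a b \<and> a \<notin> ?K' \<and> b \<notin> ?K'}"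
  \<comment> \<open>Otherwise every outside neighbour of \<open>v\<close> is a neighbour of
    \<open>y\<close>. Replacing \<open>v\<close> by \<open>y\<close> then injects the edges outside
    the new clique into those outside \<open>K\<close> and misses \<open>xy\<close>, against the
    choice of \<open>K\<close>.\<close>
  have "\<exists>z. E v z \<and> z \<notin> K \<and> \<not> E y z"
  proof (rule ccontr)
    assume "\<not> ?thesis"
    then have sub: "E y z" if "E v z" "z \<notin> K" for z using that by blast
    define \<phi> where "\<phi> c = (if c = v then y else c)" for c
    have "inj_on (map_prod \<phi> \<phi>) P'"
      by (auto simp: inj_on_def P'_def \<phi>_def split: if_splits)
    moreover have "map_prod \<phi> \<phi> ` P' \<subseteq> P"
    proof (rule image_subsetI)
      fix c assume "c \<in> P'"
      moreover obtain a b where c: "c = (a, b)" by force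
      ultimately have ab: "E a b" "a = v \<or> a \<notin> K" "b = v \<or> b \<notin> K" "a \<noteq> y" "b \<noteq> y" by (auto simp: P'_def)
      have "E y b" if "a = v" "b \<noteq> v" using sub[of b] ab that by blast
      moreover have "E a y" if "b = v" "a \<noteq> v" using sub[of a] ab that sym by blast
      moreover have "a \<noteq> v \<or> b \<noteq> v" using ab irrefl by blast
      ultimately show "map_prod \<phi> \<phi> c \<in> P"
        using ab xy unfolding c by (cases "a = v"; cases "b = v") (simp_all add: P_def \<phi>_def)
    qed
    moreover have "(x, y) \<notin> map_prod \<phi> \<phi> ` P'"
    proof
      assume "(x, y) \<in> map_prod \<phi> \<phi> ` P'"
      then obtain a b where ab: "(a, b) \<in> P'" "x = \<phi> a" "y = \<phi> b" by (elim imageE) force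
      have "b \<noteq> y" "E a b" using ab(1) by (simp_all add: P'_def)
      moreover from this have "b = v" using ab(3) by (simp add: \<phi>_def split: if_splits)
      moreover have "a = x" using ab(2) ne(5) by (simp add: \<phi>_def split: if_splits)
      ultimately show False using uv(5) by simp
    qed
    moreover have "(x, y) \<in> P" using xy by (auto simp: P_def)
    ultimately have "map_prod \<phi> \<phi> ` P' \<subset> P" by blast
    then have "card (map_prod \<phi> \<phi> ` P') < card P" by (intro psubset_card_mono) auto
    then have "card P' < card P" using \<open>inj_on _ _\<close> by (simp add: card_image)
    with few[of y v] adj xy uv show False by (simp add: P_def P'_def)
  qed
  then obtain z where z: "E v z" "z \<notin> K" "\<not> E y z" by blast
  have "z \<noteq> x" "z \<noteq> y" "z \<noteq> v" "z \<noteq> u" using z uv irrefl sym by auto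
  moreover have "\<not> E x v" "\<not> E y v" "\<not> E y z" "E z v" using uv z sym by auto
  ultimately have "E x z" using no_2K2[OF xy(1) \<open>E z v\<close>] ne by blast
  then have "E z x" by (rule sym)
  moreover have "\<not> E u z"
    using no_C4[OF xy(1) uv(7) _ \<open>E z x\<close>] ne(1) \<open>z \<noteq> y\<close> uv(4) z(3) by blast
  ultimately show ?thesis using z sym by blast
qed

lemma split_or_C5:
  "(\<exists>K. pseudo_split E K {}) \<or> (\<exists>K C p0 p1 p2 p3 p4. pseudo_split_C5 E K C p0 p1 p2 p3 p4)"
proof -
  define cliques where "cliques = {K. \<forall>a\<in>K. \<forall>b\<in>K. a \<noteq> b \<longrightarrow> E a b}"
  define out where "out K = card {(a, b). E a b \<and> a \<notin> K \<and> b \<notin> K}" for K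
  define N where "N = card (UNIV :: ('v \<times> 'v) set)"
  have out_le: "out K \<le> N" for K unfolding out_def N_def by (intro card_mono) auto
  have "finite cliques" "cliques \<noteq> {}" by (auto simp: cliques_def)
  \<comment> \<open>The weight encodes two criteria in one number: the second summand is at most
    \<open>N\<close>, so the size of the clique dominates and few outside edges break ties.\<close>
  from finite_has_maximum[OF this, of "\<lambda>K. card K * (N + 1) + (N - out K)"]
  obtain K where K: "K \<in> cliques"
    and max: "\<And>K'. K' \<in> cliques \<Longrightarrow> card K' * (N + 1) + (N - out K') \<le> card K * (N + 1) + (N - out K)"
    by metis
  have maxcard: "card K' \<le> card K" if "K' \<in> cliques" for K'
  proof (rule ccontr)
    assume "\<not> ?thesis"
    then have "(card K + 1) * (N + 1) \<le> card K' * (N + 1)" by (intro mult_right_mono) auto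
    then show False using max[OF that] by simp
  qed
  have few: "out K \<le> out K'" if "K' \<in> cliques" "card K' = card K" for K'
    using max[OF that(1)] that(2) out_le[of K] out_le[of K'] by simp
  have clique: "E a b" if "a \<in> K" "b \<in> K" "a \<noteq> b" for a b using K that by (auto simp: cliques_def)
  have few': "card {(a, b). E a b \<and> a \<notin> K \<and> b \<notin> K} \<le>
      card {(a, b). E a b \<and> a \<notin> insert y (K - {v}) \<and> b \<notin> insert y (K - {v})}"
    if "y \<notin> K" "v \<in> K" "\<And>w. w \<in> K - {v} \<Longrightarrow> E y w" for y v
  proof -
    have "insert y (K - {v}) \<in> cliques" using that clique sym by (auto simp: cliques_def)
    moreover have "card (insert y (K - {v})) = card K"
      using that card_Suc_Diff1[OF finite \<open>v \<in> K\<close>] by simp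
    ultimately show ?thesis using few unfolding out_def by blast
  qed
  show ?thesis
  proof (cases "\<exists>x y. E x y \<and> x \<notin> K \<and> y \<notin> K")
    case False
    have "pseudo_split E K {}" by unfold_locales (use clique False in auto)
    then show ?thesis by blast
  next
    case True
    then obtain x y where xy: "E x y" "x \<notin> K" "y \<notin> K" by blast
    have C5: ?thesis if h: "E x y" "x \<notin> K" "y \<notin> K" "u \<in> K" "v \<in> K" "u \<noteq> v" "\<not> E x u" "\<not> E x v" "\<not> E y v" "E y u"
      for x y u v
    proof -
      obtain z where "E v z" "E z x" "\<not> E z y" "\<not> E u z"
        using C5_of_edge_outside_clique[OF clique few' h] by blast
      then have "\<exists>K. pseudo_split_C5 E K {x, v, y, z, u} x v y z u"
        using h clique[of u v] sym by (intro pseudo_split_of_C5) blast+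
      then show ?thesis by blast
    qed
    have non: "\<exists>u\<in>K. \<not> E x u" if "x \<notin> K" for x
    proof (rule ccontr)
      assume "\<not> ?thesis"
      then have "insert x K \<in> cliques" using clique sym by (auto simp: cliques_def)
      from maxcard[OF this] that show False by simp
    qed
    \<comment> \<open>Otherwise \<open>u\<close> could be exchanged for both \<open>x\<close> and
      \<open>y\<close>, giving a larger clique.\<close>
    have two: "\<exists>w\<in>K - {u}. \<not> E x w \<or> \<not> E y w" if "u \<in> K" for u
    proof (rule ccontr)
      assume "\<not> ?thesis"
      then have "insert x (insert y (K - {u})) \<in> cliques" using clique sym xy by (auto simp: cliques_def)
      moreover have "card (insert x (insert y (K - {u}))) = Suc (card K)"
      proof -
        have "x \<noteq> y" using xy irrefl by blast
        then show ?thesis using xy card_Suc_Diff1[OF finite that] by simp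
      qed
      ultimately show False using maxcard by fastforce
    qed
    obtain u v where uv: "u \<in> K" "v \<in> K" "u \<noteq> v" "\<not> E x u" "\<not> E y v"
      using non[OF xy(2)] non[OF xy(3)] two by (metis DiffE singletonI)
    have ne: "x \<noteq> u" "x \<noteq> v" "y \<noteq> u" "y \<noteq> v" using xy uv by auto
    have "E u v" using clique uv by blast
    \<comment> \<open>If \<open>y\<close> sees \<open>u\<close>, then \<open>x\<close> cannot see
      \<open>v\<close> without an induced 4-cycle. If not, then \<open>x\<close> sees
      \<open>v\<close>, since otherwise \<open>xy\<close> and \<open>uv\<close> form an induced
      \<open>two_K2\<close>; this is the first situation with the roles exchanged.\<close>
    show ?thesis
    proof (cases "E y u")
      case True
      then have "\<not> E x v" using no_C4[of x y u v] xy uv ne \<open>E u v\<close> sym by blast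
      then show ?thesis using C5[of x y u v] xy uv True by blast
    next
      case False
      then have "E x v" using no_2K2[of x y u v] xy uv ne \<open>E u v\<close> by blast
      then show ?thesis using C5[of y x v u] xy uv False sym by blast
    qed
  qed
qed

end

section \<open>Powers of edge ideals\<close>

lemma C4_eq: "C4 = ({0, 1, 2, 3}, {{0, 1}, {1, 2}, {2, 3}, {3, 0}})"
proof -
  have lt: "i < 4 \<longleftrightarrow> i \<in> {0, 1, 2, 3}" for i :: nat by auto
  have "{{i, (i + 1) mod 4} | i. i < (4 :: nat)} = (\<lambda>i. {i, (i + 1) mod 4}) ` {0, 1, 2, 3}"
    unfolding lt by (rule Setcompr_eq_image)
  moreover have "{..<4} = {0, 1, 2, 3 :: nat}" by auto
  ultimately show ?thesis by (simp add: C4_def cycle_graph_def flip: numeral_2_eq_2)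
qed

lemma two_subsets: "{e. e \<subseteq> A \<and> card e = 2} = (\<Union>x\<in>A. (\<lambda>y. {x, y}) ` (A - {x}))"
  by (auto simp: card_2_iff)

lemma two_K2_eq: "two_K2 = ({0, 1, 2, 3}, {{0, 2}, {1, 3}})"
proof -
  have "(\<Union>x\<in>{0, 1, 2, 3}. (\<lambda>y. {x, y}) ` ({0, 1, 2, 3} - {x})) - {{0, 1}, {1, 2}, {2, 3}, {3, 0}} =
      {{0, 2}, {1, 3 :: nat}}"
    by (simp add: insert_Diff_if doubleton_eq_iff) (auto simp: insert_commute)
  then show ?thesis
    by (simp only: two_K2_def complement_graph_def C4_eq two_subsets fst_conv snd_conv)
qed

section \<open>From forbidden induced subgraphs to the adjacency relation\<close>

locale C4_2K2_free_graph =
  fixes G :: "'v::finite graph"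
  assumes simple: "simple_graph G" and verts: "verts G = UNIV"
    and C4_free: "induced_free C4 G" and two_K2_free: "induced_free two_K2 G"
begin

definition adj :: "'v \<Rightarrow> 'v \<Rightarrow> bool" where
  "adj x y \<longleftrightarrow> {x, y} \<in> edges G"

lemma edges_iff: "e \<in> edges G \<longleftrightarrow> (\<exists>x y. adj x y \<and> e = {x, y})"
  using simple by (fastforce simp: simple_graph_def adj_def card_2_iff)

sublocale symmetric_relation adj
  by unfold_locales (use simple in \<open>auto simp: adj_def simple_graph_def insert_commute\<close>)

lemma no_induced_copy:
  assumes "distinct [a, b, c, d]" and H: "induced_free ({0, 1, 2, 3 :: nat}, F) G"
    and F: "\<And>f. f a = 0 \<Longrightarrow> f b = 1 \<Longrightarrow> f c = 2 \<Longrightarrow> f d = 3 \<Longrightarrow>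
      F = (\<lambda>e. f ` e) ` {{x, y} | x y. adj x y \<and> x \<in> {a, b, c, d} \<and> y \<in> {a, b, c, d}}"
  shows False
proof -
  let ?f = "\<lambda>x. if x = a then 0 else if x = b then 1 else if x = c then 2 else 3 :: nat"
  have "bij_betw ?f {a, b, c, d} {0, 1, 2, 3}"
    using assms(1) by (auto simp: bij_betw_def inj_on_def)
  moreover have "F = (\<lambda>e. ?f ` e) ` {{x, y} | x y. adj x y \<and> x \<in> {a, b, c, d} \<and> y \<in> {a, b, c, d}}"
    by (rule F) (use assms(1) in auto)
  moreover have "{e \<in> edges G. e \<subseteq> {a, b, c, d}} = {{x, y} | x y. adj x y \<and> x \<in> {a, b, c, d} \<and> y \<in> {a, b, c, d}}"
    unfolding edges_iff by blast
  ultimately have "graph_iso (induced G {a, b, c, d}) ({0, 1, 2, 3}, F)"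
    unfolding graph_iso_def induced_def fst_conv snd_conv by (intro exI[of _ ?f] conjI) simp_all
  then show False using H verts by (auto simp: induced_free_def)
qed

sublocale C4_2K2_free adj
proof
  fix a b c d
  show "adj a c \<or> adj b d" if h: "adj a b" "adj b c" "adj c d" "adj d a" "a \<noteq> c" "b \<noteq> d"
  proof (rule ccontr)
    assume "\<not> ?thesis"
    then have n: "\<not> adj a c" "\<not> adj b d" "\<not> adj c a" "\<not> adj d b" using sym by blast+
    have d: "distinct [a, b, c, d]" using h irrefl by auto
    have edges: "{{x, y} | x y. adj x y \<and> x \<in> {a, b, c, d} \<and> y \<in> {a, b, c, d}} = {{a, b}, {b, c}, {c, d}, {d, a}}"
      (is "?P = ?Q")
    proof (intro equalityI subsetI)
      fix e assume "e \<in> ?P"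
      then obtain x y where "e = {x, y}" "adj x y" "x \<in> {a, b, c, d}" "y \<in> {a, b, c, d}" by blast
      moreover from this have "(x, y) \<in> {(a, b), (b, a), (b, c), (c, b), (c, d), (d, c), (d, a), (a, d)}"
        using n irrefl by auto
      ultimately show "e \<in> ?Q" by (auto simp: insert_commute)
    next
      fix e assume "e \<in> ?Q"
      then show "e \<in> ?P" using h by blast
    qed
    then show False
      by (intro no_induced_copy[OF d C4_free[unfolded C4_eq]], unfold edges) auto
  qed
  show "adj a c \<or> adj a d \<or> adj b c \<or> adj b d"
    if h: "adj a b" "adj c d" "a \<noteq> c" "a \<noteq> d" "b \<noteq> c" "b \<noteq> d"
  proof (rule ccontr)
    assume "\<not> ?thesis"
    then have n: "\<not> adj a c" "\<not> adj a d" "\<not> adj b c" "\<not> adj b d"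
      "\<not> adj c a" "\<not> adj d a" "\<not> adj c b" "\<not> adj d b" using sym by blast+
    \<comment> \<open>The order of the list matters: the edges of \<open>two_K2\<close> join
      positions 0 and 2, and 1 and 3.\<close>
    have d: "distinct [a, c, b, d]" using h irrefl by auto
    have edges: "{{x, y} | x y. adj x y \<and> x \<in> {a, c, b, d} \<and> y \<in> {a, c, b, d}} = {{a, b}, {c, d}}"
      (is "?P = ?Q")
    proof (intro equalityI subsetI)
      fix e assume "e \<in> ?P"
      then obtain x y where "e = {x, y}" "adj x y" "x \<in> {a, c, b, d}" "y \<in> {a, c, b, d}" by blast
      moreover from this have "(x, y) \<in> {(a, b), (b, a), (c, d), (d, c)}"
        using n irrefl by auto
      ultimately show "e \<in> ?Q" by (auto simp: insert_commute)
    next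
      fix e assume "e \<in> ?Q"
      then show "e \<in> ?P" using h by blast
    qed
    then show False
      by (intro no_induced_copy[OF d two_K2_free[unfolded two_K2_eq]], unfold edges) auto
  qed
qed

end

section \<open>Powers of the edge ideal as monomial ideals\<close>

lemma monomial_ideal_product:
  fixes A B :: "('v::finite \<Rightarrow>\<^sub>0 nat) set"
  shows "ideal_of {a * b | a b. a \<in> monomial_ideal A \<and> b \<in> monomial_ideal B} =
    (monomial_ideal {x + y | x y. x \<in> A \<and> y \<in> B} :: ('v, 'k::comm_ring_1) mpoly set)"
proof
  show "ideal_of {a * b | a b. a \<in> monomial_ideal A \<and> b \<in> monomial_ideal B} \<subseteq>
      (monomial_ideal {x + y | x y. x \<in> A \<and> y \<in> B} :: ('v, 'k) mpoly set)"
  proof (rule ideal_of_minimal)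
    show "{a * b | a b. a \<in> monomial_ideal A \<and> b \<in> monomial_ideal B} \<subseteq>
        (monomial_ideal {x + y | x y. x \<in> A \<and> y \<in> B} :: ('v, 'k) mpoly set)"
    proof clarify
      fix a b :: "('v, 'k) mpoly" assume ab: "a \<in> monomial_ideal A" "b \<in> monomial_ideal B"
      show "a * b \<in> monomial_ideal {x + y | x y. x \<in> A \<and> y \<in> B}"
        unfolding monomial_ideal_def
      proof clarify
        fix m assume "m \<in> Poly_Mapping.keys (a * b)"
        then obtain m1 m2 where m: "m = m1 + m2" "m1 \<in> Poly_Mapping.keys a" "m2 \<in> Poly_Mapping.keys b"
          using keys_mult[of a b] by blast
        then obtain x n1 y n2 where "x \<in> A" "m1 = n1 + x" "y \<in> B" "m2 = n2 + y"
          using ab unfolding monomial_ideal_def by blast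
        moreover from this have "m = (n1 + n2) + (x + y)" using m by (simp add: ac_simps)
        ultimately show "\<exists>b\<in>{x + y | x y. x \<in> A \<and> y \<in> B}. \<exists>n. m = n + b" by blast
      qed
    qed
  qed (auto intro: monomial_ideal_zero monomial_ideal_add monomial_ideal_mult)
  have gen: "Poly_Mapping.single x (1 :: 'k) \<in> monomial_ideal X" if "x \<in> X" for x :: "'v \<Rightarrow>\<^sub>0 nat" and X
    using that unfolding monomial_ideal_eq by (intro ideal_of_base) blast
  show "monomial_ideal {x + y | x y. x \<in> A \<and> y \<in> B} \<subseteq>
      (ideal_of {a * b | a b. a \<in> monomial_ideal A \<and> b \<in> monomial_ideal B} :: ('v, 'k) mpoly set)"
    unfolding monomial_ideal_eq[of "{x + y | x y. x \<in> A \<and> y \<in> B}"]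
  proof (rule ideal_of_minimal)
    show "(\<lambda>b. Poly_Mapping.single b 1) ` {x + y | x y. x \<in> A \<and> y \<in> B} \<subseteq>
        (ideal_of {a * b | a b. a \<in> monomial_ideal A \<and> b \<in> monomial_ideal B} :: ('v, 'k) mpoly set)"
    proof clarify
      fix x y assume "x \<in> A" "y \<in> B"
      then have "Poly_Mapping.single x 1 * Poly_Mapping.single y (1 :: 'k) \<in>
          ideal_of {a * b | a b. a \<in> monomial_ideal A \<and> b \<in> monomial_ideal B}"
        by (intro ideal_of_base) (use gen in blast)
      then show "Poly_Mapping.single (x + y) (1 :: 'k) \<in>
          ideal_of {a * b | a b. a \<in> monomial_ideal A \<and> b \<in> monomial_ideal B}"
        by (simp add: mult_single)
    qed
  qed (auto intro: ideal_of_zero ideal_of_add ideal_of_mult)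
qed

context symmetric_relation
begin

lemma edge_sums_0: "edge_sums E 0 = {0}"
  by (auto simp: edge_sums_def)

lemma edge_sums_Suc_eq: "edge_sums E (Suc s) = {x + y | x y. x \<in> {evar u + evar v | u v. E u v} \<and> y \<in> edge_sums E s}"
proof
  show "edge_sums E (Suc s) \<subseteq> {x + y | x y. x \<in> {evar u + evar v | u v. E u v} \<and> y \<in> edge_sums E s}"
  proof
    fix m assume "m \<in> edge_sums E (Suc s)"
    then obtain W where W: "edge_multiset E W" "size W = Suc s" "m = degrees W" by (auto simp: edge_sums_def)
    then obtain e W' where "W = add_mset e W'" by (metis size_eq_Suc_imp_eq_union)
    moreover from this obtain u v where "E u v" "e = {u, v}" using W(1) by auto
    ultimately have "m = (evar u + evar v) + degrees W'" "degrees W' \<in> edge_sums E s" "E u v"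
      using W by (auto simp: degrees_add ac_simps intro: edge_sumsI)
    then show "m \<in> {x + y | x y. x \<in> {evar u + evar v | u v. E u v} \<and> y \<in> edge_sums E s}" by blast
  qed
  show "{x + y | x y. x \<in> {evar u + evar v | u v. E u v} \<and> y \<in> edge_sums E s} \<subseteq> edge_sums E (Suc s)"
  proof clarify
    fix u v y assume "E u v" "y \<in> edge_sums E s"
    then show "evar u + evar v + y \<in> edge_sums E (Suc s)"
      using edge_sums_Suc[of u v y s] by (simp add: ac_simps)
  qed
qed

lemma finite_edge_sums: "finite (edge_sums E s)"
proof (induction s)
  case (Suc s)
  have "edge_sums E (Suc s) \<subseteq> (\<lambda>((u, v), y). evar u + evar v + y) ` (UNIV \<times> edge_sums E s)"
  proof
    fix m assume "m \<in> edge_sums E (Suc s)"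
    then obtain u v y where "m = evar u + evar v + y" "y \<in> edge_sums E s"
      unfolding edge_sums_Suc_eq by blast
    then show "m \<in> (\<lambda>((u, v), y). evar u + evar v + y) ` (UNIV \<times> edge_sums E s)"
      by (intro image_eqI[of _ _ "((u, v), y)"]) auto
  qed
  then show ?case by (rule finite_subset) (simp add: Suc)
qed (simp add: edge_sums_0)

lemma mdeg_edge_sums: "m \<in> edge_sums E s \<Longrightarrow> mdeg m = 2 * s"
  using total_UNIV by (auto simp: edge_sums_def mdeg_UNIV total_def)

end

context C4_2K2_free_graph
begin

lemma edge_ideal_eq:
  "edge_ideal G = (monomial_ideal {evar u + evar v | u v. adj u v} :: ('v, 'k::field) mpoly set)"
proof -
  have "{Var u * Var v | u v. {u, v} \<in> edges G} =
      (\<lambda>b. Poly_Mapping.single b (1 :: 'k)) ` {evar u + evar v | u v. adj u v}"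
    by (force simp: Var_def mult_single adj_def)
  then show ?thesis by (simp add: edge_ideal_def monomial_ideal_eq)
qed

lemma ideal_power_eq:
  "ideal_power (edge_ideal G) s = (monomial_ideal (edge_sums adj s) :: ('v, 'k::field) mpoly set)"
proof (induction s)
  case 0
  show ?case by (simp add: edge_sums_0 monomial_ideal_def)
next
  case (Suc s)
  show ?case
    unfolding ideal_power.simps Suc unfolding edge_ideal_eq monomial_ideal_product edge_sums_Suc_eq ..
qed

end

theorem theorem2p12:
  fixes G :: "'v::finite graph" and s :: nat
  assumes "simple_graph G" and "verts G = UNIV"
    and "induced_free C4 G" and "induced_free two_K2 G"
    and "s \<ge> 2"
  shows "has_linear_resolution (ideal_power (edge_ideal G :: ('v, 'k::field) mpoly set) s)"
proof -
  interpret C4_2K2_free_graph G by unfold_locales (fact assms)+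
  have "\<exists>r. transp r \<and> asymp r \<and> (\<forall>u\<in>edge_sums adj s. \<forall>w\<in>edge_sums adj s. u \<noteq> w \<longrightarrow> r w u \<or>
      (\<exists>a b w'. w' \<in> edge_sums adj s \<and> w' + evar b = w + evar a \<and> exponent w a < exponent u a \<and> r w' w))"
    using split_or_C5
  proof (elim disjE exE)
    fix K assume "pseudo_split adj K {}"
    then interpret pseudo_split adj K "{}" .
    show ?thesis
    \<comment> \<open>Without a cycle, monomials that agree on \<open>K\<close> and have no
      variables from \<open>S\<close> coincide, so no further keys are needed.\<close>
    proof (rule edge_sums_linear_quotients[where fc = "[]"])
      fix u w assume "u \<noteq> w" "\<And>v. v \<in> K \<Longrightarrow> exponent u v = exponent w v"
        "\<And>v. v \<in> S \<Longrightarrow> exponent u v = 0 \<and> exponent w v = 0"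
      then have "u = w" by (intro poly_mapping_eqI) force
      with \<open>u \<noteq> w\<close> show "lexless [] w u \<or> (\<exists>a\<in>{}. \<exists>b\<in>{}. \<exists>w'\<in>edge_sums adj s. w' + evar b = w + evar a \<and>
        exponent w a < exponent u a \<and> lexless [] w' w)" by blast
    qed simp
  next
    fix K C p0 p1 p2 p3 p4 assume "pseudo_split_C5 adj K C p0 p1 p2 p3 p4"
    then interpret pseudo_split_C5 adj K C p0 p1 p2 p3 p4 .
    show ?thesis
      by (rule edge_sums_linear_quotients[where fc = cycle_order])
        (use cycle_order_cong cycle_order_move[OF \<open>s \<ge> 2\<close>] in blast)+
  qed
  then obtain r where "transp r" "asymp r"
    "\<forall>u\<in>edge_sums adj s. \<forall>w\<in>edge_sums adj s. u \<noteq> w \<longrightarrow> r w u \<or>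
      (\<exists>a b w'. w' \<in> edge_sums adj s \<and> w' + evar b = w + evar a \<and> exponent w a < exponent u a \<and> r w' w)"
    by blast
  then have "linear_quot (2 * s) (emb (monomial_ideal (edge_sums adj s)) :: (nat \<Rightarrow> ('v, 'k) mpoly) set) zero_mod"
    by (intro linear_quotients[OF finite_edge_sums mdeg_edge_sums]) auto
  then show ?thesis
    unfolding ideal_power_eq by (rule linear_quot_imp_linear_resolution) (rule mdeg_edge_sums)
qed

end
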